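(* Let $\mathfrak{A}$ be a $C^*$-algebra and let $H$ and $K$ be Hilbert $\mathfrak{A}$-modules. For every $T\in\mathcal{L}(H,K)$ and every $\alpha\in(0,1)$, there exists $U\in\mathcal{L}(H,K)$ such that (i) $T=U|T|^\alpha$ and $T^*=U^*|T^*|^\alpha$; (ii) $U^*U=|T|^{2(1-\alpha)}$ and $UU^*=|T^*|^{2(1-\alpha)}$; (iii) $U|T|^\beta=|T^*|^\beta U$ for every $\beta>0$.
   Context: For Hilbert $\mathfrak{A}$-modules $H,K$, $\mathcal{L}(H,K)$ denotes the set of adjointable operators from $H$ to $K$, and $\mathcal{L}(H)=\mathcal{L}(H,H)$, a unital $C^*$-algebra. For $T\in\mathcal{L}(H,K)$, $|T|=(T^*T)^{1/2}\in\mathcal{L}(H)$ and $|T^*|=(TT^* )^{1/2}\in\mathcal{L}(K)$; powers $|T|^\beta$ with $\beta>0$ are defined by the continuous functional calculus. *)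

theory Defs
  imports "HOL-Analysis.Analysis"
begin

class complex_normed_vector = real_normed_vector +
  fixes scaleC :: "complex \<Rightarrow> 'a \<Rightarrow> 'a"  (infixr \<open>*\<^sub>C\<close> 75)
  assumes scaleC_add_right: "c *\<^sub>C (x + y) = c *\<^sub>C x + c *\<^sub>C y"
    and scaleC_add_left: "(c + d) *\<^sub>C x = c *\<^sub>C x + d *\<^sub>C x"
    and scaleC_scaleC: "c *\<^sub>C (d *\<^sub>C x) = (c * d) *\<^sub>C x"
    and scaleC_of_real: "complex_of_real r *\<^sub>C x = r *\<^sub>R x"
    and norm_scaleC: "norm (c *\<^sub>C x) = cmod c * norm x"

text \<open>C*-algebras need not have a unit: \<^class>\<open>real_normed_algebra\<close> does not require one.\<close>

class c_star_algebra = complex_normed_vector + real_normed_algebra + banach +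
  fixes cstar :: "'a \<Rightarrow> 'a"
  assumes mult_scaleC_left: "(c *\<^sub>C x) * y = c *\<^sub>C (x * y)"
    and mult_scaleC_right: "x * (c *\<^sub>C y) = c *\<^sub>C (x * y)"
    and cstar_cstar: "cstar (cstar x) = x"
    and cstar_add: "cstar (x + y) = cstar x + cstar y"
    and cstar_scaleC: "cstar (c *\<^sub>C x) = cnj c *\<^sub>C cstar x"
    and cstar_mult: "cstar (x * y) = cstar y * cstar x"
    and norm_cstar_mult: "norm (cstar x * x) = (norm x)\<^sup>2"

definition cstar_positive :: "'a::c_star_algebra \<Rightarrow> bool" where
  "cstar_positive a \<longleftrightarrow> (\<exists>b. a = cstar b * b)"

text \<open>
  Right modules, with an inner product that is linear in the second argument.  The norm of the
  type \<open>'h\<close> is the one induced by the inner product (as in \<^class>\<open>real_inner\<close>), and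
  \<^class>\<open>banach\<close> expresses completeness with respect to it.
\<close>

locale hilbert_module =
  fixes act :: "'h::{complex_normed_vector, banach} \<Rightarrow> 'a::c_star_algebra \<Rightarrow> 'h"
    and ip :: "'h \<Rightarrow> 'h \<Rightarrow> 'a"
  assumes act_add_left: "act (x + y) a = act x a + act y a"
    and act_add_right: "act x (a + b) = act x a + act x b"
    and act_mult: "act x (a * b) = act (act x a) b"
    and act_scaleC_left: "act (c *\<^sub>C x) a = c *\<^sub>C act x a"
    and act_scaleC_right: "act x (c *\<^sub>C a) = c *\<^sub>C act x a"
    and ip_add_right: "ip x (y + z) = ip x y + ip x z"
    and ip_scaleC_right: "ip x (c *\<^sub>C y) = c *\<^sub>C ip x y"
    and ip_act_right: "ip x (act y a) = ip x y * a"
    and cstar_ip: "cstar (ip x y) = ip y x"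
    and ip_positive: "cstar_positive (ip x x)"
    and ip_definite: "ip x x = 0 \<Longrightarrow> x = 0"
    and norm_eq_sqrt_norm_ip: "norm x = sqrt (norm (ip x x))"

text \<open>Linearity and boundedness are consequences of adjointability.\<close>

definition adjointable :: "('h \<Rightarrow> 'h \<Rightarrow> 'a) \<Rightarrow> ('k \<Rightarrow> 'k \<Rightarrow> 'a) \<Rightarrow> ('h \<Rightarrow> 'k) set" where
  "adjointable ipH ipK = {T. \<exists>S. \<forall>x y. ipK (T x) y = ipH x (S y)}"

definition module_adj ::
    "('h \<Rightarrow> 'h \<Rightarrow> 'a) \<Rightarrow> ('k \<Rightarrow> 'k \<Rightarrow> 'a) \<Rightarrow> ('h \<Rightarrow> 'k) \<Rightarrow> 'k \<Rightarrow> 'h" where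
  "module_adj ipH ipK T = (THE S. \<forall>x y. ipK (T x) y = ipH x (S y))"

definition op_spectrum ::
    "('h::complex_normed_vector \<Rightarrow> 'h \<Rightarrow> 'a) \<Rightarrow> ('h \<Rightarrow> 'h) \<Rightarrow> complex set" where
  "op_spectrum ip A =
     {z. \<not> (\<exists>R\<in>adjointable ip ip. R \<circ> (\<lambda>x. A x - z *\<^sub>C x) = id \<and> (\<lambda>x. A x - z *\<^sub>C x) \<circ> R = id)}"

text \<open>
  \<open>is_cfc ip A \<Phi>\<close>: \<open>\<Phi>\<close> is a unital *-homomorphism from the algebra of continuous functions on the
  spectrum of \<open>A\<close> to the algebra of adjointable operators, and maps the identity function to \<open>A\<close>.
  An element of the function algebra is represented by any function on the complex numbers that
  restricts to it; the second conjunct makes \<open>\<Phi>\<close> independent of the representative.  For normal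
  \<open>A\<close> such a \<open>\<Phi>\<close> exists, and its values on continuous functions are uniquely determined.
\<close>

definition is_cfc ::
    "('h::complex_normed_vector \<Rightarrow> 'h \<Rightarrow> 'a) \<Rightarrow> ('h \<Rightarrow> 'h) \<Rightarrow>
     ((complex \<Rightarrow> complex) \<Rightarrow> 'h \<Rightarrow> 'h) \<Rightarrow> bool" where
  "is_cfc ip A \<Phi> \<longleftrightarrow>
     (let C = {f. continuous_on (op_spectrum ip A) f} in
       (\<forall>f\<in>C. \<Phi> f \<in> adjointable ip ip) \<and>
       (\<forall>f\<in>C. \<forall>g\<in>C. (\<forall>z\<in>op_spectrum ip A. f z = g z) \<longrightarrow> \<Phi> f = \<Phi> g) \<and>
       (\<forall>f\<in>C. \<forall>g\<in>C. \<Phi> (\<lambda>z. f z + g z) = (\<lambda>x. \<Phi> f x + \<Phi> g x)) \<and>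
       (\<forall>f\<in>C. \<forall>c. \<Phi> (\<lambda>z. c * f z) = (\<lambda>x. c *\<^sub>C \<Phi> f x)) \<and>
       (\<forall>f\<in>C. \<forall>g\<in>C. \<Phi> (\<lambda>z. f z * g z) = \<Phi> f \<circ> \<Phi> g) \<and>
       (\<forall>f\<in>C. \<Phi> (\<lambda>z. cnj (f z)) = module_adj ip ip (\<Phi> f)) \<and>
       \<Phi> (\<lambda>z. 1) = id \<and>
       \<Phi> (\<lambda>z. z) = A)"

definition cfc ::
    "('h::complex_normed_vector \<Rightarrow> 'h \<Rightarrow> 'a) \<Rightarrow> (complex \<Rightarrow> complex) \<Rightarrow> ('h \<Rightarrow> 'h) \<Rightarrow> 'h \<Rightarrow> 'h" where
  "cfc ip f A = (THE B. \<exists>\<Phi>. is_cfc ip A \<Phi> \<and> B = \<Phi> f)"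

text \<open>
  For positive \<open>A\<close>, whose spectrum consists of nonnegative reals, and \<open>\<beta> > 0\<close>; note
  \<open>0 powr \<beta> = 0\<close>.
\<close>

definition op_powr ::
    "('h::complex_normed_vector \<Rightarrow> 'h \<Rightarrow> 'a) \<Rightarrow> ('h \<Rightarrow> 'h) \<Rightarrow> real \<Rightarrow> 'h \<Rightarrow> 'h" where
  "op_powr ip A \<beta> = cfc ip (\<lambda>z. complex_of_real (Re z powr \<beta>)) A"

definition op_abs ::
    "('h::complex_normed_vector \<Rightarrow> 'h \<Rightarrow> 'a) \<Rightarrow> ('k \<Rightarrow> 'k \<Rightarrow> 'a) \<Rightarrow> ('h \<Rightarrow> 'k) \<Rightarrow> 'h \<Rightarrow> 'h" where
  "op_abs ipH ipK T = op_powr ipH (module_adj ipH ipK T \<circ> T) (1 / 2)"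

end

(*
Put A = T* T and B = T T*, so that |T|^b and |T*|^b are the (b/2)-th powers of A and B.  With f_n a
continuous truncation of t^(-alpha/2) near 0, the operators T f_n(A) converge pointwise,
because ||T d(A)||^2 is controlled by the supremum of t |d(t)|^2 over the spectrum; the limit U plays the role
of "T |T|^(-alpha)".  Intertwining T g(A) = g(B) T, clear for polynomials, passes to continuous g and
shows that the adjoint of U is the same construction for T*.  All identities follow by taking limits.

The functional calculus itself rests on the estimate ||p(A)|| <= C sup |p| over the spectrum, which needs
the spectral radius only of selfadjoint elements.  A C*-inequality ||a||^2 <= C ||a* a|| with a constant
suffices for it, so that a weak Cauchy-Schwarz inequality is enough to start with.  Positivity of T* T
is reduced to the implication b* b + c* c = 0 ==> c* c = 0 in the coefficient algebra, which is an
instance of Kaplansky's theorem that all b* b are positive.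
*)

theory Submission
  imports Defs "HOL-Computational_Algebra.Fundamental_Theorem_Algebra"
begin

subsection \<open>Neumann series and the spectrum\<close>

text \<open>Closed submodules of a Hilbert module need not be complemented, so T = U |T| with a
  partial isometry U may fail. Stopping at \<alpha> < 1 avoids this: multiplied by t^(1/2), the
  function t^(-\<alpha>/2) becomes t^((1-\<alpha>)/2), which is continuous and vanishes at 0, and
  this is what makes the operators T f_n(A) a Cauchy sequence.

  \<open>cfc\<close> is a definite description, so the powers in the statement have a known value
  only once existence and uniqueness of the calculus are both proved, and uniqueness has to cover
  competitors that are not assumed continuous.

  The sharp Cauchy-Schwarz inequality is usually drawn from the order of the coefficient algebra,
  which itself rests on a functional calculus. Polarisation gives the constant 4 without that order.
  Testing positivity by norms, however, requires the constant 1. Hence one development with a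
  parameter \<open>C\<close>, instantiated with 4 for operators on modules and with 1 for left
  multiplications on the coefficient algebra.\<close>

lemma scaleC_zero_right [simp]: "c *\<^sub>C (0::'a::complex_normed_vector) = 0"
  using scaleC_add_right[of c "0::'a" 0] by simp

lemma scaleC_zero_left [simp]: "0 *\<^sub>C (x::'a::complex_normed_vector) = 0"
  using scaleC_add_left[of 0 0 x] by simp

lemma scaleC_one [simp]: "1 *\<^sub>C (x::'a::complex_normed_vector) = x"
  using scaleC_of_real[of 1 x] by simp

lemma scaleC_minus_right: "c *\<^sub>C (- (x::'a::complex_normed_vector)) = - (c *\<^sub>C x)"
  using scaleC_add_right[of c x "-x"] by (simp add: eq_neg_iff_add_eq_0 add.commute)

lemma scaleC_minus_left: "(- c) *\<^sub>C (x::'a::complex_normed_vector) = - (c *\<^sub>C x)"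
  using scaleC_add_left[of c "-c" x] by (simp add: eq_neg_iff_add_eq_0 add.commute)

lemma scaleC_diff_right: "c *\<^sub>C (x - y) = c *\<^sub>C x - c *\<^sub>C (y::'a::complex_normed_vector)"
  using scaleC_add_right[of c x "-y"] by (simp add: scaleC_minus_right)

lemma scaleC_diff_left: "(c - d) *\<^sub>C x = c *\<^sub>C x - d *\<^sub>C (x::'a::complex_normed_vector)"
  using scaleC_add_left[of c "-d" x] by (simp add: scaleC_minus_left)

lemma scaleC_scaleR: "c *\<^sub>C (r *\<^sub>R x) = r *\<^sub>R (c *\<^sub>C (x::'a::complex_normed_vector))"
  by (simp add: scaleC_of_real[symmetric] scaleC_scaleC mult.commute)

lemma bounded_bilinear_scaleC:
  "bounded_bilinear (scaleC :: complex \<Rightarrow> 'a \<Rightarrow> 'a::complex_normed_vector)"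
proof
  show "(r *\<^sub>R c) *\<^sub>C x = r *\<^sub>R (c *\<^sub>C x)" for r c and x :: 'a
    by (simp add: scaleC_of_real[symmetric] scaleC_scaleC scaleR_conv_of_real)
  show "\<exists>K. \<forall>c (x::'a). norm (c *\<^sub>C x) \<le> norm c * norm x * K"
    by (rule exI[of _ 1]) (simp add: norm_scaleC)
qed (simp_all add: scaleC_add_left scaleC_add_right scaleC_scaleR)

lemmas tendsto_scaleC = bounded_bilinear.tendsto[OF bounded_bilinear_scaleC]

text \<open>
  The operator algebra of the zero space satisfies \<open>0 = 1\<close>, so the class must not
  extend \<^class>\<open>ring_1\<close>.
\<close>

class complex_banach_algebra = complex_normed_vector + real_normed_algebra + banach + monoid_mult +
  assumes scaleC_mult_left: "(c *\<^sub>C x) * y = c *\<^sub>C (x * y)"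
    and scaleC_mult_right: "x * (c *\<^sub>C y) = c *\<^sub>C (x * y)"
    and norm_one_le: "norm 1 \<le> 1"

lemma norm_power_le: "norm (x ^ n) \<le> norm (x::'a::complex_banach_algebra) ^ n"
proof (induction n)
  case 0 then show ?case by (simp add: norm_one_le)
next
  case (Suc n)
  have "norm (x ^ Suc n) \<le> norm x * norm (x ^ n)" by (simp add: norm_mult_ineq)
  also have "\<dots> \<le> norm x * norm x ^ n" using Suc by (intro mult_left_mono) auto
  finally show ?case by simp
qed

lemma power_scaleC: "(c *\<^sub>C x) ^ n = (c ^ n) *\<^sub>C (x ^ n)" for x :: "'a::complex_banach_algebra"
  by (induction n) (simp_all add: scaleC_mult_left scaleC_mult_right scaleC_scaleC mult.commute)

text \<open>Adjointability depends on the inner product, which is a term, so the algebra is a set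
  \<open>L\<close> inside a type of operators and \<open>star\<close> is controlled on
  \<open>L\<close> only. \<open>C\<close> measures the deviation from a C*-norm.\<close>

locale cstar_subalgebra =
  fixes L :: "'r::complex_banach_algebra set" and star :: "'r \<Rightarrow> 'r" and C :: real
  assumes one_mem [simp]: "1 \<in> L"
    and add_mem [simp]: "a \<in> L \<Longrightarrow> b \<in> L \<Longrightarrow> a + b \<in> L"
    and mult_mem [simp]: "a \<in> L \<Longrightarrow> b \<in> L \<Longrightarrow> a * b \<in> L"
    and scaleC_mem [simp]: "a \<in> L \<Longrightarrow> c *\<^sub>C a \<in> L"
    and closed_L: "closed L"
    and star_mem [simp]: "a \<in> L \<Longrightarrow> star a \<in> L"
    and star_star [simp]: "a \<in> L \<Longrightarrow> star (star a) = a"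
    and star_add: "a \<in> L \<Longrightarrow> b \<in> L \<Longrightarrow> star (a + b) = star a + star b"
    and star_mult: "a \<in> L \<Longrightarrow> b \<in> L \<Longrightarrow> star (a * b) = star b * star a"
    and star_scaleC: "a \<in> L \<Longrightarrow> star (c *\<^sub>C a) = cnj c *\<^sub>C star a"
    and C_ge_1: "1 \<le> C"
    and norm_le_star: "a \<in> L \<Longrightarrow> (norm a)\<^sup>2 \<le> C * norm (star a * a)"
begin

lemma uminus_mem [simp]: "a \<in> L \<Longrightarrow> - a \<in> L"
  using scaleC_mem[of a "-1"] by (simp add: scaleC_minus_left)

lemma diff_mem [simp]: "a \<in> L \<Longrightarrow> b \<in> L \<Longrightarrow> a - b \<in> L"
  using add_mem[of a "-b"] by simp

lemma zero_mem [simp]: "0 \<in> L"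
  using scaleC_mem[OF one_mem, of 0] by simp

lemma power_mem [simp]: "a \<in> L \<Longrightarrow> a ^ n \<in> L"
  by (induction n) auto

lemma star_one [simp]: "star 1 = 1"
  using star_mult[of "star 1" 1] by simp

lemma star_minus: "a \<in> L \<Longrightarrow> star (- a) = - star a"
  using star_scaleC[of a "-1"] by (simp add: scaleC_minus_left)

lemma star_diff: "a \<in> L \<Longrightarrow> b \<in> L \<Longrightarrow> star (a - b) = star a - star b"
  using star_add[of a "-b"] by (simp add: star_minus)

lemma star_power: "a \<in> L \<Longrightarrow> star (a ^ n) = star a ^ n"
  by (induction n) (auto simp: star_mult power_commutes)

text \<open>Continuity of \<open>star\<close> is not assumed; it comes from this bound, found by
  cancelling one factor \<open>norm a\<close> in the weak C*-inequality.\<close>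

lemma norm_le_norm_star: "a \<in> L \<Longrightarrow> norm a \<le> C * norm (star a)"
proof (cases "norm a = 0")
  case False
  assume a: "a \<in> L"
  have "norm a * norm a \<le> C * norm (star a * a)"
    using norm_le_star[OF a] by (simp add: power2_eq_square)
  also have "\<dots> \<le> C * (norm (star a) * norm a)"
    using C_ge_1 by (intro mult_left_mono norm_mult_ineq) auto
  finally show ?thesis using False by (simp add: mult.assoc[symmetric])
qed (use C_ge_1 in auto)

definition inverse_of :: "'r \<Rightarrow> 'r \<Rightarrow> bool" where
  "inverse_of a b \<longleftrightarrow> b \<in> L \<and> a * b = 1 \<and> b * a = 1"

definition invertible_in :: "'r \<Rightarrow> bool" where
  "invertible_in a \<longleftrightarrow> (\<exists>b. inverse_of a b)"

definition spec :: "'r \<Rightarrow> complex set" where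
  "spec a = {z. \<not> invertible_in (a - z *\<^sub>C 1)}"

lemma inverse_of_unique: "inverse_of a b \<Longrightarrow> inverse_of a c \<Longrightarrow> b = c"
  unfolding inverse_of_def by (metis mult.assoc mult.left_neutral mult.right_neutral)

lemma inverse_of_one: "inverse_of 1 1"
  by (simp add: inverse_of_def)

lemma inverse_of_mult: "inverse_of a b \<Longrightarrow> inverse_of c d \<Longrightarrow> inverse_of (a * c) (d * b)"
  unfolding inverse_of_def by (metis mult.assoc mult.left_neutral mult_mem)

lemma invertible_in_mult: "invertible_in a \<Longrightarrow> invertible_in b \<Longrightarrow> invertible_in (a * b)"
  unfolding invertible_in_def using inverse_of_mult by blast

lemma inverse_of_scaleC: "inverse_of a b \<Longrightarrow> c \<noteq> 0 \<Longrightarrow> inverse_of (c *\<^sub>C a) (inverse c *\<^sub>C b)"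
  by (simp add: inverse_of_def scaleC_mult_left scaleC_mult_right scaleC_scaleC)

lemma invertible_in_scaleC_iff: "c \<noteq> 0 \<Longrightarrow> invertible_in (c *\<^sub>C a) \<longleftrightarrow> invertible_in a"
  unfolding invertible_in_def
  using inverse_of_scaleC[of a _ c] inverse_of_scaleC[of "c *\<^sub>C a" _ "inverse c"]
  by (auto simp: scaleC_scaleC)

lemma invertible_in_if_one_sided:
  assumes "l \<in> L" "r \<in> L" "a * r = 1" "l * a = 1"
  shows "invertible_in a"
proof -
  have "l = r" using assms by (metis mult.assoc mult.left_neutral mult.right_neutral)
  then show ?thesis using assms unfolding invertible_in_def inverse_of_def by blast
qed

text \<open>The distance of the inverse from 1 is recorded because \<open>inverse_of_perturb\<close>
  and \<open>powers_tendsto_zero\<close> argue quantitatively with it.\<close>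

lemma neumann:
  assumes x: "x \<in> L" and n: "norm x < 1"
  obtains b where "inverse_of (1 - x) b" "norm (b - 1) \<le> norm x / (1 - norm x)"
proof -
  define b where "b = (\<Sum>n. x ^ n)"
  have sn: "summable (\<lambda>n. norm (x ^ n))"
    by (rule summable_comparison_test'[of "\<lambda>n. norm x ^ n" 0]) (use n in \<open>auto simp: norm_power_le\<close>)
  then have s: "summable (\<lambda>n. x ^ n)" by (rule summable_norm_cancel)
  have "(\<lambda>n. \<Sum>i<n. x ^ i) \<longlonglongrightarrow> b"
    unfolding b_def using s by (rule summable_LIMSEQ)
  moreover have "(\<Sum>i<n. x ^ i) \<in> L" for n
    by (induction n) (auto simp: x)
  ultimately have bL: "b \<in> L"
    using closed_L closed_sequentially by metis
  have split: "b = 1 + (\<Sum>n. x ^ Suc n)"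
  proof -
    have "(\<Sum>n. x ^ Suc n) = b - x ^ 0" unfolding b_def by (rule suminf_split_head[OF s])
    then have "(\<Sum>n. x ^ Suc n) = b - 1" by (simp only: power_0)
    then show ?thesis by (metis add_diff_cancel_left' add.commute diff_add_cancel)
  qed
  have "x * b = b - 1"
  proof -
    have "x * b = (\<Sum>n. x * x ^ n)" unfolding b_def by (simp add: suminf_mult[OF s])
    then have "x * b = (\<Sum>n. x ^ Suc n)" by (simp only: power_Suc)
    then show ?thesis using split by (metis add_diff_cancel_left')
  qed
  moreover have "b * x = b - 1"
  proof -
    have "b * x = (\<Sum>n. x ^ n * x)" unfolding b_def by (simp add: suminf_mult2[OF s])
    also have "\<dots> = (\<Sum>n. x ^ Suc n)" by (simp only: power_Suc2)
    finally show ?thesis using split by (metis add_diff_cancel_left')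
  qed
  ultimately have inv: "inverse_of (1 - x) b"
    using bL by (simp add: inverse_of_def algebra_simps)
  have "norm b \<le> (\<Sum>n. norm (x ^ n))" unfolding b_def by (rule summable_norm[OF sn])
  also have "\<dots> \<le> (\<Sum>n. norm x ^ n)"
    by (rule suminf_le) (use n sn in \<open>auto simp: norm_power_le\<close>)
  also have "\<dots> = 1 / (1 - norm x)" using n by (simp add: suminf_geometric)
  finally have nb: "norm b \<le> 1 / (1 - norm x)" .
  have "norm (b - 1) \<le> norm x * norm b"
    using \<open>x * b = b - 1\<close> norm_mult_ineq[of x b] by simp
  also have "\<dots> \<le> norm x * (1 / (1 - norm x))" using nb by (intro mult_left_mono) auto
  finally show ?thesis using that inv by simp
qed

text \<open>a' = a (1 - b (a - a')), and the second factor is close to 1. This gives openness of the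
  invertible elements and continuity of inversion at once.\<close>

lemma inverse_of_perturb:
  assumes a: "a \<in> L" and b: "inverse_of a b" and "e > 0"
  obtains d where "d > 0"
    "\<And>a'. a' \<in> L \<Longrightarrow> norm (a' - a) < d \<Longrightarrow> \<exists>b'. inverse_of a' b' \<and> norm (b' - b) \<le> e"
proof -
  \<comment> \<open>The bound 1/2 keeps the Neumann error q / (1 - q) below 2 q; the other bound
    makes 2 q (norm b + 1) at most e.\<close>
  define q where "q = min (1/2) (e / (2 * (norm b + 1)))"
  have q: "0 < q" "q \<le> 1/2" "2 * q * (norm b + 1) \<le> e"
    using \<open>e > 0\<close> by (auto simp: q_def min_def field_simps add_pos_nonneg add_nonneg_pos)
  define d where "d = q / (norm b + 1)"
  have d: "d > 0" "d * (norm b + 1) = q" using q(1)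
    by (auto simp: d_def add_nonneg_pos add_nonneg_eq_0_iff intro!: divide_pos_pos)
  have bL: "b \<in> L" using b by (simp add: inverse_of_def)
  show ?thesis
  proof (rule that[OF d(1)])
    fix a' assume a': "a' \<in> L" "norm (a' - a) < d"
    define x where "x = b * (a - a')"
    have "norm x \<le> norm b * norm (a - a')" unfolding x_def by (rule norm_mult_ineq)
    also have "\<dots> \<le> norm b * d" using a' by (intro mult_left_mono) (auto simp: norm_minus_commute)
    also have "\<dots> \<le> q" using d by (simp add: algebra_simps)
    finally have x: "norm x \<le> q" .
    then have "norm x < 1" using q by linarith
    moreover have xL: "x \<in> L" using a a' bL by (simp add: x_def)
    ultimately obtain n where n: "inverse_of (1 - x) n" "norm (n - 1) \<le> norm x / (1 - norm x)"
      using neumann by blast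
    have "norm x / (1 - norm x) \<le> q / (1/2)"
      using x q by (intro frac_le) auto
    then have n1: "norm (n - 1) \<le> 2 * q" using n(2) by (simp add: mult.commute)
    have "a' = a * (1 - x)"
      using b by (simp add: x_def algebra_simps mult.assoc[symmetric] inverse_of_def)
    then have "inverse_of a' (n * b)" using inverse_of_mult[OF b n(1)] by simp
    moreover have "norm (n * b - b) \<le> e"
    proof -
      have "n * b - b = (n - 1) * b" by (simp add: algebra_simps)
      then have "norm (n * b - b) \<le> norm (n - 1) * norm b" using norm_mult_ineq[of "n - 1" b] by simp
      also have "\<dots> \<le> 2 * q * (norm b + 1)" using n1 q by (intro mult_mono) auto
      finally show ?thesis using q by linarith
    qed
    ultimately show "\<exists>b'. inverse_of a' b' \<and> norm (b' - b) \<le> e" by blast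
  qed
qed

text \<open>The geometric sum p satisfies (1 - x) p = p (1 - x) = 1 - x^n, so an inverse of 1 - x^n
  yields a left and a right inverse of 1 - x.\<close>

lemma invertible_in_one_minus_if_power:
  assumes x: "x \<in> L" and "invertible_in (1 - x ^ n)"
  shows "invertible_in (1 - x)"
proof -
  define p where "p = (\<Sum>i<n. x ^ i)"
  have pL: "p \<in> L" unfolding p_def by (induction n) (auto simp: x)
  have "x * p - p = x ^ n - 1"
  proof (unfold p_def, induction n)
    case (Suc n) then show ?case by (simp add: algebra_simps)
  qed simp
  then have 1: "(1 - x) * p = 1 - x ^ n" by (simp add: algebra_simps)
  have "p * x = x * p"
    unfolding p_def sum_distrib_left sum_distrib_right by (simp add: power_commutes)
  then have 2: "p * (1 - x) = 1 - x ^ n" using 1 by (simp add: algebra_simps)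
  obtain m where m: "m \<in> L" "(1 - x ^ n) * m = 1" "m * (1 - x ^ n) = 1"
    using assms(2) by (auto simp: invertible_in_def inverse_of_def)
  show ?thesis
    by (rule invertible_in_if_one_sided[of "m * p" "p * m"])
      (use m pL 1 2 in \<open>auto simp: mult.assoc\<close>, simp add: mult.assoc[symmetric])
qed

text \<open>Otherwise the n-th power of a / z has norm below 1, and 1 - a / z is invertible. General
  n is kept because \<open>normal_spec_bound\<close> needs the estimate for all powers.\<close>

lemma spec_power_bound:
  assumes a: "a \<in> L" and z: "z \<in> spec a"
  shows "cmod z ^ n \<le> norm (a ^ n)"
proof (rule ccontr)
  assume "\<not> ?thesis"
  then have lt: "norm (a ^ n) < cmod z ^ n" by simp
  \<comment> \<open>z = 0 leaves only n = 0 and norm 1 < 1, hence 1 = 0; but in the zero algebra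
    everything is invertible and the spectrum is empty.\<close>
  have z0: "z \<noteq> 0"
  proof
    assume "z = 0"
    then have "n = 0" using lt by (cases n) auto
    then have "norm (1::'r) < 1" using lt by simp
    then obtain b where "inverse_of (1 - 1) b" using neumann[of 1] by auto
    then have "(1::'r) = 0" by (simp add: inverse_of_def)
    then have "x = 0" for x :: 'r by (metis mult.right_neutral mult_zero_right)
    then have "inverse_of (a - z *\<^sub>C 1) 0" by (simp add: inverse_of_def \<open>1 = 0\<close>)
    then show False using z by (auto simp: spec_def invertible_in_def)
  qed
  define x where "x = inverse z *\<^sub>C a"
  have "norm (x ^ n) = norm (a ^ n) / cmod z ^ n"
    by (simp add: x_def power_scaleC norm_scaleC norm_inverse norm_power norm_divide power_inverse field_simps)
  also have "\<dots> < 1" using lt z0 by simp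
  finally have "norm (x ^ n) < 1" .
  moreover have xL: "x \<in> L" using a by (simp add: x_def)
  ultimately have "invertible_in (1 - x ^ n)"
    unfolding invertible_in_def using neumann[of "x ^ n"] power_mem[OF xL, of n] by blast
  then have "invertible_in (1 - x)" using xL invertible_in_one_minus_if_power by blast
  moreover have "a - z *\<^sub>C 1 = (- z) *\<^sub>C (1 - x)"
    using z0 by (simp add: x_def scaleC_diff_right scaleC_scaleC scaleC_minus_left)
  ultimately have "invertible_in (a - z *\<^sub>C 1)"
    using z0 invertible_in_scaleC_iff[of "- z" "1 - x"] by simp
  then show False using z by (simp add: spec_def)
qed

lemma spec_norm_bound: "a \<in> L \<Longrightarrow> z \<in> spec a \<Longrightarrow> cmod z \<le> norm a"
  using spec_power_bound[of a z 1] by simp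

lemma closed_spec:
  assumes a: "a \<in> L" shows "closed (spec a)"
proof -
  have "open (- spec a)"
    unfolding open_dist
  proof (intro ballI)
    fix z assume "z \<in> - spec a"
    then obtain b where b: "inverse_of (a - z *\<^sub>C 1) b" by (auto simp: spec_def invertible_in_def)
    have mem: "a - z *\<^sub>C 1 \<in> L" using a by simp
    obtain d where d: "d > 0"
      "\<And>a'. a' \<in> L \<Longrightarrow> norm (a' - (a - z *\<^sub>C 1)) < d \<Longrightarrow> \<exists>b'. inverse_of a' b' \<and> norm (b' - b) \<le> 1"
      using inverse_of_perturb[OF mem b zero_less_one] by blast
    have "y \<in> - spec a" if "dist y z < d" for y
    proof -
      have "a - y *\<^sub>C 1 - (a - z *\<^sub>C 1) = (z - y) *\<^sub>C 1" by (simp add: scaleC_diff_left)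
      then have "norm (a - y *\<^sub>C 1 - (a - z *\<^sub>C 1)) = cmod (z - y) * norm (1::'r)" by (simp add: norm_scaleC)
      also have "\<dots> \<le> cmod (z - y) * 1" by (intro mult_left_mono norm_one_le) auto
      also have "\<dots> < d" using that by (simp add: dist_norm norm_minus_commute)
      finally have "\<exists>b'. inverse_of (a - y *\<^sub>C 1) b'" using d(2)[of "a - y *\<^sub>C 1"] a by auto
      then show ?thesis by (simp add: spec_def invertible_in_def)
    qed
    then show "\<exists>e>0. \<forall>y. dist y z < e \<longrightarrow> y \<in> - spec a" using d(1) by blast
  qed
  then show ?thesis by (simp add: closed_def)
qed

lemma compact_spec: "a \<in> L \<Longrightarrow> compact (spec a)"
  unfolding compact_eq_bounded_closed
  using closed_spec spec_norm_bound by (auto simp: bounded_iff)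

end

subsection \<open>Norms of selfadjoint elements\<close>

context cstar_subalgebra begin

text \<open>Compactness of the disc makes one s < 1 serve all w. Only such a uniform estimate can be
  handed on from a to its powers 2^n.\<close>

lemma resolvent_uniformly_continuous:
  assumes a: "a \<in> L" and inv: "\<And>w. cmod w \<le> \<delta> \<Longrightarrow> invertible_in (1 - w *\<^sub>C a)" and "e > 0" "\<delta> > 0"
  obtains s where "0 < s" "s < 1"
    "\<And>w g h. cmod w \<le> \<delta> \<Longrightarrow> inverse_of (1 - w *\<^sub>C a) g \<Longrightarrow>
       inverse_of (1 - (complex_of_real s * w) *\<^sub>C a) h \<Longrightarrow> norm (g - h) \<le> e"
proof -
  define F where "F w = (SOME g. inverse_of (1 - w *\<^sub>C a) g)" for w
  have F: "inverse_of (1 - w *\<^sub>C a) (F w)" if "cmod w \<le> \<delta>" for w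
    using inv[OF that] unfolding F_def invertible_in_def by (rule someI_ex)
  have "continuous_on (cball 0 \<delta>) F"
    unfolding continuous_on_iff
  proof (intro ballI allI impI)
    fix w :: complex and e :: real assume w: "w \<in> cball 0 \<delta>" and "e > 0"
    then have e2: "e / 2 > 0" by simp
    have mem: "1 - w *\<^sub>C a \<in> L" using a by simp
    have "inverse_of (1 - w *\<^sub>C a) (F w)" using F w by simp
    from inverse_of_perturb[OF mem this e2] obtain d where d: "d > 0"
      "\<And>a'. a' \<in> L \<Longrightarrow> norm (a' - (1 - w *\<^sub>C a)) < d \<Longrightarrow> \<exists>b'. inverse_of a' b' \<and> norm (b' - F w) \<le> e / 2"
      by blast
    have "dist (F w') (F w) < e"
      if w': "w' \<in> cball 0 \<delta>" "dist w' w < d / (norm a + 1)" for w'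
    proof -
      have "1 - w' *\<^sub>C a - (1 - w *\<^sub>C a) = (w - w') *\<^sub>C a" by (simp add: scaleC_diff_left)
      then have "norm (1 - w' *\<^sub>C a - (1 - w *\<^sub>C a)) = cmod (w - w') * norm a" by (simp add: norm_scaleC)
      also have "\<dots> \<le> cmod (w - w') * (norm a + 1)" by (intro mult_left_mono) auto
      also have "\<dots> < d" using w'(2) by (simp add: pos_less_divide_eq add_nonneg_pos dist_norm norm_minus_commute)
      finally obtain b' where b': "inverse_of (1 - w' *\<^sub>C a) b'" "norm (b' - F w) \<le> e / 2"
        using d(2)[of "1 - w' *\<^sub>C a"] a by auto
      have "b' = F w'" using inverse_of_unique[OF b'(1) F] w' by simp
      then show ?thesis using b' \<open>e > 0\<close> by (simp add: dist_norm)
    qed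
    then show "\<exists>d>0. \<forall>w'\<in>cball 0 \<delta>. dist w' w < d \<longrightarrow> dist (F w') (F w) < e"
      using d(1) by (intro exI[of _ "d / (norm a + 1)"]) (auto simp: add_nonneg_pos)
  qed
  then have "uniformly_continuous_on (cball 0 \<delta>) F"
    by (intro compact_uniformly_continuous) auto
  then obtain d where d: "d > 0"
    "\<And>w w'. w \<in> cball 0 \<delta> \<Longrightarrow> w' \<in> cball 0 \<delta> \<Longrightarrow> dist w' w < d \<Longrightarrow> dist (F w') (F w) < e"
    unfolding uniformly_continuous_on_def using \<open>e > 0\<close> by metis
  \<comment> \<open>1 - d / (2 \<delta>) brings s w within d / 2 of w on the whole disc; the maximum
    with 1/2 keeps s positive.\<close>
  define s where "s = max (1/2) (1 - d / (2 * \<delta>))"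
  have s: "0 < s" "s < 1" "(1 - s) * \<delta> < d"
  proof -
    have "1 - s \<le> d / (2 * \<delta>)" by (simp add: s_def max_def)
    then have "(1 - s) * \<delta> \<le> d / (2 * \<delta>) * \<delta>" using \<open>\<delta> > 0\<close> by (intro mult_right_mono) auto
    also have "\<dots> < d" using d \<open>\<delta> > 0\<close> by simp
    finally show "(1 - s) * \<delta> < d" .
  qed (use d \<open>\<delta> > 0\<close> in \<open>auto simp: s_def max_def\<close>)
  show ?thesis
  proof (rule that[OF s(1,2)])
    fix w g h assume w: "cmod w \<le> \<delta>" and g: "inverse_of (1 - w *\<^sub>C a) g"
      and h: "inverse_of (1 - (complex_of_real s * w) *\<^sub>C a) h"
    have sw: "cmod (complex_of_real s * w) \<le> \<delta>"
    proof -
      have "cmod (complex_of_real s * w) = s * cmod w" using s by (simp add: norm_mult)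
      also have "\<dots> \<le> 1 * \<delta>" using s w by (intro mult_mono) auto
      finally show ?thesis by simp
    qed
    have "dist (complex_of_real s * w) w = (1 - s) * cmod w"
    proof -
      have "w - complex_of_real s * w = complex_of_real (1 - s) * w" by (simp add: algebra_simps)
      then have "cmod (w - complex_of_real s * w) = \<bar>1 - s\<bar> * cmod w"
        by (simp only: norm_mult norm_of_real)
      then show ?thesis using s by (simp add: dist_norm norm_minus_commute)
    qed
    also have "\<dots> \<le> (1 - s) * \<delta>" using s w by (intro mult_left_mono) auto
    finally have "dist (F (complex_of_real s * w)) (F w) < e" using d(2) w sw s by simp
    moreover have "g = F w" "h = F (complex_of_real s * w)"
      using inverse_of_unique g h F w sw by blast+
    ultimately show "norm (g - h) \<le> e" by (simp add: dist_norm norm_minus_commute)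
  qed
qed

lemma exists_root_minus_one: "\<exists>\<zeta>::complex. \<zeta> ^ (2 ^ n) = -1 \<and> cmod \<zeta> = 1"
proof -
  let ?\<zeta> = "cis (pi / 2 ^ n)"
  have "?\<zeta> ^ (2 ^ n) = -1" by (simp add: Complex.DeMoivre)
  then show ?thesis by (metis norm_cis)
qed

text \<open>
  Rickart's elementary route to the spectral radius: the resolvents of \<open>x\<^sup>2\<close> are averages of
  those of \<open>x\<close> and \<open>-x\<close>, so a modulus of continuity along rays passes to all powers \<open>2\<^sup>n\<close>.
\<close>

lemma doubled_resolvent:
  assumes a: "a \<in> L" and inv: "\<And>w. cmod w \<le> \<delta> \<Longrightarrow> invertible_in (1 - w *\<^sub>C a)"
    and s: "0 < s" "s < 1"
    and unif: "\<And>w g h. cmod w \<le> \<delta> \<Longrightarrow> inverse_of (1 - w *\<^sub>C a) g \<Longrightarrow>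
       inverse_of (1 - (complex_of_real s * w) *\<^sub>C a) h \<Longrightarrow> norm (g - h) \<le> e"
  shows "cmod w \<le> \<delta> \<Longrightarrow> \<exists>g h. inverse_of (1 - (w *\<^sub>C a) ^ (2 ^ n)) g \<and>
       inverse_of (1 - ((complex_of_real s * w) *\<^sub>C a) ^ (2 ^ n)) h \<and> norm (g - h) \<le> e"
proof (induction n arbitrary: w)
  case 0
  have "cmod (complex_of_real s * w) \<le> 1 * cmod w"
    unfolding norm_mult using s by (intro mult_right_mono) auto
  then have "cmod (complex_of_real s * w) \<le> \<delta>" using 0 by simp
  then show ?case using inv[of w] inv[of "complex_of_real s * w"] unif[OF 0] 0
    unfolding invertible_in_def by fastforce
next
  case (Suc n)
  \<comment> \<open>Replacing v by \<zeta> v changes the sign of the 2^n-th power X, so the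
    induction hypothesis provides inverses of both 1 - X and 1 + X.\<close>
  obtain \<zeta> :: complex where \<zeta>: "\<zeta> ^ (2 ^ n) = -1" "cmod \<zeta> = 1" using exists_root_minus_one by blast
  have half: "inverse_of (1 - (v *\<^sub>C a) ^ (2 ^ Suc n)) ((1/2) *\<^sub>C (g + g'))"
    if "inverse_of (1 - (v *\<^sub>C a) ^ (2 ^ n)) g" "inverse_of (1 - ((\<zeta> * v) *\<^sub>C a) ^ (2 ^ n)) g'" for v g g'
  proof -
    define X where "X = (v *\<^sub>C a) ^ (2 ^ n)"
    have X2: "(v *\<^sub>C a) ^ (2 ^ Suc n) = X * X"
      by (simp add: X_def power_mult[symmetric] power_add[symmetric] mult_2)
    have mX: "((\<zeta> * v) *\<^sub>C a) ^ (2 ^ n) = - X"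
      by (simp add: X_def power_scaleC power_mult_distrib \<zeta> scaleC_minus_left)
    have g: "g \<in> L" "(1 - X) * g = 1" "g * (1 - X) = 1"
      and g': "g' \<in> L" "(1 + X) * g' = 1" "g' * (1 + X) = 1"
      using that by (auto simp: inverse_of_def mX X_def[symmetric])
    have f: "1 - X * X = (1 + X) * (1 - X)" "1 - X * X = (1 - X) * (1 + X)"
      by (simp_all add: algebra_simps)
    have "(1 - X * X) * g = (1 + X) * ((1 - X) * g)" "(1 - X * X) * g' = (1 - X) * ((1 + X) * g')"
      by (simp only: f(1) mult.assoc, simp only: f(2) mult.assoc)
    then have 1: "(1 - X * X) * (g + g') = 2 *\<^sub>C 1" 
      using scaleC_add_left[of 1 1 "1::'r"] by (simp add: g g' distrib_left)
    have "g * (1 - X * X) = (g * (1 - X)) * (1 + X)" "g' * (1 - X * X) = (g' * (1 + X)) * (1 - X)"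
      by (simp only: f(2) mult.assoc, simp only: f(1) mult.assoc)
    then have 2: "(g + g') * (1 - X * X) = 2 *\<^sub>C 1" 
      using scaleC_add_left[of 1 1 "1::'r"] by (simp add: g g' distrib_right)
    show ?thesis
      unfolding inverse_of_def X2 using g g' 1 2
      by (simp add: scaleC_mult_left scaleC_mult_right scaleC_scaleC)
  qed
  obtain g h where gh: "inverse_of (1 - (w *\<^sub>C a) ^ (2 ^ n)) g"
       "inverse_of (1 - ((complex_of_real s * w) *\<^sub>C a) ^ (2 ^ n)) h" "norm (g - h) \<le> e"
    using Suc.IH[OF Suc.prems] by blast
  have "cmod (\<zeta> * w) \<le> \<delta>" using Suc.prems \<zeta> by (simp add: norm_mult)
  then obtain g' h' where gh': "inverse_of (1 - ((\<zeta> * w) *\<^sub>C a) ^ (2 ^ n)) g'"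
       "inverse_of (1 - ((\<zeta> * (complex_of_real s * w)) *\<^sub>C a) ^ (2 ^ n)) h'" "norm (g' - h') \<le> e"
    using Suc.IH[of "\<zeta> * w"] by (auto simp: mult.left_commute)
  have "norm ((1/2) *\<^sub>C (g + g') - (1/2) *\<^sub>C (h + h')) = norm ((g - h) + (g' - h')) / 2"
    by (simp add: scaleC_diff_right[symmetric] norm_scaleC algebra_simps)
  also have "\<dots> \<le> e" using norm_triangle_ineq[of "g - h" "g' - h'"] gh(3) gh'(3) by simp
  finally show ?case using half[OF gh(1) gh'(1)] half[OF gh(2) gh'(2)] by blast
qed

lemma powers_tendsto_zero_if_eventually_lt_1:
  fixes x :: 'r
  assumes "norm (x ^ (2 ^ m)) < 1"
  shows "(\<lambda>n. x ^ (2 ^ n)) \<longlonglongrightarrow> 0"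
proof -
  define q where "q = norm (x ^ (2 ^ m))"
  have lim: "(\<lambda>n. q ^ n) \<longlonglongrightarrow> 0" using assms by (intro LIMSEQ_realpow_zero) (auto simp: q_def)
  have bd: "norm (x ^ (2 ^ (n + m))) \<le> q ^ n" for n
  proof -
    have "norm (x ^ (2 ^ (n + m))) \<le> q ^ (2 ^ n)"
      using norm_power_le[of "x ^ (2 ^ m)" "2 ^ n"] by (simp add: q_def power_mult[symmetric] power_add mult.commute)
    also have "\<dots> \<le> q ^ n"
      using assms less_exp[of n] by (intro power_decreasing) (auto simp: q_def)
    finally show ?thesis .
  qed
  from bd have "\<forall>\<^sub>F n in sequentially. norm (x ^ (2 ^ (n + m))) \<le> q ^ n" by simp
  then have "(\<lambda>n. x ^ (2 ^ (n + m))) \<longlonglongrightarrow> 0" using lim by (rule Lim_null_comparison)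
  then show ?thesis by (rule LIMSEQ_offset)
qed

text \<open>Convergence holds for w shrunk by a high power of s, where the norm is below 1.
  \<open>step\<close> carries it from s v to v, so finitely many steps along the ray reach
  w.\<close>

lemma powers_tendsto_zero:
  assumes a: "a \<in> L" and "\<delta> > 0" and inv: "\<And>w. cmod w \<le> \<delta> \<Longrightarrow> invertible_in (1 - w *\<^sub>C a)"
    and w: "cmod w \<le> \<delta>"
  shows "(\<lambda>n. (w *\<^sub>C a) ^ (2 ^ n)) \<longlonglongrightarrow> 0"
proof -
  obtain s where s: "0 < s" "s < 1"
    "\<And>w g h. cmod w \<le> \<delta> \<Longrightarrow> inverse_of (1 - w *\<^sub>C a) g \<Longrightarrow>
       inverse_of (1 - (complex_of_real s * w) *\<^sub>C a) h \<Longrightarrow> norm (g - h) \<le> 1/8"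
    using resolvent_uniformly_continuous[OF a inv _ \<open>\<delta> > 0\<close>, of "1/8"] by auto
  have dbl: "\<exists>g h. inverse_of (1 - (v *\<^sub>C a) ^ (2 ^ m)) g \<and>
      inverse_of (1 - ((complex_of_real s * v) *\<^sub>C a) ^ (2 ^ m)) h \<and> norm (g - h) \<le> 1/8"
    if "cmod v \<le> \<delta>" for v m
    by (rule doubled_resolvent[where \<delta> = \<delta>]) (fact a | fact inv | fact s | fact that)+
  have step: "(\<lambda>n. (v *\<^sub>C a) ^ (2 ^ n)) \<longlonglongrightarrow> 0"
    if v: "cmod v \<le> \<delta>" and lim: "(\<lambda>n. ((complex_of_real s * v) *\<^sub>C a) ^ (2 ^ n)) \<longlonglongrightarrow> 0" for v
  proof -
    have "\<forall>\<^sub>F n in sequentially. norm (((complex_of_real s * v) *\<^sub>C a) ^ (2 ^ n)) < 1/9"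
      using order_tendstoD(2)[OF tendsto_norm[OF lim], of "1/9"] by simp
    \<comment> \<open>norm Y < 1/9 puts h within (1/9) / (8/9) = 1/8 of 1, hence g within 1/4 of 1.
      Neumann for g then puts its inverse 1 - X within (1/4) / (3/4) = 1/3 of 1, so norm X <
      1.\<close>
    then obtain m where m: "norm (((complex_of_real s * v) *\<^sub>C a) ^ (2 ^ m)) < 1/9"
      by (meson eventually_sequentially order_refl)
    define Y X where "Y = ((complex_of_real s * v) *\<^sub>C a) ^ (2 ^ m)" and "X = (v *\<^sub>C a) ^ (2 ^ m)"
    have mem: "X \<in> L" "Y \<in> L" using a by (auto simp: X_def Y_def)
    obtain g h where gh: "inverse_of (1 - X) g" "inverse_of (1 - Y) h" "norm (g - h) \<le> 1/8"
      using dbl[OF v, of m] by (auto simp: X_def Y_def)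
    obtain h' where h': "inverse_of (1 - Y) h'" "norm (h' - 1) \<le> norm Y / (1 - norm Y)"
      using neumann[OF mem(2)] m by (auto simp: Y_def)
    have "norm Y / (1 - norm Y) \<le> (1/9) / (8/9)"
      using m by (intro frac_le) (auto simp: Y_def)
    from order_trans[OF h'(2) this] have "norm (h' - 1) \<le> 1/8" by simp
    then have "norm (h - 1) \<le> 1/8" using inverse_of_unique[OF gh(2) h'(1)] by simp
    then have g1: "norm (g - 1) \<le> 1/4"
      using norm_triangle_ineq[of "g - h" "h - 1"] gh(3) by simp
    have gL: "1 - g \<in> L" using gh by (simp add: inverse_of_def)
    obtain k where k: "inverse_of (1 - (1 - g)) k" "norm (k - 1) \<le> norm (1 - g) / (1 - norm (1 - g))"
      using neumann[OF gL] g1 by (auto simp: norm_minus_commute)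
    have "norm (1 - g) / (1 - norm (1 - g)) \<le> (1/4) / (3/4)"
      using g1 by (intro frac_le) (auto simp: norm_minus_commute)
    from order_trans[OF k(2) this] have "norm (k - 1) \<le> 1/3" by simp
    moreover have "inverse_of g (1 - X)" using gh(1) mem by (auto simp: inverse_of_def)
    then have "k = 1 - X" using k(1) inverse_of_unique by auto
    ultimately have "norm X < 1" by simp
    then show ?thesis unfolding X_def by (rule powers_tendsto_zero_if_eventually_lt_1)
  qed
  have sdown: "cmod ((complex_of_real s) ^ k * w) \<le> \<delta>" for k
  proof -
    have "cmod ((complex_of_real s) ^ k * w) \<le> 1 * cmod w"
      unfolding norm_mult norm_power using s by (intro mult_right_mono) (auto intro: power_le_one)
    then show ?thesis using w by simp
  qed
  have "(\<lambda>k. s ^ k * norm (w *\<^sub>C a)) \<longlonglongrightarrow> 0 * norm (w *\<^sub>C a)"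
    using s by (intro tendsto_mult LIMSEQ_realpow_zero) auto
  then have "\<forall>\<^sub>F k in sequentially. s ^ k * norm (w *\<^sub>C a) < 1"
    by (intro order_tendstoD(2)[where y=0 and a=1]) auto
  then obtain k where k: "s ^ k * norm (w *\<^sub>C a) < 1"
    by (meson eventually_sequentially order_refl)
  have "norm ((((complex_of_real s) ^ k * w) *\<^sub>C a) ^ (2 ^ 0)) < 1"
    using k s by (simp add: norm_scaleC norm_mult norm_power mult.assoc)
  then have start: "(\<lambda>n. (((complex_of_real s) ^ k * w) *\<^sub>C a) ^ (2 ^ n)) \<longlonglongrightarrow> 0"
    by (rule powers_tendsto_zero_if_eventually_lt_1)
  have "(\<lambda>n. (((complex_of_real s) ^ (k - j) * w) *\<^sub>C a) ^ (2 ^ n)) \<longlonglongrightarrow> 0" if "j \<le> k" for j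
    using that
  proof (induction j)
    case 0 then show ?case using start by simp
  next
    case (Suc j)
    then have "k - j = Suc (k - Suc j)" by simp
    then show ?case using step[OF sdown[of "k - Suc j"]] Suc by (simp add: mult.assoc)
  qed
  from this[of k] show ?thesis by simp
qed

text \<open>Repeated squaring collects the factor C^(2^n - 1); the C on the left avoids the
  subtraction in the exponent. After taking 2^n-th roots at most a single C survives.\<close>

lemma selfadj_norm_power:
  assumes "a \<in> L" "star a = a"
  shows "C * norm a ^ (2 ^ n) \<le> C ^ (2 ^ n) * norm (a ^ (2 ^ n))"
proof (induction n)
  case 0 show ?case by simp
next
  case (Suc n)
  have sq: "(norm (a ^ 2 ^ n))\<^sup>2 \<le> C * norm (a ^ 2 ^ Suc n)"
    using norm_le_star[of "a ^ 2 ^ n"] assms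
    by (simp add: star_power power_mult[symmetric] power_add[symmetric] mult_2)
  have "C * (C * norm a ^ (2 ^ Suc n)) = (C * norm a ^ (2 ^ n))\<^sup>2"
    by (simp add: power2_eq_square power_add mult_2 algebra_simps)
  also have "\<dots> \<le> (C ^ (2 ^ n) * norm (a ^ (2 ^ n)))\<^sup>2"
    using Suc C_ge_1 by (intro power_mono) auto
  also have "\<dots> = C ^ (2 ^ Suc n) * (norm (a ^ (2 ^ n)))\<^sup>2"
    by (simp add: power_mult_distrib power_mult[symmetric] mult.commute)
  also have "\<dots> \<le> C ^ (2 ^ Suc n) * (C * norm (a ^ 2 ^ Suc n))"
    using sq C_ge_1 by (intro mult_left_mono) auto
  finally have "C * (C * norm a ^ (2 ^ Suc n)) \<le> C * (C ^ (2 ^ Suc n) * norm (a ^ 2 ^ Suc n))"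
    by (simp add: algebra_simps)
  then show ?case using C_ge_1 by (simp add: mult_le_cancel_left_pos)
qed

text \<open>The hypothesis makes 1 - w a invertible for all w in the disc of radius 1 / \<rho>, so
  the 2^n-th powers of a / \<rho> tend to 0. One exponent where the norm is below 1 suffices, by
  \<open>selfadj_norm_power\<close>.\<close>

lemma selfadj_norm_le:
  assumes a: "a \<in> L" "star a = a" and "\<rho> > 0" and spec: "\<And>z. z \<in> spec a \<Longrightarrow> cmod z < \<rho>"
  shows "norm a \<le> C * \<rho>"
proof -
  have inv: "invertible_in (1 - w *\<^sub>C a)" if "cmod w \<le> 1 / \<rho>" for w
  proof (cases "w = 0")
    case True then show ?thesis using inverse_of_one by (auto simp: invertible_in_def)
  next
    case False
    have "\<rho> \<le> cmod (inverse w)"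
      using that False \<open>\<rho> > 0\<close> by (simp add: norm_inverse norm_divide field_simps)
    then have "inverse w \<notin> spec a" using spec by force
    then have "invertible_in (a - inverse w *\<^sub>C 1)" by (simp add: spec_def)
    then have "invertible_in ((- w) *\<^sub>C (a - inverse w *\<^sub>C 1))"
      using False invertible_in_scaleC_iff by simp
    moreover have "(- w) *\<^sub>C (a - inverse w *\<^sub>C 1) = 1 - w *\<^sub>C a"
      using False by (simp add: scaleC_diff_right scaleC_scaleC scaleC_minus_left)
    ultimately show ?thesis by simp
  qed
  have "(\<lambda>n. (complex_of_real (1 / \<rho>) *\<^sub>C a) ^ (2 ^ n)) \<longlonglongrightarrow> 0"
    using \<open>\<rho> > 0\<close> by (intro powers_tendsto_zero[OF a(1) _ inv]) (auto simp: norm_divide)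
  from tendsto_norm[OF this]
  have "\<forall>\<^sub>F n in sequentially. norm ((complex_of_real (1 / \<rho>) *\<^sub>C a) ^ (2 ^ n)) < 1"
    by (intro order_tendstoD(2)[where y=0 and a=1]) auto
  then obtain n where "norm ((complex_of_real (1 / \<rho>) *\<^sub>C a) ^ (2 ^ n)) < 1"
    by (meson eventually_sequentially order_refl)
  then have "norm (a ^ (2 ^ n)) < \<rho> ^ (2 ^ n)"
    using \<open>\<rho> > 0\<close> by (simp add: power_scaleC norm_scaleC norm_power norm_divide field_simps)
  then have "C ^ (2 ^ n) * norm (a ^ (2 ^ n)) \<le> C ^ (2 ^ n) * \<rho> ^ (2 ^ n)"
    using C_ge_1 by (intro mult_left_mono) auto
  with selfadj_norm_power[OF a, of n] have "C * norm a ^ (2 ^ n) \<le> (C * \<rho>) ^ (2 ^ n)"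
    by (simp add: power_mult_distrib)
  moreover have "1 * norm a ^ (2 ^ n) \<le> C * norm a ^ (2 ^ n)"
    using C_ge_1 by (intro mult_right_mono) auto
  ultimately have "norm a ^ (2 ^ n) \<le> (C * \<rho>) ^ (2 ^ n)" by simp
  then show ?thesis using C_ge_1 \<open>\<rho> > 0\<close> by (subst (asm) power_mono_iff) auto
qed

end

subsection \<open>Polynomials of a selfadjoint element\<close>

text \<open>Horner's scheme: \<open>poly\<close> wants coefficients and argument in the same
  commutative semiring.\<close>

definition peval :: "complex poly \<Rightarrow> 'r::complex_banach_algebra \<Rightarrow> 'r" where
  "peval p a = fold_coeffs (\<lambda>c x. c *\<^sub>C 1 + a * x) p 0"

lemma peval_0 [simp]: "peval 0 a = 0"
  by (simp add: peval_def)

lemma peval_pCons: "peval (pCons c p) a = c *\<^sub>C 1 + a * peval p a"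
  by (cases "c = 0 \<and> p = 0") (auto simp: peval_def fold_coeffs_pCons_not_0_0_eq fold_coeffs_pCons_coeff_not_0_eq)

lemma peval_1 [simp]: "peval 1 a = 1"
  by (simp add: one_pCons peval_pCons)

lemma peval_add: "peval (p + q) a = peval p a + peval q a"
  by (induction p q rule: poly_induct2) (simp_all add: peval_pCons scaleC_add_left algebra_simps)

lemma peval_smult: "peval (smult c p) a = c *\<^sub>C peval p a"
  by (induction p) (simp_all add: peval_pCons scaleC_add_right scaleC_mult_right scaleC_scaleC)

lemma peval_diff: "peval (p - q) a = peval p a - peval q a"
  using peval_add[of p "-q" a] peval_smult[of "-1" q a] by (simp add: scaleC_minus_left)

lemma peval_mult: "peval (p * q) a = peval p a * peval q a"
  by (induction p)
    (simp_all add: peval_pCons peval_add peval_smult scaleC_mult_left distrib_right mult.assoc)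

lemma peval_X: "peval [:0, 1:] a = a"
  by (simp add: peval_pCons)

text \<open>A constant that is the same for all powers disappears when roots are taken; this is how
  \<open>C\<close> is removed from \<open>normal_spec_bound\<close>.\<close>

lemma le_if_powers_le:
  fixes x K C :: real
  assumes "0 \<le> x" "0 \<le> K" "\<And>n. x ^ n \<le> C * K ^ n"
  shows "x \<le> K"
proof (rule ccontr)
  assume "\<not> x \<le> K"
  then have lt: "K < x" by simp
  show False
  proof (cases "K = 0")
    case True then show ?thesis using assms(3)[of 1] lt by simp
  next
    case False
    then have K: "K > 0" using assms by simp
    obtain n where "C < (x / K) ^ n" using real_arch_pow[of "x / K" C] lt K by auto
    then have "C * K ^ n < x ^ n" using K by (simp add: power_divide field_simps)
    then show ?thesis using assms(3)[of n] by simp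
  qed
qed

lemma commuting_power_mult_distrib:
  fixes a b :: "'b::monoid_mult"
  assumes "a * b = b * a"
  shows "(a * b) ^ n = a ^ n * b ^ n"
proof (induction n)
  case (Suc n)
  have "b * a ^ n = a ^ n * b" by (simp add: assms power_commuting_commutes)
  then have "a * b * (a ^ n * b ^ n) = (a * a ^ n) * (b * b ^ n)"
    by (metis mult.assoc)
  then show ?case using Suc by simp
qed simp

context cstar_subalgebra begin

text \<open>No factor C may remain, as Arens' trick below compares leading terms t^2 exactly. For
  normal a the weak inequality for a^n involves the n-th power of \<open>star a * a\<close>, and
  letting n grow removes C.\<close>

lemma normal_spec_bound:
  assumes a: "a \<in> L" "star a * a = a * star a" and z: "z \<in> spec a"
  shows "(cmod z)\<^sup>2 \<le> norm (star a * a)"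
proof (rule le_if_powers_le[of _ _ C])
  fix n
  have "((cmod z)\<^sup>2) ^ n = (cmod z ^ n)\<^sup>2" by (simp add: power_mult[symmetric] mult.commute)
  also have "\<dots> \<le> (norm (a ^ n))\<^sup>2" using spec_power_bound[OF a(1) z] by (intro power_mono) auto
  also have "\<dots> \<le> C * norm (star (a ^ n) * a ^ n)" using a by (intro norm_le_star) auto
  also have "star (a ^ n) * a ^ n = (star a * a) ^ n"
    using a commuting_power_mult_distrib[OF a(2), of n] by (simp add: star_power)
  also have "C * norm ((star a * a) ^ n) \<le> C * norm (star a * a) ^ n"
    using C_ge_1 by (intro mult_left_mono norm_power_le) auto
  finally show "((cmod z)\<^sup>2) ^ n \<le> C * norm (star a * a) ^ n" .
qed auto

text \<open>Arens' trick: translate by large imaginary multiples of the identity.\<close>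

lemma selfadj_spec_real:
  assumes a: "a \<in> L" "star a = a" and z: "z \<in> spec a"
  shows "Im z = 0"
proof (rule ccontr)
  assume im: "Im z \<noteq> 0"
  \<comment> \<open>The bound for a + i t forces 2 t Im z to be at most the square of norm a; t is
    chosen so that it exceeds this by exactly 1.\<close>
  define t where "t = ((norm a)\<^sup>2 + 1) / (2 * Im z)"
  define n where "n = a + (\<i> * t) *\<^sub>C 1"
  have sn: "star n = a - (\<i> * t) *\<^sub>C 1"
    using a by (simp add: n_def star_add star_scaleC scaleC_minus_left)
  have nL: "n \<in> L" using a by (simp add: n_def)
  have prod: "star n * n = a * a + (complex_of_real (t\<^sup>2)) *\<^sub>C 1"
    unfolding sn by (simp add: n_def algebra_simps scaleC_mult_left scaleC_mult_right scaleC_scaleC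
        power2_eq_square scaleC_minus_left scaleC_diff_right)
  have prod': "n * star n = star n * n"
    unfolding sn by (simp add: n_def algebra_simps scaleC_mult_left scaleC_mult_right scaleC_diff_right scaleC_add_right)
  have "z + \<i> * t \<in> spec n"
    using z by (simp add: spec_def n_def scaleC_add_left algebra_simps)
  then have "(cmod (z + \<i> * t))\<^sup>2 \<le> norm (star n * n)"
    using normal_spec_bound[OF nL] prod' by simp
  also have "\<dots> \<le> norm a * norm a + t\<^sup>2 * norm (1::'r)"
    unfolding prod using norm_mult_ineq[of a a]
    by (intro order_trans[OF norm_triangle_ineq] add_mono) (auto simp: norm_scaleC norm_power)
  also have "\<dots> \<le> (norm a)\<^sup>2 + t\<^sup>2"
    using mult_left_mono[OF norm_one_le, of "t\<^sup>2"] by (simp add: power2_eq_square)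
  finally have "(Re z)\<^sup>2 + (Im z + t)\<^sup>2 \<le> (norm a)\<^sup>2 + t\<^sup>2"
    by (simp add: cmod_power2)
  then have "2 * Im z * t \<le> (norm a)\<^sup>2"
    using zero_le_power2[of "Re z"] zero_le_power2[of "Im z"] unfolding power2_sum by linarith
  moreover have "2 * Im z * t = (norm a)\<^sup>2 + 1" using im by (simp add: t_def)
  ultimately show False by simp
qed

lemma peval_mem [simp]: "a \<in> L \<Longrightarrow> peval p a \<in> L"
  by (induction p) (simp_all add: peval_pCons)

lemma peval_commute: "a * peval p a = peval p a * a"
  by (metis mult.commute peval_X peval_mult)

lemma star_peval:
  assumes "a \<in> L" "star a = a"
  shows "star (peval p a) = peval (map_poly cnj p) a"
proof (induction p)
  case (pCons c p)
  then show ?case using assms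
    by (simp add: peval_pCons map_poly_pCons star_add star_mult star_scaleC peval_commute)
qed (use star_diff[of 0 0] in simp)

text \<open>The fundamental theorem of algebra splits off linear factors, each invertible because
  its root lies outside the spectrum.\<close>

lemma peval_invertible:
  assumes a: "a \<in> L"
  shows "p \<noteq> 0 \<Longrightarrow> (\<And>z. z \<in> spec a \<Longrightarrow> poly p z \<noteq> 0) \<Longrightarrow> invertible_in (peval p a)"
proof (induction "degree p" arbitrary: p)
  case 0
  then obtain c where "p = [:c:]" using degree_eq_zeroE by metis
  moreover have "invertible_in 1" using inverse_of_one by (auto simp: invertible_in_def)
  ultimately show ?case using 0 invertible_in_scaleC_iff by (simp add: peval_pCons)
next
  case (Suc n)
  then have "\<not> constant (poly p)" by (simp add: constant_degree)
  then obtain z where "poly p z = 0" using fundamental_theorem_of_algebra by blast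
  then obtain q where q: "p = [:-z, 1:] * q" by (metis poly_eq_0_iff_dvd dvdE)
  have "q \<noteq> 0" using q Suc.prems by auto
  moreover have "degree q = n" using Suc.hyps(2) \<open>q \<noteq> 0\<close> by (simp add: q degree_mult_eq del: mult_pCons_left)
  ultimately have "invertible_in (peval q a)" using Suc.hyps(1) Suc.prems(2) by (auto simp: q)
  moreover have "z \<notin> spec a" using \<open>poly p z = 0\<close> Suc.prems(2) by auto
  then have "invertible_in (peval [:-z, 1:] a)"
    by (simp add: spec_def peval_pCons scaleC_minus_left)
  ultimately show ?case unfolding q peval_mult by (rule invertible_in_mult[rotated])
qed

lemma spec_peval_subset:
  assumes a: "a \<in> L" and ne: "spec a \<noteq> {}"
  shows "spec (peval p a) \<subseteq> poly p ` spec a"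
proof
  fix m assume m: "m \<in> spec (peval p a)"
  show "m \<in> poly p ` spec a"
  proof (rule ccontr)
    assume n: "m \<notin> poly p ` spec a"
    have "invertible_in (peval (p - [:m:]) a)"
    proof (rule peval_invertible[OF a])
      show "poly (p - [:m:]) z \<noteq> 0" if "z \<in> spec a" for z using n that by auto
      \<comment> \<open>If p were the constant m, any point of the nonempty spectrum would put m
        into the image.\<close>
      then show "p - [:m:] \<noteq> 0" using ne by auto
    qed
    then show False using m by (simp add: spec_def peval_diff peval_pCons)
  qed
qed

text \<open>With an empty spectrum the radius estimate holds for every positive bound, so a = 0; but
  then 0 is invertible. This replaces the usual appeal to Liouville's theorem.\<close>

lemma spec_empty_imp_trivial:
  assumes a: "a \<in> L" "star a = a" and "spec a = {}"
  shows "x = (0::'r)"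
proof -
  have "norm a \<le> C * e" if "e > 0" for e using selfadj_norm_le[OF a that] assms by auto
  then have "norm a \<le> 0 + e" if "e > 0" for e
    using that C_ge_1 by (metis add_0 divide_pos_pos less_le_trans mult.commute nonzero_eq_divide_eq order_less_irrefl zero_less_one)
  then have "norm a \<le> 0" by (rule field_le_epsilon)
  then have "a = 0" by simp
  moreover have "0 \<notin> spec a" using assms by simp
  ultimately have "1 = (0::'r)" by (auto simp: spec_def invertible_in_def inverse_of_def)
  then show ?thesis by (metis mult.right_neutral mult_zero_right)
qed

lemma selfadj_norm_le':
  assumes a: "a \<in> L" "star a = a" and "0 \<le> \<rho>" and spec: "\<And>z. z \<in> spec a \<Longrightarrow> cmod z \<le> \<rho>"
  shows "norm a \<le> C * \<rho>"
proof (rule field_le_epsilon)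
  fix e :: real assume "e > 0"
  then have "e / C > 0" using C_ge_1 by simp
  then have "norm a \<le> C * (\<rho> + e / C)"
    using \<open>0 \<le> \<rho>\<close> spec by (intro selfadj_norm_le[OF a]) (force simp: add_nonneg_pos)+
  then show "norm a \<le> C * \<rho> + e" using C_ge_1 by (simp add: distrib_left)
qed

text \<open>Passing to \<open>star a * a\<close> brings in the selfadjoint estimate. One C comes
  from the C*-inequality, one from that estimate, and the square root leaves a single C.\<close>

lemma norm_le_if_spec_star_mult:
  assumes a: "a \<in> L" and "0 \<le> \<rho>" and spec: "\<And>z. z \<in> spec (star a * a) \<Longrightarrow> cmod z \<le> \<rho>\<^sup>2"
  shows "norm a \<le> C * \<rho>"
proof (rule power2_le_imp_le)
  have "(norm a)\<^sup>2 \<le> C * norm (star a * a)" using a by (rule norm_le_star)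
  also have "\<dots> \<le> C * (C * \<rho>\<^sup>2)"
    using a C_ge_1 spec by (intro mult_left_mono selfadj_norm_le') (auto simp: star_mult)
  finally show "(norm a)\<^sup>2 \<le> (C * \<rho>)\<^sup>2" by (simp add: power2_eq_square algebra_simps)
qed (use C_ge_1 \<open>0 \<le> \<rho>\<close> in auto)

text \<open>The spectrum of a is real, and there \<open>map_poly cnj p * p\<close> takes the value
  |p t|^2, which bounds the spectrum of p(a)* p(a).\<close>

lemma norm_peval_le:
  assumes a: "a \<in> L" "star a = a" and "0 \<le> \<rho>" and le: "\<And>z. z \<in> spec a \<Longrightarrow> cmod (poly p z) \<le> \<rho>"
  shows "norm (peval p a) \<le> C * \<rho>"
proof (cases "spec a = {}")
  case True
  then have "peval p a = 0" using spec_empty_imp_trivial[OF a] by blast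
  then show ?thesis using C_ge_1 \<open>0 \<le> \<rho>\<close> by simp
next
  case False
  show ?thesis
  proof (rule norm_le_if_spec_star_mult)
    fix z assume "z \<in> spec (star (peval p a) * peval p a)"
    then have "z \<in> spec (peval (map_poly cnj p * p) a)" using a by (simp add: star_peval peval_mult)
    then obtain t where t: "t \<in> spec a" "z = poly (map_poly cnj p * p) t"
      using spec_peval_subset[OF a(1) False] by blast
    have "cnj t = t" using selfadj_spec_real[OF a t(1)] by (simp add: complex_eq_iff)
    then have "z = cnj (poly p t) * poly p t" using t by (simp add: poly_map_poly_cnj)
    then have "cmod z = (cmod (poly p t))\<^sup>2" by (simp add: norm_mult power2_eq_square)
    then show "cmod z \<le> \<rho>\<^sup>2" using le[OF t(1)] by (simp add: power_mono)
  qed (use a \<open>0 \<le> \<rho>\<close> in auto)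
qed

end

subsection \<open>Continuous functional calculus\<close>

lemma weierstrass_real_compact:
  fixes S :: "complex set"
  assumes S: "compact S" "\<And>z. z \<in> S \<Longrightarrow> Im z = 0" and f: "continuous_on S f" and "e > 0"
  shows "\<exists>p. \<forall>z\<in>S. cmod (poly p z - f z) < e"
proof -
  define S' where "S' = Re ` S"
  have S': "compact S'" unfolding S'_def using S(1) by (intro compact_continuous_image continuous_intros)
  have S'S: "complex_of_real x \<in> S" if "x \<in> S'" for x
    using that S(2) unfolding S'_def by (metis complex_is_Real_iff imageE of_real_Re)
  have f': "continuous_on S' (\<lambda>x. f (complex_of_real x))"
    by (rule continuous_on_compose2[OF f]) (auto intro!: continuous_intros S'S)
  have approx: "\<exists>p. \<forall>z\<in>S. cmod (poly p z - complex_of_real (g (Re z))) < e / 2"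
    if g: "continuous_on S' g" for g
  proof -
    obtain u where u: "real_polynomial_function u" "\<And>x. x \<in> S' \<Longrightarrow> \<bar>g x - u x\<bar> < e / 2"
      using Stone_Weierstrass_real_polynomial_function[OF S' g, of "e / 2"] \<open>e > 0\<close> by auto
    obtain b n where b: "u = (\<lambda>x. \<Sum>i\<le>n. b i * x ^ i)"
      using u(1) real_polynomial_function_iff_sum by auto
    define p where "p = (\<Sum>i\<le>n. monom (complex_of_real (b i)) i)"
    have "cmod (poly p z - complex_of_real (g (Re z))) < e / 2" if "z \<in> S" for z
    proof -
      have z: "z = complex_of_real (Re z)" using S(2)[OF that] by (simp add: complex_eq_iff)
      have "poly p z = complex_of_real (u (Re z))"
        by (subst z) (simp add: p_def b poly_sum poly_monom)
      then have "poly p z - complex_of_real (g (Re z)) = complex_of_real (u (Re z) - g (Re z))" by simp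
      then have "cmod (poly p z - complex_of_real (g (Re z))) = \<bar>u (Re z) - g (Re z)\<bar>"
        by (simp only: norm_of_real)
      then show ?thesis using u(2)[of "Re z"] that by (simp add: S'_def abs_minus_commute)
    qed
    then show ?thesis by blast
  qed
  obtain p where p: "\<forall>z\<in>S. cmod (poly p z - complex_of_real (Re (f (complex_of_real (Re z))))) < e / 2"
    using approx[OF continuous_on_Re[OF f']] by blast
  obtain q where q: "\<forall>z\<in>S. cmod (poly q z - complex_of_real (Im (f (complex_of_real (Re z))))) < e / 2"
    using approx[OF continuous_on_Im[OF f']] by blast
  have "cmod (poly (p + smult \<i> q) z - f z) < e" if "z \<in> S" for z
  proof -
    have z: "complex_of_real (Re z) = z" using S(2)[OF that] by (simp add: complex_eq_iff)
    have "poly (p + smult \<i> q) z - f z =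
        (poly p z - complex_of_real (Re (f z))) + \<i> * (poly q z - complex_of_real (Im (f z)))"
      using complex_eq[of "f z"] by (simp add: algebra_simps)
    then have "cmod (poly (p + smult \<i> q) z - f z) \<le>
        cmod (poly p z - complex_of_real (Re (f z))) + cmod (poly q z - complex_of_real (Im (f z)))"
      using norm_triangle_ineq norm_mult[of \<i>] by (metis mult_1 norm_ii)
    moreover have "cmod (poly p z - complex_of_real (Re (f z))) < e / 2" using p that z by force
    moreover have "cmod (poly q z - complex_of_real (Im (f z))) < e / 2" using q that z by force
    ultimately show ?thesis by linarith
  qed
  then show ?thesis by blast
qed

lemma weierstrass_sequence:
  fixes S :: "complex set"
  assumes S: "compact S" "\<And>z. z \<in> S \<Longrightarrow> Im z = 0" and f: "continuous_on S f"
  obtains p where "uniform_limit S (\<lambda>n. poly (p n)) f sequentially"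
proof -
  have "\<forall>n. \<exists>p. \<forall>z\<in>S. cmod (poly p z - f z) < inverse (real (Suc n))"
    using weierstrass_real_compact[OF S f] by simp
  then obtain p where p: "\<And>n z. z \<in> S \<Longrightarrow> cmod (poly (p n) z - f z) < inverse (real (Suc n))"
    by metis
  have "uniform_limit S (\<lambda>n. poly (p n)) f sequentially"
  proof (rule uniform_limitI)
    fix e :: real assume "e > 0"
    then obtain N where N: "N > 0" "inverse (real N) < e" using reals_Archimedean[of e]
      by (metis zero_less_Suc)
    have "\<forall>z\<in>S. dist (poly (p n) z) (f z) < e" if "n \<ge> N" for n
    proof
      fix z assume "z \<in> S"
      have "inverse (real (Suc n)) \<le> inverse (real N)" using N that by (intro le_imp_inverse_le) auto
      with p[OF \<open>z \<in> S\<close>, of n] N(2) show "dist (poly (p n) z) (f z) < e"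
        unfolding dist_norm by linarith
    qed
    then show "\<forall>\<^sub>F n in sequentially. \<forall>z\<in>S. dist (poly (p n) z) (f z) < e"
      using eventually_sequentially by blast
  qed
  then show ?thesis by (rule that)
qed

lemma (in cstar_subalgebra) tendsto_star:
  assumes "\<And>n. x n \<in> L" "y \<in> L" "x \<longlonglongrightarrow> y"
  shows "(\<lambda>n. star (x n)) \<longlonglongrightarrow> star y"
proof (rule Lim_null_comparison[of "\<lambda>n. star (x n) - star y" "\<lambda>n. C * norm (x n - y)", THEN LIM_zero_cancel])
  have "norm (star (x n) - star y) \<le> C * norm (x n - y)" for n
    using norm_le_norm_star[of "star (x n - y)"] assms by (simp add: star_diff)
  then show "\<forall>\<^sub>F n in sequentially. norm (star (x n) - star y) \<le> C * norm (x n - y)" by simp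
  show "(\<lambda>n. C * norm (x n - y)) \<longlonglongrightarrow> 0"
    using tendsto_mult_left[OF tendsto_norm[OF LIM_zero[OF assms(3)]], of C] by simp
qed

text \<open>The algebraic content of \<open>is_cfc\<close>, with \<Phi> left open so that the
  constructed calculus and any competitor are both instances. Continuity of \<Phi> is derived, not
  assumed.\<close>

locale functional_calculus = cstar_subalgebra +
  fixes a :: 'a and \<Phi> :: "(complex \<Rightarrow> complex) \<Rightarrow> 'a"
  assumes selfadj: "a \<in> L" "star a = a"
    and calc_mem: "continuous_on (spec a) f \<Longrightarrow> \<Phi> f \<in> L"
    and calc_cong: "continuous_on (spec a) f \<Longrightarrow> continuous_on (spec a) g \<Longrightarrow>
      (\<And>z. z \<in> spec a \<Longrightarrow> f z = g z) \<Longrightarrow> \<Phi> f = \<Phi> g"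
    and calc_add: "continuous_on (spec a) f \<Longrightarrow> continuous_on (spec a) g \<Longrightarrow>
      \<Phi> (\<lambda>z. f z + g z) = \<Phi> f + \<Phi> g"
    and calc_scale: "continuous_on (spec a) f \<Longrightarrow> \<Phi> (\<lambda>z. c * f z) = c *\<^sub>C \<Phi> f"
    and calc_mult: "continuous_on (spec a) f \<Longrightarrow> continuous_on (spec a) g \<Longrightarrow>
      \<Phi> (\<lambda>z. f z * g z) = \<Phi> f * \<Phi> g"
    and calc_cnj: "continuous_on (spec a) f \<Longrightarrow> \<Phi> (\<lambda>z. cnj (f z)) = star (\<Phi> f)"
    and calc_one: "\<Phi> (\<lambda>z. 1) = 1"
    and calc_id: "\<Phi> (\<lambda>z. z) = a"
begin

lemma calc_const: "\<Phi> (\<lambda>z. c) = c *\<^sub>C 1"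
  using calc_scale[of "\<lambda>z. 1" c] calc_one by simp

lemma calc_diff:
  assumes "continuous_on (spec a) f" "continuous_on (spec a) g"
  shows "\<Phi> (\<lambda>z. f z - g z) = \<Phi> f - \<Phi> g"
  using calc_add[OF assms(1) continuous_on_mult_left[OF assms(2), of "-1"]]
    calc_scale[OF assms(2), of "-1"] by (simp add: scaleC_minus_left)

lemma calc_poly: "\<Phi> (poly p) = peval p a"
proof (induction p)
  case 0
  then show ?case using calc_const[of 0] by (simp add: poly_0[abs_def])
next
  case (pCons c p)
  have "poly (pCons c p) = (\<lambda>z. c + z * poly p z)" by auto
  moreover have "continuous_on (spec a) (poly p)" by (intro continuous_intros)
  ultimately show ?case using pCons calc_add[of "\<lambda>z. c" "\<lambda>z. z * poly p z"] calc_mult[of "\<lambda>z. z" "poly p"]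
    by (simp add: calc_const calc_id peval_pCons continuous_intros)
qed

text \<open>If m is not a value of f, then 1 / (f - m) is continuous on the spectrum and \<Phi> maps
  it to the required inverse.\<close>

lemma spec_calc_subset:
  assumes f: "continuous_on (spec a) f"
  shows "spec (\<Phi> f) \<subseteq> f ` spec a"
proof
  fix m assume m: "m \<in> spec (\<Phi> f)"
  show "m \<in> f ` spec a"
  proof (rule ccontr)
    assume n: "m \<notin> f ` spec a"
    define d where "d = (\<lambda>z. f z - m)"
    define g where "g = (\<lambda>z. inverse (d z))"
    have d: "continuous_on (spec a) d" unfolding d_def by (intro continuous_intros f)
    have d0: "d z \<noteq> 0" if "z \<in> spec a" for z using n that by (auto simp: d_def)
    have g: "continuous_on (spec a) g" unfolding g_def using d0 by (intro continuous_intros d) auto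
    have "\<Phi> d * \<Phi> g = \<Phi> (\<lambda>z. d z * g z)" "\<Phi> g * \<Phi> d = \<Phi> (\<lambda>z. g z * d z)"
      using d g by (simp_all add: calc_mult)
    moreover have "\<Phi> (\<lambda>z. d z * g z) = \<Phi> (\<lambda>z. 1)" "\<Phi> (\<lambda>z. g z * d z) = \<Phi> (\<lambda>z. 1)"
      by (rule calc_cong; use d0 in \<open>auto intro!: continuous_intros d g simp: g_def\<close>)+
    ultimately have "inverse_of (\<Phi> d) (\<Phi> g)" using calc_mem[OF g] calc_one by (simp add: inverse_of_def)
    moreover have "\<Phi> d = \<Phi> f - m *\<^sub>C 1"
      unfolding d_def using f by (simp add: calc_diff calc_const)
    ultimately show False using m by (auto simp: spec_def invertible_in_def)
  qed
qed

text \<open>Automatic continuity: the spectrum of \<Phi>(|f|^2) consists of values of |f|^2, and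
  \<Phi>(|f|^2) is the star product of \<Phi>(f) with itself.\<close>

lemma norm_calc_le:
  assumes f: "continuous_on (spec a) f" and "0 \<le> \<rho>" and le: "\<And>z. z \<in> spec a \<Longrightarrow> cmod (f z) \<le> \<rho>"
  shows "norm (\<Phi> f) \<le> C * \<rho>"
proof (rule norm_le_if_spec_star_mult)
  have cont: "continuous_on (spec a) (\<lambda>z. cnj (f z) * f z)" by (intro continuous_intros f)
  fix z assume "z \<in> spec (star (\<Phi> f) * \<Phi> f)"
  then have "z \<in> spec (\<Phi> (\<lambda>z. cnj (f z) * f z))"
    using f by (simp add: calc_mult[of "\<lambda>z. cnj (f z)" f] calc_cnj continuous_intros)
  then obtain t where t: "t \<in> spec a" "z = cnj (f t) * f t"
    using spec_calc_subset[of "\<lambda>z. cnj (f z) * f z"] cont by auto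
  then have "cmod z = (cmod (f t))\<^sup>2" by (simp add: norm_mult power2_eq_square)
  then show "cmod z \<le> \<rho>\<^sup>2" using le[OF t(1)] by (simp add: power_mono)
qed (use f calc_mem \<open>0 \<le> \<rho>\<close> in auto)

lemma calc_limit:
  assumes "\<And>n. continuous_on (spec a) (f n)" "uniform_limit (spec a) f g sequentially"
  shows "(\<lambda>n. \<Phi> (f n)) \<longlonglongrightarrow> \<Phi> g"
proof (rule LIMSEQ_I)
  fix e :: real assume "e > 0"
  have g: "continuous_on (spec a) g"
    by (rule uniform_limit_theorem[OF _ assms(2)]) (use assms(1) in auto)
  have "e / (2 * C) > 0" using \<open>e > 0\<close> C_ge_1 by simp
  from uniform_limitD[OF assms(2) this]
  obtain N where N: "\<And>n z. n \<ge> N \<Longrightarrow> z \<in> spec a \<Longrightarrow> dist (f n z) (g z) < e / (2 * C)"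
    unfolding eventually_sequentially by blast
  have "norm (\<Phi> (f n) - \<Phi> g) < e" if "n \<ge> N" for n
  proof -
    have "norm (\<Phi> (\<lambda>z. f n z - g z)) \<le> C * (e / (2 * C))"
    proof (rule norm_calc_le)
      show "cmod (f n z - g z) \<le> e / (2 * C)" if "z \<in> spec a" for z
        using N[OF \<open>n \<ge> N\<close> that] by (simp add: dist_norm)
    qed (use \<open>e > 0\<close> C_ge_1 assms(1) g in \<open>auto intro!: continuous_intros\<close>)
    also have "\<dots> < e" using \<open>e > 0\<close> C_ge_1 by simp
    finally show ?thesis using calc_diff[OF assms(1) g] by simp
  qed
  then show "\<exists>N. \<forall>n\<ge>N. norm (\<Phi> (f n) - \<Phi> g) < e" by blast
qed

lemma calc_poly_limit:
  assumes "uniform_limit (spec a) (\<lambda>n. poly (p n)) g sequentially"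
  shows "(\<lambda>n. peval (p n) a) \<longlonglongrightarrow> \<Phi> g"
  using calc_limit[OF _ assms] by (simp add: calc_poly continuous_intros)

end

context cstar_subalgebra begin

text \<open>Both calculi agree with \<open>peval\<close> on polynomials and are continuous for
  uniform convergence.\<close>

lemma functional_calculus_unique:
  assumes "functional_calculus L star C a \<Phi>" "functional_calculus L star C a \<Psi>"
    and f: "continuous_on (spec a) f"
  shows "\<Phi> f = \<Psi> f"
proof -
  interpret P: functional_calculus L star C a \<Phi> by fact
  interpret Q: functional_calculus L star C a \<Psi> by fact
  obtain p where p: "uniform_limit (spec a) (\<lambda>n. poly (p n)) f sequentially"
    using weierstrass_sequence[OF compact_spec[OF P.selfadj(1)] selfadj_spec_real[OF P.selfadj] f] by blast
  show ?thesis using LIMSEQ_unique[OF P.calc_poly_limit[OF p] Q.calc_poly_limit[OF p]] .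
qed

text \<open>The chosen sequence is immaterial by \<open>cfun_limit\<close>. For f that polynomials
  do not approximate uniformly on the spectrum the value is unspecified.\<close>

definition cfun :: "'r \<Rightarrow> (complex \<Rightarrow> complex) \<Rightarrow> 'r" where
  "cfun a f = lim (\<lambda>n. peval ((SOME p. uniform_limit (spec a) (\<lambda>n. poly (p n)) f sequentially) n) a)"

text \<open>Two sequences at once: p = q gives the Cauchy property, different ones give independence
  of the choice.\<close>

lemma peval_close:
  assumes a: "a \<in> L" "star a = a"
    and p: "uniform_limit (spec a) (\<lambda>n. poly (p n)) f sequentially"
    and q: "uniform_limit (spec a) (\<lambda>n. poly (q n)) f sequentially" and "e > 0"
  shows "\<exists>N. \<forall>m\<ge>N. \<forall>n\<ge>N. norm (peval (p m) a - peval (q n) a) < e"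
proof -
  have "e / (4 * C) > 0" using \<open>e > 0\<close> C_ge_1 by simp
  from uniform_limitD[OF p this] uniform_limitD[OF q this]
  obtain M N where M: "\<And>n z. n \<ge> M \<Longrightarrow> z \<in> spec a \<Longrightarrow> dist (poly (p n) z) (f z) < e / (4 * C)"
    and N: "\<And>n z. n \<ge> N \<Longrightarrow> z \<in> spec a \<Longrightarrow> dist (poly (q n) z) (f z) < e / (4 * C)"
    unfolding eventually_sequentially by blast
  have "norm (peval (p m) a - peval (q n) a) < e" if "m \<ge> max M N" "n \<ge> max M N" for m n
  proof -
    have "norm (peval (p m - q n) a) \<le> C * (e / (4 * C) + e / (4 * C))"
    proof (rule norm_peval_le[OF a])
      fix z assume "z \<in> spec a"
      then have "dist (poly (p m) z) (f z) < e / (4 * C)" "dist (poly (q n) z) (f z) < e / (4 * C)"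
        using M N that by auto
      then show "cmod (poly (p m - q n) z) \<le> e / (4 * C) + e / (4 * C)"
        using dist_triangle2[of "poly (p m) z" "poly (q n) z" "f z"] by (simp add: dist_norm)
    qed (use \<open>e / (4 * C) > 0\<close> in auto)
    also have "\<dots> < e" using \<open>e > 0\<close> C_ge_1 by (simp add: field_simps)
    finally show ?thesis by (simp add: peval_diff)
  qed
  then show ?thesis by blast
qed

lemma cfun_limit:
  assumes a: "a \<in> L" "star a = a"
    and p: "uniform_limit (spec a) (\<lambda>n. poly (p n)) f sequentially"
  shows "(\<lambda>n. peval (p n) a) \<longlonglongrightarrow> cfun a f"
proof -
  define q where "q = (SOME p. uniform_limit (spec a) (\<lambda>n. poly (p n)) f sequentially)"
  have q: "uniform_limit (spec a) (\<lambda>n. poly (q n)) f sequentially"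
    using someI[of "\<lambda>p. uniform_limit (spec a) (\<lambda>n. poly (p n)) f sequentially", OF p]
    by (simp only: q_def)
  have "Cauchy (\<lambda>n. peval (q n) a)"
    using peval_close[OF a q q] by (intro CauchyI) blast
  then have lim: "(\<lambda>n. peval (q n) a) \<longlonglongrightarrow> cfun a f"
    unfolding cfun_def q_def[symmetric] by (simp add: Cauchy_convergent_iff convergent_LIMSEQ_iff)
  have "(\<lambda>n. peval (p n) a - peval (q n) a) \<longlonglongrightarrow> 0"
  proof (rule LIMSEQ_I)
    fix e :: real assume "e > 0"
    from peval_close[OF a p q this] show "\<exists>N. \<forall>n\<ge>N. norm (peval (p n) a - peval (q n) a - 0) < e" by auto
  qed
  from tendsto_add[OF this lim] show ?thesis by simp
qed

lemma cfun_calculus: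
  assumes a: "a \<in> L" "star a = a"
  shows "functional_calculus L star C a (cfun a)"
proof -
  have ex: "\<exists>p. uniform_limit (spec a) (\<lambda>n. poly (p n)) f sequentially" if "continuous_on (spec a) f" for f
    using weierstrass_sequence[OF compact_spec[OF a(1)] selfadj_spec_real[OF a] that] by blast
  \<comment> \<open>Uniform limits pass to products only for bounded limit functions.\<close>
  have bd: "bounded (f ` spec a)" if "continuous_on (spec a) f" for f :: "complex \<Rightarrow> complex"
    using compact_continuous_image[OF that compact_spec[OF a(1)]] by (rule compact_imp_bounded)
  have mem: "cfun a f \<in> L" if f: "continuous_on (spec a) f" for f
  proof -
    obtain p where p: "uniform_limit (spec a) (\<lambda>n. poly (p n)) f sequentially" using ex[OF f] by blast
    show ?thesis using closed_sequentially[OF closed_L _ cfun_limit[OF a p]] a by simp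
  qed
  show ?thesis
  proof
    show "a \<in> L" "star a = a" by fact+
    show "cfun a f \<in> L" if "continuous_on (spec a) f" for f by (rule mem[OF that])
    show "cfun a f = cfun a g"
      if f: "continuous_on (spec a) f" and "\<And>z. z \<in> spec a \<Longrightarrow> f z = g z" for f g
    proof -
      obtain p where p: "uniform_limit (spec a) (\<lambda>n. poly (p n)) f sequentially" using ex[OF f] by blast
      then have q: "uniform_limit (spec a) (\<lambda>n. poly (p n)) g sequentially"
        using that(2) uniform_limit_cong'[of "spec a" "\<lambda>n. poly (p n)" "\<lambda>n. poly (p n)" f g sequentially] by simp
      show ?thesis by (rule LIMSEQ_unique[OF cfun_limit[OF a p] cfun_limit[OF a q]])
    qed
    show "cfun a (\<lambda>z. f z + g z) = cfun a f + cfun a g"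
      if f: "continuous_on (spec a) f" and g: "continuous_on (spec a) g" for f g
    proof -
      obtain p q where p: "uniform_limit (spec a) (\<lambda>n. poly (p n)) f sequentially"
        and q: "uniform_limit (spec a) (\<lambda>n. poly (q n)) g sequentially" using ex[OF f] ex[OF g] by blast
      have "uniform_limit (spec a) (\<lambda>n. poly (p n + q n)) (\<lambda>z. f z + g z) sequentially"
        using uniform_limit_add[OF p q] by (simp add: poly_add[abs_def])
      from LIMSEQ_unique[OF cfun_limit[OF a this]] show ?thesis
        using tendsto_add[OF cfun_limit[OF a p] cfun_limit[OF a q]] by (simp add: peval_add)
    qed
    show mult: "cfun a (\<lambda>z. f z * g z) = cfun a f * cfun a g"
      if f: "continuous_on (spec a) f" and g: "continuous_on (spec a) g" for f g
    proof -
      obtain p q where p: "uniform_limit (spec a) (\<lambda>n. poly (p n)) f sequentially"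
        and q: "uniform_limit (spec a) (\<lambda>n. poly (q n)) g sequentially" using ex[OF f] ex[OF g] by blast
      have "uniform_limit (spec a) (\<lambda>n. poly (p n * q n)) (\<lambda>z. f z * g z) sequentially"
        using uniform_lim_mult[OF p q bd[OF f] bd[OF g]] by (simp add: poly_mult[abs_def])
      from LIMSEQ_unique[OF cfun_limit[OF a this]] show ?thesis
        using tendsto_mult[OF cfun_limit[OF a p] cfun_limit[OF a q]] by (simp add: peval_mult)
    qed
    have const: "cfun a (poly p) = peval p a" for p
    proof -
      have "uniform_limit (spec a) (\<lambda>n. poly p) (poly p) sequentially"
        by (rule uniform_limitI) simp
      from LIMSEQ_unique[OF cfun_limit[OF a this] tendsto_const] show ?thesis .
    qed
    show "cfun a (\<lambda>z. c * f z) = c *\<^sub>C cfun a f" if f: "continuous_on (spec a) f" for f c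
      using mult[of "poly [:c:]" f] const[of "[:c:]"] f
      by (simp add: peval_pCons scaleC_mult_left)
    show "cfun a (\<lambda>z. 1) = 1" using const[of 1] by (simp add: poly_1[abs_def])
    show "cfun a (\<lambda>z. z) = a" using const[of "[:0, 1:]"] by (simp add: peval_X poly_pCons[abs_def])
    show "cfun a (\<lambda>z. cnj (f z)) = star (cfun a f)" if f: "continuous_on (spec a) f" for f
    proof -
      obtain p where p: "uniform_limit (spec a) (\<lambda>n. poly (p n)) f sequentially" using ex[OF f] by blast
      \<comment> \<open>On the real spectrum, conjugating the coefficients of a polynomial
        conjugates its values.\<close>
      have real: "cnj z = z" if "z \<in> spec a" for z
        using selfadj_spec_real[OF a that] by (simp add: complex_eq_iff)
      have "uniform_limit (spec a) (\<lambda>n. poly (map_poly cnj (p n))) (\<lambda>z. cnj (f z)) sequentially"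
      proof (rule uniform_limitI)
        fix e :: real assume "e > 0"
        from uniform_limitD[OF p this]
        show "\<forall>\<^sub>F n in sequentially. \<forall>z\<in>spec a. dist (poly (map_poly cnj (p n)) z) (cnj (f z)) < e"
        proof eventually_elim
          case (elim n)
          then show ?case
            by (auto simp: poly_map_poly_cnj real dist_norm complex_cnj_diff[symmetric] simp del: complex_cnj_diff)
        qed
      qed
      from cfun_limit[OF a this] have "(\<lambda>n. star (peval (p n) a)) \<longlonglongrightarrow> cfun a (\<lambda>z. cnj (f z))"
        using a by (simp add: star_peval)
      moreover have "(\<lambda>n. star (peval (p n) a)) \<longlonglongrightarrow> star (cfun a f)"
        using a mem[OF f] by (intro tendsto_star cfun_limit p) auto
      ultimately show ?thesis by (rule LIMSEQ_unique)
    qed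
  qed
qed

end

subsection \<open>Positive elements\<close>

context cstar_subalgebra begin

text \<open>A purely spectral description, independent of \<open>C\<close>. That
  \<open>star b * b\<close> satisfies it is a theorem, \<open>positive_star_mult\<close>, proved for
  C = 1.\<close>

definition positive :: "'r \<Rightarrow> bool" where
  "positive a \<longleftrightarrow> a \<in> L \<and> star a = a \<and> (\<forall>z\<in>spec a. 0 \<le> Re z)"

lemma positive_cfun:
  assumes a: "a \<in> L" "star a = a" and f: "continuous_on (spec a) f"
    and nn: "\<And>z. z \<in> spec a \<Longrightarrow> Im (f z) = 0 \<and> 0 \<le> Re (f z)"
  shows "positive (cfun a f)"
proof -
  interpret A: functional_calculus L star C a "cfun a" by (rule cfun_calculus[OF a])
  have "star (cfun a f) = cfun a (\<lambda>z. cnj (f z))" using A.calc_cnj[OF f] by simp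
  also have "\<dots> = cfun a f"
    by (rule A.calc_cong) (use nn f in \<open>auto intro!: continuous_intros simp: complex_eq_iff\<close>)
  finally show ?thesis
    using A.calc_mem[OF f] A.spec_calc_subset[OF f] nn by (auto simp: positive_def)
qed

lemma positive_square:
  assumes a: "a \<in> L" "star a = a"
  shows "positive (a * a)"
proof -
  interpret A: functional_calculus L star C a "cfun a" by (rule cfun_calculus[OF a])
  have "positive (cfun a (\<lambda>z. z * z))"
    by (rule positive_cfun[OF a]) (use selfadj_spec_real[OF a] in \<open>auto intro!: continuous_intros\<close>)
  then show ?thesis using A.calc_mult[of "\<lambda>z. z" "\<lambda>z. z"] by (simp add: A.calc_id)
qed

definition neg_part :: "'r \<Rightarrow> 'r" where
  "neg_part a = cfun a (\<lambda>z. complex_of_real (max (- Re z) 0))"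

text \<open>On the spectrum, z n(z) = - n(z)^2 for n(z) = max (- z) 0. Compressing a by its negative
  part thus yields minus a cube, whose sign conflicts with a being a star product.\<close>

lemma neg_part:
  assumes a: "a \<in> L" "star a = a"
  shows "neg_part a \<in> L" "star (neg_part a) = neg_part a"
    and neg_part_mult: "neg_part a * a * neg_part a = - (neg_part a * neg_part a * neg_part a)"
proof -
  interpret A: functional_calculus L star C a "cfun a" by (rule cfun_calculus[OF a])
  let ?n = "\<lambda>z. complex_of_real (max (- Re z) 0)"
  have n: "continuous_on (spec a) ?n" by (intro continuous_intros)
  show "neg_part a \<in> L" unfolding neg_part_def by (rule A.calc_mem[OF n])
  show "star (neg_part a) = neg_part a" unfolding neg_part_def using A.calc_cnj[OF n] by simp
  have "cfun a (\<lambda>z. ?n z * z * ?n z) = cfun a (\<lambda>z. (-1) * (?n z * ?n z * ?n z))"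
  proof (rule A.calc_cong)
    show "?n z * z * ?n z = (-1) * (?n z * ?n z * ?n z)" if "z \<in> spec a" for z
      using selfadj_spec_real[OF a that] by (auto simp: max_def complex_eq_iff)
  qed (intro continuous_intros)+
  moreover have "cfun a (\<lambda>z. ?n z * z * ?n z) = neg_part a * a * neg_part a"
    using A.calc_mult[of "\<lambda>z. ?n z * z" ?n] A.calc_mult[of ?n "\<lambda>z. z"] n
    by (simp add: neg_part_def A.calc_id continuous_intros)
  moreover have "cfun a (\<lambda>z. (-1) * (?n z * ?n z * ?n z)) = - (neg_part a * neg_part a * neg_part a)"
    using A.calc_scale[of "\<lambda>z. ?n z * ?n z * ?n z" "-1"] A.calc_mult[of "\<lambda>z. ?n z * ?n z" ?n] A.calc_mult[of ?n ?n] n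
    by (simp add: neg_part_def scaleC_minus_left continuous_on_mult)
  ultimately show "neg_part a * a * neg_part a = - (neg_part a * neg_part a * neg_part a)" by simp
qed

text \<open>m is the power 3/2 of the negative part; it exhibits the cube as m* m.\<close>

lemma neg_part_cube_sqrt:
  assumes a: "a \<in> L" "star a = a"
  obtains m where "m \<in> L" "star m = m" "m * m = neg_part a * neg_part a * neg_part a"
proof -
  interpret A: functional_calculus L star C a "cfun a" by (rule cfun_calculus[OF a])
  let ?n = "\<lambda>z. complex_of_real (max (- Re z) 0)"
  let ?s = "\<lambda>z. complex_of_real (sqrt (max (- Re z) 0))"
  let ?m = "\<lambda>z. ?n z * ?s z"
  have n: "continuous_on (spec a) ?n" "continuous_on (spec a) ?m" by (intro continuous_intros)+
  have "cfun a ?m * cfun a ?m = cfun a (\<lambda>z. ?m z * ?m z)" using A.calc_mult[OF n(2,2)] by simp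
  also have "\<dots> = cfun a (\<lambda>z. ?n z * ?n z * ?n z)"
  proof (rule A.calc_cong)
    show "?m z * ?m z = ?n z * ?n z * ?n z" for z
    proof -
      have "?s z * ?s z = ?n z" by (simp flip: of_real_mult)
      then show ?thesis by (metis mult.assoc mult.commute)
    qed
  qed (intro continuous_intros)+
  also have "\<dots> = neg_part a * neg_part a * neg_part a"
    using A.calc_mult[of "\<lambda>z. ?n z * ?n z" ?n] A.calc_mult[of ?n ?n] n
    by (simp add: neg_part_def continuous_on_mult)
  finally have "cfun a ?m * cfun a ?m = neg_part a * neg_part a * neg_part a" .
  moreover have "star (cfun a ?m) = cfun a ?m" using A.calc_cnj[OF n(2)] by simp
  ultimately show ?thesis using that A.calc_mem[OF n(2)] by blast
qed

lemma selfadj_zero_if_square_zero: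
  assumes "a \<in> L" "star a = a" "a * a = 0"
  shows "a = 0"
  using norm_le_star[OF assms(1)] assms by simp

lemma positive_if_neg_part_cube_zero:
  assumes a: "a \<in> L" "star a = a" and "neg_part a * neg_part a * neg_part a = 0"
  shows "positive a"
proof -
  interpret A: functional_calculus L star C a "cfun a" by (rule cfun_calculus[OF a])
  let ?n = "\<lambda>z. complex_of_real (max (- Re z) 0)"
  let ?p = "\<lambda>z. complex_of_real (max (Re z) 0)"
  have c: "continuous_on (spec a) ?n" "continuous_on (spec a) ?p" by (intro continuous_intros)+
  \<comment> \<open>Two descents: the square of n^2 is n^4 = 0, so n^2 = 0, and then n = 0.\<close>
  have "neg_part a * neg_part a = 0"
    by (rule selfadj_zero_if_square_zero) (use neg_part[OF a] assms(3) in \<open>auto simp: star_mult mult.assoc[symmetric]\<close>)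
  then have "neg_part a = 0" using neg_part[OF a] selfadj_zero_if_square_zero by blast
  moreover have "cfun a (\<lambda>z. ?p z - ?n z) = cfun a (\<lambda>z. z)"
  proof (rule A.calc_cong)
    show "?p z - ?n z = z" if "z \<in> spec a" for z
      using selfadj_spec_real[OF a that] by (simp add: max_def complex_eq_iff)
  qed (intro continuous_intros)+
  ultimately have "cfun a ?p = a" using A.calc_diff[OF c(2,1)] by (simp add: A.calc_id neg_part_def)
  moreover have "positive (cfun a ?p)" by (rule positive_cfun[OF a c(2)]) auto
  ultimately show ?thesis by simp
qed

lemma spec_uminus: "z \<in> spec (- a) \<longleftrightarrow> - z \<in> spec a"
proof -
  have "- a - z *\<^sub>C 1 = (-1) *\<^sub>C (a - (- z) *\<^sub>C 1)"
    by (simp add: scaleC_minus_left)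
  then have "invertible_in (- a - z *\<^sub>C 1) \<longleftrightarrow> invertible_in (a - (- z) *\<^sub>C 1)"
    using invertible_in_scaleC_iff[of "-1"] by simp
  then show ?thesis by (simp add: spec_def)
qed

lemma positive_antisym:
  assumes "positive a" "positive (- a)"
  shows "a = 0"
proof -
  have a: "a \<in> L" "star a = a" using assms by (auto simp: positive_def)
  have "cmod z \<le> 0" if "z \<in> spec a" for z
  proof -
    have "- z \<in> spec (- a)" using that by (simp add: spec_uminus)
    then have "Re z = 0" using assms that by (force simp: positive_def)
    then show ?thesis using selfadj_spec_real[OF a that] by (simp add: complex_eq_iff)
  qed
  then have "norm a \<le> C * 0" by (intro selfadj_norm_le'[OF a]) auto
  then show ?thesis by simp
qed

text \<open>Jacobson's lemma: if r inverts s t - z, then (t r s - 1) / z inverts t s - z.\<close>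

lemma spec_mult_commute:
  assumes s: "s \<in> L" "t \<in> L" and z: "z \<in> spec (t * s)" "z \<noteq> 0"
  shows "z \<in> spec (s * t)"
proof (rule ccontr)
  assume "z \<notin> spec (s * t)"
  then obtain r where r: "r \<in> L" "(s * t - z *\<^sub>C 1) * r = 1" "r * (s * t - z *\<^sub>C 1) = 1"
    by (auto simp: spec_def invertible_in_def inverse_of_def)
  have r1: "s * (t * r) = 1 + z *\<^sub>C r" and r2: "r * (s * t) = 1 + z *\<^sub>C r"
    using r by (simp_all add: algebra_simps scaleC_mult_left scaleC_mult_right)
  have "(t * s - z *\<^sub>C 1) * (t * r * s - 1) = t * (s * (t * r)) * s - t * s - z *\<^sub>C (t * r * s) + z *\<^sub>C 1"
    by (simp add: algebra_simps scaleC_mult_left scaleC_mult_right scaleC_diff_right)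
  then have 1: "(t * s - z *\<^sub>C 1) * (t * r * s - 1) = z *\<^sub>C 1"
    by (simp add: r1 algebra_simps scaleC_mult_left scaleC_mult_right)
  have "(t * r * s - 1) * (t * s - z *\<^sub>C 1) = t * (r * (s * t)) * s - t * s - z *\<^sub>C (t * r * s) + z *\<^sub>C 1"
    by (simp add: algebra_simps scaleC_mult_left scaleC_mult_right scaleC_diff_right)
  then have 2: "(t * r * s - 1) * (t * s - z *\<^sub>C 1) = z *\<^sub>C 1"
    by (simp add: r2 algebra_simps scaleC_mult_left scaleC_mult_right)
  have "inverse_of (t * s - z *\<^sub>C 1) (inverse z *\<^sub>C (t * r * s - 1))"
    using 1 2 r s z(2) by (simp add: inverse_of_def scaleC_mult_left scaleC_mult_right scaleC_scaleC)
  then show False using z by (auto simp: spec_def invertible_in_def)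
qed

text \<open>Positivity becomes a norm condition, so sums can be treated by the triangle inequality.
  The forward direction is where C = 1 matters: otherwise it would only bound the norm by C
  t.\<close>

lemma positive_iff_norm_le:
  assumes "C = 1" and a: "a \<in> L" "star a = a" and t: "norm a \<le> t"
  shows "positive a \<longleftrightarrow> norm (t *\<^sub>C 1 - a) \<le> t"
proof
  interpret A: functional_calculus L star C a "cfun a" by (rule cfun_calculus[OF a])
  assume p: "positive a"
  have "norm (cfun a (\<lambda>z. complex_of_real t - z)) \<le> C * t"
  proof (rule A.norm_calc_le)
    show "0 \<le> t" using t norm_ge_zero[of a] by linarith
    show "cmod (complex_of_real t - z) \<le> t" if z: "z \<in> spec a" for z
    proof -
      have im: "Im z = 0" by (rule selfadj_spec_real[OF a z])
      then have zr: "z = complex_of_real (Re z)" by (simp add: complex_eq_iff)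
      have "0 \<le> Re z" using p z by (auto simp: positive_def)
      moreover have "Re z \<le> t" using spec_norm_bound[OF a(1) z] t complex_Re_le_cmod[of z] by linarith
      moreover have "cmod (complex_of_real t - z) = \<bar>t - Re z\<bar>"
        by (subst zr) (simp only: of_real_diff[symmetric] norm_of_real)
      ultimately show ?thesis by simp
    qed
  qed (intro continuous_intros)
  then show "norm (t *\<^sub>C 1 - a) \<le> t"
    using A.calc_diff[of "\<lambda>z. complex_of_real t" "\<lambda>z. z"] \<open>C = 1\<close> by (simp add: A.calc_const A.calc_id)
next
  assume le: "norm (t *\<^sub>C 1 - a) \<le> t"
  have "0 \<le> Re z" if z: "z \<in> spec a" for z
  proof -
    have "t *\<^sub>C 1 - a - (t - z) *\<^sub>C 1 = (-1) *\<^sub>C (a - z *\<^sub>C 1)"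
      by (simp add: scaleC_diff_left scaleC_minus_left)
    then have "t - z \<in> spec (t *\<^sub>C 1 - a)"
      using z invertible_in_scaleC_iff[of "-1" "a - z *\<^sub>C 1"] unfolding spec_def by simp
    then have "cmod (t - z) \<le> t" using spec_norm_bound[of "t *\<^sub>C 1 - a"] a le by fastforce
    then show ?thesis using complex_Re_le_cmod[of "t - z"] by simp
  qed
  then show "positive a" using a by (simp add: positive_def)
qed

lemma positive_add:
  assumes C: "C = 1" and ab: "positive a" "positive b"
  shows "positive (a + b)"
proof -
  have a: "a \<in> L" "star a = a" and b: "b \<in> L" "star b = b" using ab by (auto simp: positive_def)
  have "complex_of_real (norm a + norm b) *\<^sub>C 1 - (a + b) = (norm a *\<^sub>C 1 - a) + (norm b *\<^sub>C 1 - b)"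
    by (simp add: scaleC_add_left)
  then have "norm (complex_of_real (norm a + norm b) *\<^sub>C 1 - (a + b)) \<le> norm a + norm b"
    using positive_iff_norm_le[OF C a order_refl] positive_iff_norm_le[OF C b order_refl] ab
    by (metis add_mono norm_triangle_le)
  then show ?thesis
    using a b by (subst positive_iff_norm_le[OF C _ _ norm_triangle_ineq]) (auto simp: star_add)
qed

text \<open>Kaplansky's argument: for s = b n with n the negative part, s* s = - n^3, so - s* s is
  positive, and so is - s s* because the two spectra agree away from 0. But s* s + s s* is positive
  as a sum of selfadjoint squares, so s* s is positive as well and hence 0.\<close>

lemma positive_star_mult:
  assumes C: "C = 1" and b: "b \<in> L"
  shows "positive (star b * b)"
proof (rule positive_if_neg_part_cube_zero)
  let ?a = "star b * b"
  show a: "?a \<in> L" "star ?a = ?a" using b by (auto simp: star_mult)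
  define n where "n = neg_part ?a"
  have n: "n \<in> L" "star n = n" "n * ?a * n = - (n * n * n)"
    using neg_part[OF a] neg_part_mult[OF a] by (auto simp: n_def)
  define s where "s = b * n"
  have s: "s \<in> L" using b n by (simp add: s_def)
  have ss: "star s * s = - (n * n * n)"
    using b n by (simp add: s_def star_mult mult.assoc)
  obtain m where "m \<in> L" "star m = m" "m * m = n * n * n"
    using neg_part_cube_sqrt[OF a] by (auto simp: n_def)
  then have p1: "positive (- (star s * s))" using positive_square[of m] ss by simp
  have p2: "positive (- (s * star s))"
    unfolding positive_def
  proof (intro conjI ballI)
    fix z assume z: "z \<in> spec (- (s * star s))"
    show "0 \<le> Re z"
    proof (cases "z = 0")
      case False
      then have "z \<in> spec (- (star s * s))"
        using spec_mult_commute[of "star s" "- s" z] s z by simp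
      then show ?thesis using p1 by (auto simp: positive_def)
    qed simp
  qed (use s in \<open>auto simp: star_minus star_mult\<close>)
  define u v where "u = s + star s" and "v = \<i> *\<^sub>C (s - star s)"
  have u: "u \<in> L" "star u = u" using s by (auto simp: u_def star_add add.commute)
  have v: "v \<in> L" "star v = v"
    using s by (auto simp: v_def star_scaleC star_diff scaleC_diff_right scaleC_minus_left)
  have "u * u + v * v = star s * s + star s * s + (s * star s + s * star s)"
    by (simp add: u_def v_def algebra_simps scaleC_mult_left scaleC_mult_right scaleC_scaleC
        scaleC_diff_right scaleC_minus_left)
  then have eq: "star s * s + star s * s = u * u + v * v + (- (s * star s) + - (s * star s))"
    by (simp add: algebra_simps)
  have "positive (star s * s + star s * s)"
    unfolding eq using u v p2 by (intro positive_add[OF C] positive_square) auto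
  moreover have "positive (- (star s * s + star s * s))"
    using positive_add[OF C p1 p1] by (simp add: algebra_simps)
  ultimately have "star s * s + star s * s = 0" by (rule positive_antisym)
  then have "2 *\<^sub>R (star s * s) = 0" by (simp add: scaleR_2)
  then show "neg_part ?a * neg_part ?a * neg_part ?a = 0" using ss by (simp add: n_def)
qed

end

subsection \<open>Bounded complex-linear operators\<close>

definition scaleC_blinfun :: "complex \<Rightarrow> 'h::complex_normed_vector \<Rightarrow>\<^sub>L 'h" where
  "scaleC_blinfun c = Blinfun (scaleC c)"

lemma scaleC_blinfun_apply [simp]: "blinfun_apply (scaleC_blinfun c) x = c *\<^sub>C x"
  unfolding scaleC_blinfun_def
  by (simp add: bounded_linear_Blinfun_apply bounded_bilinear.bounded_linear_right[OF bounded_bilinear_scaleC])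

text \<open>Bounded linear functions of the analysis library are real linear; the complex scalar
  action on them is an algebra action only after restriction to complex linear ones.\<close>

typedef (overloaded) 'h bop =
  "{f :: 'h::{complex_normed_vector, banach} \<Rightarrow>\<^sub>L 'h. \<forall>c x. blinfun_apply f (c *\<^sub>C x) = c *\<^sub>C blinfun_apply f x}"
  by (rule exI[of _ 0]) simp

setup_lifting type_definition_bop

instantiation bop :: ("{complex_normed_vector, banach}") real_normed_vector
begin

lift_definition zero_bop :: "'a bop" is 0 by simp
lift_definition plus_bop :: "'a bop \<Rightarrow> 'a bop \<Rightarrow> 'a bop" is "(+)"
  by (simp add: blinfun.add_left scaleC_add_right)
lift_definition minus_bop :: "'a bop \<Rightarrow> 'a bop \<Rightarrow> 'a bop" is "(-)"
  by (simp add: blinfun.diff_left scaleC_diff_right)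
lift_definition uminus_bop :: "'a bop \<Rightarrow> 'a bop" is uminus
  by (simp add: blinfun.minus_left scaleC_minus_right)
lift_definition scaleR_bop :: "real \<Rightarrow> 'a bop \<Rightarrow> 'a bop" is scaleR
  by (simp add: blinfun.scaleR_left scaleC_scaleR)
lift_definition norm_bop :: "'a bop \<Rightarrow> real" is norm .

definition dist_bop :: "'a bop \<Rightarrow> 'a bop \<Rightarrow> real" where "dist_bop f g = norm (f - g)"
definition sgn_bop :: "'a bop \<Rightarrow> 'a bop" where "sgn_bop f = inverse (norm f) *\<^sub>R f"
definition "(uniformity :: ('a bop \<times> 'a bop) filter) = (INF e\<in>{0 <..}. principal {(x, y). dist x y < e})"
definition open_bop :: "'a bop set \<Rightarrow> bool"
  where "open_bop S = (\<forall>x\<in>S. \<forall>\<^sub>F (x', y) in uniformity. x' = x \<longrightarrow> y \<in> S)"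

instance
proof
  fix f g h :: "'a bop" and r s :: real
  show "f + g + h = f + (g + h)" "f + g = g + f" "0 + f = f" "- f + f = 0" "f - g = f + - g"
    by (transfer, simp add: algebra_simps)+
  show "r *\<^sub>R (f + g) = r *\<^sub>R f + r *\<^sub>R g" "(r + s) *\<^sub>R f = r *\<^sub>R f + s *\<^sub>R f"
    "r *\<^sub>R s *\<^sub>R f = (r * s) *\<^sub>R f" "1 *\<^sub>R f = f"
    by (transfer, simp add: algebra_simps)+
  show "dist f g = norm (f - g)" "sgn f = inverse (norm f) *\<^sub>R f" by (simp_all add: dist_bop_def sgn_bop_def)
  show "(uniformity :: ('a bop \<times> 'a bop) filter) = (INF e\<in>{0 <..}. principal {(x, y). dist x y < e})"
    by (rule uniformity_bop_def)
  show "open U = (\<forall>x\<in>U. \<forall>\<^sub>F (x', y) in uniformity. x' = x \<longrightarrow> y \<in> U)" for U :: "'a bop set"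
    by (rule open_bop_def)
  show "norm f = 0 \<longleftrightarrow> f = 0" by transfer simp
  show "norm (f + g) \<le> norm f + norm g" by transfer (rule norm_triangle_ineq)
  show "norm (r *\<^sub>R f) = \<bar>r\<bar> * norm f" by transfer simp
qed

end

instantiation bop :: ("{complex_normed_vector, banach}") complex_normed_vector
begin

lift_definition scaleC_bop :: "complex \<Rightarrow> 'a bop \<Rightarrow> 'a bop" is "\<lambda>c f. scaleC_blinfun c o\<^sub>L f"
  by (simp add: scaleC_scaleC mult.commute)

instance
proof
  fix f g :: "'a bop" and r :: real and c d :: complex
  show "c *\<^sub>C (f + g) = c *\<^sub>C f + c *\<^sub>C g" "(c + d) *\<^sub>C f = c *\<^sub>C f + d *\<^sub>C f"
    "c *\<^sub>C d *\<^sub>C f = (c * d) *\<^sub>C f" "complex_of_real r *\<^sub>C f = r *\<^sub>R f"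
    by (transfer, auto intro!: blinfun_eqI
        simp: blinfun.bilinear_simps scaleC_add_left scaleC_add_right scaleC_scaleC scaleC_of_real)+
  show "norm (c *\<^sub>C f) = cmod c * norm f"
  proof (rule antisym)
    have le: "norm (d *\<^sub>C g) \<le> cmod d * norm g" for d and g :: "'a bop"
    proof (transfer, rule norm_blinfun_bound)
      fix d and g :: "'a \<Rightarrow>\<^sub>L 'a" and x
      show "norm (blinfun_apply (scaleC_blinfun d o\<^sub>L g) x) \<le> cmod d * norm g * norm x"
        using mult_left_mono[OF norm_blinfun[of g x] norm_ge_zero[of d]] by (simp add: norm_scaleC)
    qed simp
    show "norm (c *\<^sub>C f) \<le> cmod c * norm f" by (rule le)
    show "cmod c * norm f \<le> norm (c *\<^sub>C f)"
    proof (cases "c = 0")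
      case False
      have "inverse c *\<^sub>C c *\<^sub>C f = f"
        using False by (transfer, auto intro!: blinfun_eqI simp: scaleC_scaleC)
      then have "norm f \<le> cmod (inverse c) * norm (c *\<^sub>C f)" using le[of "inverse c" "c *\<^sub>C f"] by simp
      then show ?thesis using False by (simp add: norm_inverse norm_divide field_simps)
    qed simp
  qed
qed

end

instance bop :: ("{complex_normed_vector, banach}") banach
proof
  fix X :: "nat \<Rightarrow> 'a bop" assume X: "Cauchy X"
  have norm_Rep: "norm (Rep_bop f - Rep_bop g) = norm (f - g)" for f g :: "'a bop" by transfer simp
  have "Cauchy (\<lambda>n. Rep_bop (X n))"
    using X unfolding Cauchy_iff norm_Rep by (simp add: norm_Rep)
  then obtain l where l: "(\<lambda>n. Rep_bop (X n)) \<longlonglongrightarrow> l" by (auto simp: Cauchy_convergent_iff convergent_def)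
  have "blinfun_apply l (c *\<^sub>C x) = c *\<^sub>C blinfun_apply l x" for c x
  proof (rule LIMSEQ_unique)
    show "(\<lambda>n. blinfun_apply (Rep_bop (X n)) (c *\<^sub>C x)) \<longlonglongrightarrow> blinfun_apply l (c *\<^sub>C x)"
      by (intro tendsto_intros l)
    have "(\<lambda>n. c *\<^sub>C blinfun_apply (Rep_bop (X n)) x) \<longlonglongrightarrow> c *\<^sub>C blinfun_apply l x"
      by (intro tendsto_scaleC tendsto_intros l)
    then show "(\<lambda>n. blinfun_apply (Rep_bop (X n)) (c *\<^sub>C x)) \<longlonglongrightarrow> c *\<^sub>C blinfun_apply l x"
      using Rep_bop[of "X _"] by simp
  qed
  then have "Rep_bop (Abs_bop l) = l" by (intro Abs_bop_inverse) auto
  then have "(\<lambda>n. norm (X n - Abs_bop l)) \<longlonglongrightarrow> 0"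
    using tendsto_norm[OF LIM_zero[OF l]] by (simp add: norm_Rep[symmetric])
  then have "(\<lambda>n. X n - Abs_bop l) \<longlonglongrightarrow> 0" by (rule tendsto_norm_zero_cancel)
  then show "convergent X" using LIM_zero_cancel by (auto simp: convergent_def)
qed

instantiation bop :: ("{complex_normed_vector, banach}") complex_banach_algebra
begin

lift_definition one_bop :: "'a bop" is id_blinfun by simp
lift_definition times_bop :: "'a bop \<Rightarrow> 'a bop \<Rightarrow> 'a bop" is "(o\<^sub>L)" by simp

instance
proof
  fix f g h :: "'a bop" and r :: real and c :: complex
  show "f * g * h = f * (g * h)" "1 * f = f" "f * 1 = f" "(f + g) * h = f * h + g * h"
    "f * (g + h) = f * g + f * h" "r *\<^sub>R f * g = r *\<^sub>R (f * g)" "f * r *\<^sub>R g = r *\<^sub>R (f * g)"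
    by (transfer, auto intro!: blinfun_eqI simp: blinfun.bilinear_simps)+
  show "norm (f * g) \<le> norm f * norm g" by transfer (rule norm_blinfun_compose)
  show "(c *\<^sub>C f) * g = c *\<^sub>C (f * g)" "f * (c *\<^sub>C g) = c *\<^sub>C (f * g)"
    by (transfer, auto intro!: blinfun_eqI)+
  show "norm (1 :: 'a bop) \<le> 1" by transfer (rule norm_blinfun_id_le)
qed

end

lift_definition app :: "'h::{complex_normed_vector, banach} bop \<Rightarrow> 'h \<Rightarrow> 'h" is blinfun_apply .

lemma app_simps [simp]:
  "app 0 x = 0" "app 1 x = x" "app (f + g) x = app f x + app g x" "app (f - g) x = app f x - app g x"
  "app (- f) x = - app f x" "app (f * g) x = app f (app g x)" "app (r *\<^sub>R f) x = r *\<^sub>R app f x"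
  "app (c *\<^sub>C f) x = c *\<^sub>C app f x"
  by (transfer, simp add: blinfun.bilinear_simps)+

lemma norm_app_le: "norm (app f x) \<le> norm f * norm x"
  by transfer (rule norm_blinfun)

lemma norm_bop_le: "0 \<le> b \<Longrightarrow> (\<And>x. norm (app f x) \<le> b * norm x) \<Longrightarrow> norm f \<le> b"
  by transfer (rule norm_blinfun_bound)

lemma bop_eqI: "(\<And>x. app f x = app g x) \<Longrightarrow> f = g"
  by transfer (rule blinfun_eqI)

lemma bounded_linear_app: "bounded_linear (app f)"
  by transfer (rule blinfun.bounded_linear_right)

lemma bounded_bilinear_app: "bounded_bilinear app"
proof
  interpret bounded_linear "app f" for f :: "'a bop" by (rule bounded_linear_app)
  show "app f (x + y) = app f x + app f y" "app f (r *\<^sub>R x) = r *\<^sub>R app f x" for f :: "'a bop" and x y r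
    by (simp_all add: add scaleR)
  show "\<exists>K. \<forall>(f :: 'a bop) x. norm (app f x) \<le> norm f * norm x * K"
    by (rule exI[of _ 1]) (simp add: norm_app_le)
qed simp_all

lemmas tendsto_app = bounded_bilinear.tendsto[OF bounded_bilinear_app]

lemma app_exists:
  assumes "bounded_linear f" "\<And>c x. f (c *\<^sub>C x) = c *\<^sub>C f x"
  shows "\<exists>F. app F = f"
proof
  have "app (Abs_bop (Blinfun f)) = blinfun_apply (Blinfun f)"
    unfolding app.rep_eq by (subst Abs_bop_inverse) (use assms in \<open>auto simp: bounded_linear_Blinfun_apply\<close>)
  then show "app (Abs_bop (Blinfun f)) = f" using assms by (simp add: bounded_linear_Blinfun_apply)
qed

text \<open>Passes from the plain functions of the statement to elements of the algebra; its value
  is arbitrary unless f is bounded and complex linear.\<close>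

definition mk_bop :: "('h \<Rightarrow> 'h) \<Rightarrow> 'h::{complex_normed_vector, banach} bop" where
  "mk_bop f = (SOME F. app F = f)"

lemma mk_bop_app [simp]: "mk_bop (app F) = F"
  unfolding mk_bop_def by (rule some_equality) (auto intro: bop_eqI)

lemma app_mk_bop: "bounded_linear f \<Longrightarrow> (\<And>c x. f (c *\<^sub>C x) = c *\<^sub>C f x) \<Longrightarrow> app (mk_bop f) = f"
  unfolding mk_bop_def by (rule someI_ex) (rule app_exists)

subsection \<open>Hilbert modules\<close>

context hilbert_module begin

lemma ip_add_left: "ip (x + y) z = ip x z + ip y z"
  using cstar_ip[of z "x + y"] cstar_ip[of z x] cstar_ip[of z y] by (simp add: ip_add_right cstar_add)

lemma ip_scaleC_left: "ip (c *\<^sub>C x) y = cnj c *\<^sub>C ip x y"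
  using cstar_ip[of y "c *\<^sub>C x"] cstar_ip[of y x] by (simp add: ip_scaleC_right cstar_scaleC)

lemma ip_minus_right: "ip x (- y) = - ip x y"
  using ip_scaleC_right[of x "-1" y] by (simp add: scaleC_minus_left)

lemma ip_minus_left: "ip (- x) y = - ip x y"
  using ip_scaleC_left[of "-1" x y] by (simp add: scaleC_minus_left)

lemma ip_diff_right: "ip x (y - z) = ip x y - ip x z"
  using ip_add_right[of x y "- z"] by (simp add: ip_minus_right)

lemma ip_diff_left: "ip (x - y) z = ip x z - ip y z"
  using ip_add_left[of x "- y" z] by (simp add: ip_minus_left)

lemma norm_ip_self: "norm (ip x x) = (norm x)\<^sup>2"
  by (simp add: norm_eq_sqrt_norm_ip)

lemma ip_left_cancel: "(\<And>y. ip x y = ip x' y) \<Longrightarrow> x = x'"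
  using ip_definite[of "x - x'"] by (simp add: ip_diff_left)

lemma ip_right_cancel: "(\<And>x. ip x y = ip x y') \<Longrightarrow> y = y'"
  using ip_definite[of "y - y'"] by (simp add: ip_diff_right)

text \<open>
  A Cauchy-Schwarz inequality up to a constant: polarisation and the triangle inequality suffice,
  no order theory of the coefficient algebra is needed.
\<close>

lemma norm_ip_le: "norm (ip x y) \<le> 4 * norm x * norm y"
proof -
  \<comment> \<open>The vectors x + y, x - y, x + i y, x - i y have norm at most 2. Their four
    squares sum to at most 16, against 4 times the inner product.\<close>
  have pol: "norm (ip x y) \<le> 4" if "norm x = 1" "norm y = 1" for x y
  proof -
    let ?q = "\<lambda>z. ip z z"
    have 1: "?q (x + y) - ?q (x - y) = 2 *\<^sub>R (ip x y + ip y x)"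
      by (simp add: ip_add_left ip_add_right ip_diff_left ip_diff_right scaleR_2)
    have 2: "?q (x + \<i> *\<^sub>C y) - ?q (x - \<i> *\<^sub>C y) = 2 *\<^sub>R (\<i> *\<^sub>C (ip x y - ip y x))"
      by (simp add: ip_add_left ip_add_right ip_diff_left ip_diff_right ip_scaleC_left ip_scaleC_right
          scaleR_2 scaleC_diff_right scaleC_add_right scaleC_minus_left)
    have "(?q (x + y) - ?q (x - y)) - \<i> *\<^sub>C (?q (x + \<i> *\<^sub>C y) - ?q (x - \<i> *\<^sub>C y)) = 4 *\<^sub>R ip x y"
      unfolding 1 2 by (simp add: scaleC_scaleR scaleC_scaleC scaleC_minus_left flip: scaleR_diff_right)
        (simp flip: scaleR_add_left mult_2 add: scaleR_2[symmetric])
    then have "4 * norm (ip x y) = norm ((?q (x + y) - ?q (x - y)) - \<i> *\<^sub>C (?q (x + \<i> *\<^sub>C y) - ?q (x - \<i> *\<^sub>C y)))"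
      by simp
    also have "\<dots> \<le> norm (?q (x + y)) + norm (?q (x - y)) + (norm (?q (x + \<i> *\<^sub>C y)) + norm (?q (x - \<i> *\<^sub>C y)))"
    proof -
      have "norm (\<i> *\<^sub>C (?q (x + \<i> *\<^sub>C y) - ?q (x - \<i> *\<^sub>C y))) \<le> norm (?q (x + \<i> *\<^sub>C y)) + norm (?q (x - \<i> *\<^sub>C y))"
        by (simp add: norm_scaleC norm_triangle_ineq4)
      then show ?thesis
        by (intro order_trans[OF norm_triangle_ineq4] add_mono norm_triangle_ineq4)
    qed
    also have "\<dots> \<le> 4 + 4 + (4 + 4)"
    proof -
      have b: "norm (?q z) \<le> 4" if "norm z \<le> 2" for z
        using power_mono[OF that norm_ge_zero, of 2] by (simp add: norm_ip_self)
      have "norm (\<i> *\<^sub>C y) = 1" using \<open>norm y = 1\<close> by (simp add: norm_scaleC)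
      then show ?thesis
        using \<open>norm x = 1\<close> \<open>norm y = 1\<close> norm_triangle_ineq[of x y] norm_triangle_ineq4[of x y]
          norm_triangle_ineq[of x "\<i> *\<^sub>C y"] norm_triangle_ineq4[of x "\<i> *\<^sub>C y"]
        by (intro add_mono b) auto
    qed
    finally show ?thesis by simp
  qed
  have scale: "ip (r *\<^sub>R u) (s *\<^sub>R v) = (r * s) *\<^sub>R ip u v" for r s u v
    by (simp add: ip_scaleC_left ip_scaleC_right scaleC_scaleC mult.commute flip: scaleC_of_real)
  show ?thesis
  proof (cases "x = 0 \<or> y = 0")
    case True
    have "ip 0 y = 0" "ip x 0 = 0" using ip_scaleC_left[of 0 0 y] ip_scaleC_right[of x 0 0] by simp_all
    then show ?thesis using True by auto
  next
    case False
    then have "norm (ip ((1 / norm x) *\<^sub>R x) ((1 / norm y) *\<^sub>R y)) \<le> 4" by (intro pol) auto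
    then have "norm (ip x y) / (norm x * norm y) \<le> 4" by (simp add: scale)
    then show ?thesis using False by (simp add: field_simps)
  qed
qed

lemma bounded_bilinear_ip: "bounded_bilinear ip"
proof
  show "ip (r *\<^sub>R x) y = r *\<^sub>R ip x y" "ip x (r *\<^sub>R y) = r *\<^sub>R ip x y" for r x y
    by (simp_all add: ip_scaleC_left ip_scaleC_right flip: scaleC_of_real)
  show "\<exists>K. \<forall>x y. norm (ip x y) \<le> norm x * norm y * K"
    using norm_ip_le by (intro exI[of _ 4]) (simp add: algebra_simps)
qed (simp_all add: ip_add_left ip_add_right)

lemmas tendsto_ip = bounded_bilinear.tendsto[OF bounded_bilinear_ip]

end

section \<open>Adjoints between two Hilbert modules and their boundedness\<close>

locale hilbert_module_pair =
  H: hilbert_module actH ipH + K: hilbert_module actK ipK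
  for actH :: "'h::{complex_normed_vector, banach} \<Rightarrow> 'a::c_star_algebra \<Rightarrow> 'h" and ipH
    and actK :: "'k::{complex_normed_vector, banach} \<Rightarrow> 'a \<Rightarrow> 'k" and ipK
begin

lemma module_adj_unique:
  assumes "\<And>x y. ipK (T x) y = ipH x (S y)"
  shows "module_adj ipH ipK T = S"
  unfolding module_adj_def
proof (rule the_equality)
  show "\<forall>x y. ipK (T x) y = ipH x (S y)" using assms by simp
  fix S' assume "\<forall>x y. ipK (T x) y = ipH x (S' y)"
  then have "S' y = S y" for y by (intro H.ip_right_cancel) (simp flip: assms)
  then show "S' = S" by auto
qed

lemma adjoint_eq:
  assumes "T \<in> adjointable ipH ipK"
  shows "ipK (T x) y = ipH x (module_adj ipH ipK T y)"
proof -
  obtain S where S: "\<And>x y. ipK (T x) y = ipH x (S y)" using assms by (auto simp: adjointable_def)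
  then have "module_adj ipH ipK T = S" by (rule module_adj_unique)
  then show ?thesis using S by simp
qed

lemma adjoint_eq':
  assumes "T \<in> adjointable ipH ipK"
  shows "ipH (module_adj ipH ipK T y) x = ipK y (T x)"
  by (metis H.cstar_ip K.cstar_ip adjoint_eq assms)

lemma module_adj_mem: "T \<in> adjointable ipH ipK \<Longrightarrow> module_adj ipH ipK T \<in> adjointable ipK ipH"
  using adjoint_eq' by (auto simp: adjointable_def)

lemma adjointable_add: "T \<in> adjointable ipH ipK \<Longrightarrow> T (x + y) = T x + T y"
  by (rule K.ip_left_cancel) (simp add: adjoint_eq H.ip_add_left K.ip_add_left)

lemma adjointable_scaleC: "T \<in> adjointable ipH ipK \<Longrightarrow> T (c *\<^sub>C x) = c *\<^sub>C T x"
  by (rule K.ip_left_cancel) (simp add: adjoint_eq H.ip_scaleC_left K.ip_scaleC_left)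

text \<open>Uniform boundedness: the sets below are closed because \<open>T\<close> has an adjoint.\<close>

lemma adjointable_bounded_linear:
  assumes T: "T \<in> adjointable ipH ipK"
  shows "bounded_linear T"
proof -
  interpret Hb: bounded_bilinear ipH by (rule H.bounded_bilinear_ip)
  have lin: "T (x + y) = T x + T y" "T (r *\<^sub>R x) = r *\<^sub>R T x" for x y r
    using adjointable_add[OF T] adjointable_scaleC[OF T, of "complex_of_real r"] by (auto simp: scaleC_of_real)
  have diff: "T (x - y) = T x - T y" for x y
    using lin(1)[of x "- y"] lin(2)[of "-1" y] by simp
  define S where "S = module_adj ipH ipK T"
  define E where "E n = {x. \<forall>y. norm y \<le> 1 \<longrightarrow> norm (ipH x (S y)) \<le> real n}" for n :: nat
  have clE: "closed (E n)" for n
  proof -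
    have "E n = (\<Inter>y\<in>{y. norm y \<le> 1}. {x. norm (ipH x (S y)) \<le> real n})" by (auto simp: E_def)
    moreover have "closed {x. norm (ipH x (S y)) \<le> real n}" for y
      by (intro closed_Collect_le continuous_intros Hb.continuous_on)
    ultimately show ?thesis by auto
  qed
  \<comment> \<open>Testing against the normalised vector T x recovers its norm exactly.\<close>
  have E_bd: "norm (T x) \<le> real n" if "x \<in> E n" for x n
  proof (cases "T x = 0")
    case False
    let ?y = "(1 / norm (T x)) *\<^sub>R T x"
    have "ipH x (S ?y) = (1 / norm (T x)) *\<^sub>R ipK (T x) (T x)"
      unfolding S_def adjoint_eq[OF T, symmetric] using K.ip_scaleC_right[of "T x" "complex_of_real (1 / norm (T x))" "T x"]
      by (simp only: scaleC_of_real)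
    then have "norm (ipH x (S ?y)) = norm (T x)"
      using False by (simp add: K.norm_ip_self power2_eq_square)
    moreover have "norm ?y \<le> 1" using False by simp
    ultimately show ?thesis using that unfolding E_def by fastforce
  qed simp
  have cover: "(\<Union>n. E n) = UNIV"
  proof -
    have "\<exists>n. x \<in> E n" for x
    proof -
      obtain n where n: "4 * norm (T x) \<le> real n" using real_arch_simple by blast
      have "norm (ipH x (S y)) \<le> real n" if "norm y \<le> 1" for y
      proof -
        have "norm (ipH x (S y)) \<le> 4 * norm (T x) * norm y"
          unfolding S_def adjoint_eq[OF T, symmetric] by (rule K.norm_ip_le)
        also have "\<dots> \<le> 4 * norm (T x) * 1" using that by (intro mult_left_mono) auto
        finally show ?thesis using n by simp
      qed
      then show ?thesis by (auto simp: E_def)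
    qed
    then show ?thesis by auto
  qed
  have "\<exists>n. interior (E n) \<noteq> {}"
  proof (rule ccontr)
    assume "\<not> ?thesis"
    then have "euclidean interior_of \<Union>(range E) = {}"
      by (intro Baire_category_alt) (auto simp: completely_metrizable_space_euclidean clE)
    then show False using cover by simp
  qed
  then obtain n x0 where "x0 \<in> interior (E n)" by blast
  then obtain e where e: "e > 0" "ball x0 e \<subseteq> E n" by (auto simp: mem_interior)
  have "norm (T x) \<le> norm x * (4 * real n / e)" for x
  proof (cases "x = 0")
    case True then show ?thesis using lin(2)[of 0 0] by simp
  next
    case False
    \<comment> \<open>r x has length e / 2, so x0 + r x stays in the ball; T is at most n in norm at
      both points, which bounds r T x by 2 n.\<close>
    define r where "r = e / (2 * norm x)"
    have r: "r > 0" using False e by (simp add: r_def)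
    have "x0 + r *\<^sub>R x \<in> ball x0 e" using False e by (simp add: dist_norm r_def)
    then have "norm (T (x0 + r *\<^sub>R x)) \<le> real n" using e E_bd by blast
    moreover have "x0 \<in> E n" using e by auto
    then have "norm (T x0) \<le> real n" by (rule E_bd)
    ultimately have "norm (r *\<^sub>R T x) \<le> 2 * real n"
      using norm_triangle_ineq4[of "T (x0 + r *\<^sub>R x)" "T x0"] by (simp add: lin)
    then have "r * norm (T x) \<le> 2 * real n" using r by simp
    then show ?thesis using False e by (simp add: r_def field_simps)
  qed
  then show ?thesis using lin by (intro bounded_linear_intro)
qed

end

section \<open>The algebra of adjointable operators on one module\<close>

definition adj_ops :: "('h::{complex_normed_vector, banach} \<Rightarrow> 'h \<Rightarrow> 'a) \<Rightarrow> 'h bop set" where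
  "adj_ops ip = {F. app F \<in> adjointable ip ip}"

definition adj_star :: "('h::{complex_normed_vector, banach} \<Rightarrow> 'h \<Rightarrow> 'a) \<Rightarrow> 'h bop \<Rightarrow> 'h bop" where
  "adj_star ip F = mk_bop (module_adj ip ip (app F))"

context hilbert_module begin

sublocale self: hilbert_module_pair act ip act ip ..

lemma app_mk_bop_adjointable:
  assumes "f \<in> adjointable ip ip"
  shows "app (mk_bop f) = f"
  using app_mk_bop self.adjointable_bounded_linear[OF assms] self.adjointable_scaleC[OF assms] by blast

lemma mk_bop_mem: "f \<in> adjointable ip ip \<Longrightarrow> mk_bop f \<in> adj_ops ip"
  by (simp add: adj_ops_def app_mk_bop_adjointable)

lemma app_adj_star: "F \<in> adj_ops ip \<Longrightarrow> app (adj_star ip F) = module_adj ip ip (app F)"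
  by (simp add: adj_star_def adj_ops_def app_mk_bop_adjointable self.module_adj_mem)

lemma ip_app: "F \<in> adj_ops ip \<Longrightarrow> ip (app F x) y = ip x (app (adj_star ip F) y)"
  using self.adjoint_eq[of "app F"] by (simp add: app_adj_star adj_ops_def)

lemma adj_opsI: "(\<And>x y. ip (app F x) y = ip x (app G y)) \<Longrightarrow> F \<in> adj_ops ip"
  by (auto simp: adj_ops_def adjointable_def)

lemma adj_star_eqI:
  assumes "\<And>x y. ip (app F x) y = ip x (app G y)"
  shows "adj_star ip F = G"
  using self.module_adj_unique[OF assms] by (simp add: adj_star_def)

lemma adj_star_mem: "F \<in> adj_ops ip \<Longrightarrow> adj_star ip F \<in> adj_ops ip"
  by (simp add: adj_star_def adj_ops_def app_mk_bop_adjointable self.module_adj_mem)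

lemma adj_star_star: "F \<in> adj_ops ip \<Longrightarrow> adj_star ip (adj_star ip F) = F"
  by (rule adj_star_eqI) (metis cstar_ip ip_app)

text \<open>The constant of the Cauchy-Schwarz inequality becomes that of the C*-inequality, through
  F x having inner square <x, F* F x>. It is 4 in general and 1 for a C*-algebra as a module over
  itself.\<close>

lemma cstar_subalgebra_adj_ops:
  assumes C: "1 \<le> C" "\<And>x y. norm (ip x y) \<le> C * norm x * norm y"
  shows "cstar_subalgebra (adj_ops ip) (adj_star ip) C"
proof -
  have diff: "F - G \<in> adj_ops ip" "adj_star ip (F - G) = adj_star ip F - adj_star ip G"
    if "F \<in> adj_ops ip" "G \<in> adj_ops ip" for F G
    using that
    by (auto intro!: adj_opsI[of _ "adj_star ip F - adj_star ip G"] adj_star_eqI simp: ip_diff_left ip_diff_right ip_app)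
  have star_le: "norm (adj_star ip F) \<le> C * norm F" if F: "F \<in> adj_ops ip" for F
  proof (rule norm_bop_le)
    fix y let ?z = "app (adj_star ip F) y"
    have "norm ?z * norm ?z = norm (ip (app F ?z) y)"
      using F by (simp add: ip_app norm_ip_self power2_eq_square)
    also have "\<dots> \<le> C * norm (app F ?z) * norm y" by (rule C)
    also have "\<dots> \<le> C * (norm F * norm ?z) * norm y"
      using C by (intro mult_right_mono mult_left_mono norm_app_le) auto
    finally have "norm ?z * norm ?z \<le> (C * norm F * norm y) * norm ?z" by (simp add: algebra_simps)
    then show "norm ?z \<le> C * norm F * norm y"
      using C by (cases "norm ?z = 0") (auto simp: mult_le_cancel_right)
  qed (use C in simp)
  show ?thesis
  proof
    show "1 \<in> adj_ops ip" by (rule adj_opsI[of _ 1]) simp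
    fix F G assume F: "F \<in> adj_ops ip"
    show "c *\<^sub>C F \<in> adj_ops ip" "adj_star ip (c *\<^sub>C F) = cnj c *\<^sub>C adj_star ip F" for c
      using F by (auto intro!: adj_opsI[of _ "cnj c *\<^sub>C adj_star ip F"] adj_star_eqI
          simp: ip_app ip_scaleC_left ip_scaleC_right)
    show "adj_star ip F \<in> adj_ops ip" "adj_star ip (adj_star ip F) = F"
      using F by (simp_all add: adj_star_mem adj_star_star)
    show "(norm F)\<^sup>2 \<le> C * norm (adj_star ip F * F)"
    proof -
      have "norm F \<le> sqrt (C * norm (adj_star ip F * F))"
      proof (rule norm_bop_le)
        fix x
        have "(norm (app F x))\<^sup>2 = norm (ip x (app (adj_star ip F * F) x))"
          using F by (simp add: ip_app norm_ip_self flip: norm_ip_self)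
        also have "\<dots> \<le> C * norm x * norm (app (adj_star ip F * F) x)" by (rule C)
        also have "\<dots> \<le> C * norm x * (norm (adj_star ip F * F) * norm x)"
          using C by (intro mult_left_mono norm_app_le) auto
        also have "\<dots> = (sqrt (C * norm (adj_star ip F * F)) * norm x)\<^sup>2"
          using C by (simp add: power_mult_distrib power2_eq_square)
        finally show "norm (app F x) \<le> sqrt (C * norm (adj_star ip F * F)) * norm x"
          by (rule power2_le_imp_le) (use C in simp)
      qed (use C in simp)
      from power_mono[OF this norm_ge_zero, of 2] show ?thesis using C by simp
    qed
    assume G: "G \<in> adj_ops ip"
    show "F + G \<in> adj_ops ip" "adj_star ip (F + G) = adj_star ip F + adj_star ip G"
      using F G by (auto intro!: adj_opsI[of _ "adj_star ip F + adj_star ip G"] adj_star_eqI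
          simp: ip_app ip_add_left ip_add_right)
    show "F * G \<in> adj_ops ip" "adj_star ip (F * G) = adj_star ip G * adj_star ip F"
      using F G by (auto intro!: adj_opsI[of _ "adj_star ip G * adj_star ip F"] adj_star_eqI simp: ip_app)
  next
    show "closed (adj_ops ip)"
      unfolding closed_sequential_limits
    proof (intro allI impI)
      fix X F assume "(\<forall>n. X n \<in> adj_ops ip) \<and> X \<longlonglongrightarrow> F"
      then have X: "\<And>n. X n \<in> adj_ops ip" "X \<longlonglongrightarrow> F" by auto
      \<comment> \<open>For a limit to be adjointable an adjoint must be produced: by
        \<open>star_le\<close> the adjoints of X n converge too, and their limit serves for
        F.\<close>
      have "Cauchy (\<lambda>n. adj_star ip (X n))"
      proof (rule CauchyI)
        fix e :: real assume "e > 0"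
        then have "e / C > 0" using C by simp
        then obtain M where M: "\<And>m n. m \<ge> M \<Longrightarrow> n \<ge> M \<Longrightarrow> norm (X m - X n) < e / C"
          using CauchyD[OF LIMSEQ_imp_Cauchy[OF X(2)]] by blast
        have "norm (adj_star ip (X m) - adj_star ip (X n)) < e" if "m \<ge> M" "n \<ge> M" for m n
          using M[OF that] star_le[OF diff(1)[OF X(1) X(1)], of m n] C
          by (simp add: diff X pos_less_divide_eq mult.commute)
        then show "\<exists>M. \<forall>m\<ge>M. \<forall>n\<ge>M. norm (adj_star ip (X m) - adj_star ip (X n)) < e" by blast
      qed
      then obtain G where G: "(\<lambda>n. adj_star ip (X n)) \<longlonglongrightarrow> G" by (auto simp: Cauchy_convergent_iff convergent_def)
      show "F \<in> adj_ops ip"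
      proof (rule adj_opsI)
        fix x y
        have "(\<lambda>n. ip (app (X n) x) y) \<longlonglongrightarrow> ip (app F x) y"
          by (intro tendsto_ip tendsto_app X tendsto_const)
        moreover have "(\<lambda>n. ip x (app (adj_star ip (X n)) y)) \<longlonglongrightarrow> ip x (app G y)"
          by (intro tendsto_ip tendsto_app G tendsto_const)
        ultimately show "ip (app F x) y = ip x (app G y)"
          using X by (simp add: ip_app LIMSEQ_unique)
      qed
    qed
  qed (rule C)
qed

sublocale ops: cstar_subalgebra "adj_ops ip" "adj_star ip" 4
  by (rule cstar_subalgebra_adj_ops) (auto simp: norm_ip_le)

end

section \<open>Sums of star products in the coefficient algebra\<close>

lemma norm_cstar [simp]: "norm (cstar x) = norm (x :: 'a::c_star_algebra)"
proof -
  have le: "norm y \<le> norm (cstar y)" for y :: 'a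
  proof (cases "y = 0")
    case False
    have "norm y * norm y \<le> norm (cstar y) * norm y"
      using norm_cstar_mult[of y] norm_mult_ineq[of "cstar y" y] by (simp add: power2_eq_square)
    then show ?thesis using False by simp
  qed simp
  show ?thesis using le[of x] le[of "cstar x"] by (simp add: cstar_cstar)
qed

lemma hilbert_module_self: "hilbert_module (*) (\<lambda>x y. cstar x * (y :: 'a::c_star_algebra))"
proof
  fix x y z a b :: 'a and c
  show "cstar_positive (cstar x * x)" by (auto simp: cstar_positive_def)
  show "cstar x * x = 0 \<Longrightarrow> x = 0" using norm_cstar_mult[of x] by simp
  show "norm x = sqrt (norm (cstar x * x))" by (simp add: norm_cstar_mult)
qed (simp_all add: algebra_simps mult_scaleC_left mult_scaleC_right cstar_mult cstar_cstar)

text \<open>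
  Kaplansky's theorem for the (possibly nonunital) coefficient algebra is applied to its left
  multiplication operators, which form part of a unital algebra with \<open>C = 1\<close>.
\<close>

lemma sum_star_mult_zero:
  fixes b c :: "'a::c_star_algebra"
  assumes "cstar b * b + cstar c * c = 0"
  shows "cstar c * c = 0"
proof -
  let ?ip = "\<lambda>x y :: 'a. cstar x * y"
  interpret hilbert_module "(*)" ?ip by (rule hilbert_module_self)
  interpret C1: cstar_subalgebra "adj_ops ?ip" "adj_star ?ip" 1
  proof (rule cstar_subalgebra_adj_ops)
    show "norm (cstar x * y) \<le> 1 * norm x * norm y" for x y :: 'a
      using norm_mult_ineq[of "cstar x" y] by simp
  qed simp
  define lm :: "'a \<Rightarrow> 'a bop" where "lm x = mk_bop ((*) x)" for x
  have app_lm [simp]: "app (lm x) = (*) x" for x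
    unfolding lm_def by (rule app_mk_bop) (auto simp: bounded_linear_mult_right mult_scaleC_right)
  have adj: "?ip (app (lm x) y) z = ?ip y (app (lm (cstar x)) z)" for x y z
    by (simp add: cstar_mult mult.assoc)
  have lm_mem: "lm x \<in> adj_ops ?ip" for x by (rule adj_opsI[OF adj])
  have lm_star: "adj_star ?ip (lm x) = lm (cstar x)" for x by (rule adj_star_eqI[OF adj])
  have pos: "C1.positive (lm (cstar x * x))" for x
  proof -
    have "lm (cstar x * x) = adj_star ?ip (lm x) * lm x"
      unfolding lm_star by (rule bop_eqI) (simp add: mult.assoc)
    then show ?thesis using C1.positive_star_mult[OF refl lm_mem] by simp
  qed
  have "lm (cstar b * b) = - lm (cstar c * c)"
    by (rule bop_eqI) (use assms in \<open>simp add: eq_neg_iff_add_eq_0 flip: distrib_right\<close>)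
  then have "lm (cstar c * c) = 0" using C1.positive_antisym[OF pos[of c]] pos[of b] by simp
  \<comment> \<open>With no unit to evaluate at, y = \<open>cstar c * c\<close> itself is inserted.
    It is selfadjoint, so the result reads \<open>cstar y * y = 0\<close> and the C*-identity
    applies.\<close>
  then have "app (lm (cstar c * c)) (cstar c * c) = 0" by simp
  then have "cstar (cstar c * c) * (cstar c * c) = 0" by (simp add: cstar_mult cstar_cstar)
  then show ?thesis using norm_cstar_mult[of "cstar c * c"] by simp
qed

section \<open>Positivity of T* T\<close>

context hilbert_module_pair begin

lemma adjoint_compose_mem:
  assumes T: "T \<in> adjointable ipH ipK"
  shows "mk_bop (module_adj ipH ipK T \<circ> T) \<in> adj_ops ipH"
    "app (mk_bop (module_adj ipH ipK T \<circ> T)) = module_adj ipH ipK T \<circ> T"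
    "adj_star ipH (mk_bop (module_adj ipH ipK T \<circ> T)) = mk_bop (module_adj ipH ipK T \<circ> T)"
proof -
  have sym: "ipH ((module_adj ipH ipK T \<circ> T) x) y = ipH x ((module_adj ipH ipK T \<circ> T) y)" for x y
    using T by (simp add: adjoint_eq' adjoint_eq[symmetric])
  then have mem: "module_adj ipH ipK T \<circ> T \<in> adjointable ipH ipH" by (auto simp: adjointable_def)
  show app: "app (mk_bop (module_adj ipH ipK T \<circ> T)) = module_adj ipH ipK T \<circ> T"
    by (rule H.app_mk_bop_adjointable[OF mem])
  show "mk_bop (module_adj ipH ipK T \<circ> T) \<in> adj_ops ipH" by (rule H.mk_bop_mem[OF mem])
  show "adj_star ipH (mk_bop (module_adj ipH ipK T \<circ> T)) = mk_bop (module_adj ipH ipK T \<circ> T)"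
    by (rule H.adj_star_eqI) (simp only: app sym)
qed

text \<open>T joins different modules, so T* T is not a star product inside one algebra, and the
  sign argument is run on vectors: with n the negative part and m^2 = n^3, the inner squares of T n
  x and m x add up to 0.\<close>

lemma positive_adjoint_compose:
  assumes T: "T \<in> adjointable ipH ipK"
  shows "H.ops.positive (mk_bop (module_adj ipH ipK T \<circ> T))"
proof -
  define A where "A = mk_bop (module_adj ipH ipK T \<circ> T)"
  note A = adjoint_compose_mem[OF T, folded A_def]
  define n where "n = H.ops.neg_part A"
  have n: "n \<in> adj_ops ipH" "adj_star ipH n = n" "n * A * n = - (n * n * n)"
    using H.ops.neg_part[OF A(1,3)] H.ops.neg_part_mult[OF A(1,3)] by (auto simp: n_def)
  obtain m where m: "m \<in> adj_ops ipH" "adj_star ipH m = m" "m * m = n * n * n"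
    using H.ops.neg_part_cube_sqrt[OF A(1,3)] unfolding n_def by blast
  have "app m x = 0" for x
  proof -
    have "ipK (T (app n x)) (T (app n x)) = ipH x (app (n * A * n) x)"
      using H.ip_app[OF n(1)] n(2) A(2) by (simp add: adjoint_eq[OF T])
    also have "\<dots> = - ipH (app m x) (app m x)"
      using H.ip_app[OF m(1)] m(2) by (simp add: n(3) H.ip_minus_right flip: m(3))
    finally have sum: "ipK (T (app n x)) (T (app n x)) + ipH (app m x) (app m x) = 0" by simp
    obtain b c where "ipK (T (app n x)) (T (app n x)) = cstar b * b" "ipH (app m x) (app m x) = cstar c * c"
      using H.ip_positive K.ip_positive unfolding cstar_positive_def by metis
    then have "ipH (app m x) (app m x) = 0" using sum_star_mult_zero[of b c] sum by simp
    then show ?thesis by (rule H.ip_definite)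
  qed
  then have "m = 0" by (intro bop_eqI) simp
  then have "n * n * n = 0" using m(3) by simp
  then show ?thesis
    using H.ops.positive_if_neg_part_cube_zero[OF A(1,3)] by (simp add: n_def A_def)
qed

end

subsection \<open>Powers of positive operators\<close>

definition cpowr :: "real \<Rightarrow> complex \<Rightarrow> complex" where
  "cpowr \<beta> z = complex_of_real (Re z powr \<beta>)"

lemma continuous_on_cpowr: "0 < \<beta> \<Longrightarrow> (\<And>z. z \<in> S \<Longrightarrow> 0 \<le> Re z) \<Longrightarrow> continuous_on S (cpowr \<beta>)"
  unfolding cpowr_def by (intro continuous_intros continuous_on_powr') auto

context functional_calculus begin

lemma calc_poly_compose:
  assumes h: "continuous_on (spec a) h"
  shows "\<Phi> (\<lambda>z. poly p (h z)) = peval p (\<Phi> h)"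
proof (induction p)
  case 0
  then show ?case using calc_const[of 0] by simp
next
  case (pCons c p)
  have "continuous_on (spec a) (\<lambda>z. poly p (h z))" by (intro continuous_intros h)
  then show ?case
    using pCons h calc_add[of "\<lambda>z. c" "\<lambda>z. h z * poly p (h z)"] calc_mult[of h "\<lambda>z. poly p (h z)"]
    by (simp add: calc_const peval_pCons continuous_on_mult)
qed

text \<open>S contains both the spectrum of \<Phi>(h) and the values of h, so one polynomial
  sequence approximates g on both.\<close>

lemma calc_compose:
  assumes h: "continuous_on (spec a) h" and sa: "star (\<Phi> h) = \<Phi> h"
    and S: "compact S" "\<And>z. z \<in> S \<Longrightarrow> Im z = 0" "spec (\<Phi> h) \<subseteq> S" "h ` spec a \<subseteq> S"
    and g: "continuous_on S g"
  shows "cfun (\<Phi> h) g = \<Phi> (\<lambda>z. g (h z))"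
proof -
  obtain p where p: "uniform_limit S (\<lambda>n. poly (p n)) g sequentially"
    using weierstrass_sequence[OF S(1,2) g] by blast
  have "(\<lambda>n. peval (p n) (\<Phi> h)) \<longlonglongrightarrow> cfun (\<Phi> h) g"
    using p S(3) by (intro cfun_limit calc_mem h sa uniform_limit_on_subset[OF p])
  moreover have "uniform_limit (spec a) (\<lambda>n z. poly (p n) (h z)) (\<lambda>z. g (h z)) sequentially"
    using S(4) by (intro uniform_limit_compose'[OF p]) auto
  then have "(\<lambda>n. \<Phi> (\<lambda>z. poly (p n) (h z))) \<longlonglongrightarrow> \<Phi> (\<lambda>z. g (h z))"
    by (intro calc_limit) (auto intro!: continuous_intros h)
  ultimately show ?thesis by (simp add: calc_poly_compose h LIMSEQ_unique)
qed

end

lemma (in cstar_subalgebra) positive_spec_subset: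
  assumes "positive a" "norm a \<le> M"
  shows "spec a \<subseteq> complex_of_real ` {0..M}"
proof
  fix z assume z: "z \<in> spec a"
  have "z = complex_of_real (Re z)"
    using selfadj_spec_real[OF _ _ z] assms by (simp add: positive_def complex_eq_iff)
  moreover have "Re z \<le> M"
    using spec_norm_bound[OF _ z] complex_Re_le_cmod[of z] assms by (force simp: positive_def)
  ultimately show "z \<in> complex_of_real ` {0..M}" using z assms(1)
    by (metis atLeastAtMost_iff image_eqI positive_def)
qed

lemma compact_of_real_Icc: "compact (complex_of_real ` {a..b})"
  by (intro compact_continuous_image continuous_intros) auto

text \<open>|T| is itself a power of T* T, so its powers are powers of a power.\<close>

lemma (in cstar_subalgebra) cfun_cpowr_cpowr:
  assumes a: "positive a" and "0 < \<beta>" "0 < \<gamma>"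
  shows "positive (cfun a (cpowr \<beta>))"
    and "cfun (cfun a (cpowr \<beta>)) (cpowr \<gamma>) = cfun a (cpowr (\<beta> * \<gamma>))"
proof -
  have sa: "a \<in> L" "star a = a" and nn: "\<And>z. z \<in> spec a \<Longrightarrow> 0 \<le> Re z" using a by (auto simp: positive_def)
  interpret A: functional_calculus L star C a "cfun a" by (rule cfun_calculus[OF sa])
  have cont: "continuous_on (spec a) (cpowr \<beta>)" using \<open>0 < \<beta>\<close> nn by (rule continuous_on_cpowr)
  show pos: "positive (cfun a (cpowr \<beta>))"
    by (rule positive_cfun[OF sa cont]) (simp add: cpowr_def)
  \<comment> \<open>The first entry bounds the spectrum of the power of a, the second the values of
    \<open>cpowr \<beta>\<close> on the spectrum of a.\<close>
  define M where "M = max (norm (cfun a (cpowr \<beta>))) (norm a powr \<beta>)"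
  let ?S = "complex_of_real ` {0..M}"
  have "cpowr \<beta> z \<in> ?S" if z: "z \<in> spec a" for z
  proof -
    have "Re z \<le> norm a" using spec_norm_bound[OF sa(1) z] complex_Re_le_cmod[of z] by linarith
    then have "Re z powr \<beta> \<le> norm a powr \<beta>" using nn[OF z] \<open>0 < \<beta>\<close> by (intro powr_mono2) auto
    then show ?thesis by (auto simp: cpowr_def M_def)
  qed
  then have "cfun (cfun a (cpowr \<beta>)) (cpowr \<gamma>) = cfun a (\<lambda>z. cpowr \<gamma> (cpowr \<beta> z))"
    using pos \<open>0 < \<gamma>\<close>
    by (intro A.calc_compose[OF cont _ compact_of_real_Icc[of 0 M]] positive_spec_subset continuous_on_cpowr)
      (auto simp: positive_def M_def)
  also have "(\<lambda>z. cpowr \<gamma> (cpowr \<beta> z)) = cpowr (\<beta> * \<gamma>)"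
    by (auto simp: cpowr_def powr_powr)
  finally show "cfun (cfun a (cpowr \<beta>)) (cpowr \<gamma>) = cfun a (cpowr (\<beta> * \<gamma>))" .
qed

section \<open>Agreement with the spectrum and calculus of the definitions\<close>

context hilbert_module begin

lemma op_spectrum_app:
  assumes "A \<in> adj_ops ip"
  shows "op_spectrum ip (app A) = ops.spec A"
proof -
  have op: "(\<lambda>x. app A x - z *\<^sub>C x) = app (A - z *\<^sub>C 1)" for z by auto
  have "(\<exists>R\<in>adjointable ip ip. R \<circ> app B = id \<and> app B \<circ> R = id) \<longleftrightarrow> ops.invertible_in B" for B
  proof
    assume "\<exists>R\<in>adjointable ip ip. R \<circ> app B = id \<and> app B \<circ> R = id"
    then obtain R where R: "R \<in> adjointable ip ip" "R \<circ> app B = id" "app B \<circ> R = id" by blast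
    have "mk_bop R * B = 1" "B * mk_bop R = 1"
      by (rule bop_eqI; use R in \<open>simp add: app_mk_bop_adjointable fun_eq_iff\<close>)+
    then show "ops.invertible_in B"
      using mk_bop_mem[OF R(1)] by (auto simp: ops.invertible_in_def ops.inverse_of_def)
  next
    assume "ops.invertible_in B"
    then obtain R where R: "R \<in> adj_ops ip" "B * R = 1" "R * B = 1"
      by (auto simp: ops.invertible_in_def ops.inverse_of_def)
    have "app R \<circ> app B = id" "app B \<circ> app R = id"
      using app_simps(6)[of R B] app_simps(6)[of B R] R by (auto simp: fun_eq_iff)
    then show "\<exists>R\<in>adjointable ip ip. R \<circ> app B = id \<and> app B \<circ> R = id"
      using R by (auto simp: adj_ops_def)
  qed
  then show ?thesis unfolding op_spectrum_def ops.spec_def op by simp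
qed

lemma is_cfc_cfun:
  assumes A: "A \<in> adj_ops ip" "adj_star ip A = A"
  shows "is_cfc ip (app A) (\<lambda>f. app (ops.cfun A f))"
proof -
  interpret A: functional_calculus "adj_ops ip" "adj_star ip" 4 A "ops.cfun A" by (rule ops.cfun_calculus[OF A])
  show ?thesis
    unfolding is_cfc_def op_spectrum_app[OF A(1)] Let_def
  proof (intro conjI ballI impI allI; (unfold mem_Collect_eq)?)
    fix f g :: "complex \<Rightarrow> complex" and c
    assume f: "continuous_on (ops.spec A) f"
    show "app (ops.cfun A f) \<in> adjointable ip ip" using A.calc_mem[OF f] by (simp add: adj_ops_def)
    show "app (ops.cfun A (\<lambda>z. c * f z)) = (\<lambda>x. c *\<^sub>C app (ops.cfun A f) x)"
      using A.calc_scale[OF f] by auto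
    show "app (ops.cfun A (\<lambda>z. cnj (f z))) = module_adj ip ip (app (ops.cfun A f))"
      using A.calc_cnj[OF f] A.calc_mem[OF f] by (simp add: app_adj_star)
    assume g: "continuous_on (ops.spec A) g"
    show "app (ops.cfun A f) = app (ops.cfun A g)" if "\<forall>z\<in>ops.spec A. f z = g z"
      using A.calc_cong[OF f g] that by simp
    show "app (ops.cfun A (\<lambda>z. f z + g z)) = (\<lambda>x. app (ops.cfun A f) x + app (ops.cfun A g) x)"
      using A.calc_add[OF f g] by auto
    show "app (ops.cfun A (\<lambda>z. f z * g z)) = app (ops.cfun A f) \<circ> app (ops.cfun A g)"
      using A.calc_mult[OF f g] by auto
  qed (auto simp: A.calc_one A.calc_id)
qed

text \<open>Turns an arbitrary competitor into a calculus in the algebra, where the uniqueness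
  theorem applies. \<open>mk_bop\<close> is faithful here because only values at continuous
  functions are compared.\<close>

lemma functional_calculus_if_is_cfc:
  assumes A: "A \<in> adj_ops ip" "adj_star ip A = A" and \<Phi>: "is_cfc ip (app A) \<Phi>"
  shows "functional_calculus (adj_ops ip) (adj_star ip) 4 A (\<lambda>f. mk_bop (\<Phi> f))"
proof -
  note \<Phi>' = \<Phi>[unfolded is_cfc_def op_spectrum_app[OF A(1)] Let_def]
  have mem: "\<Phi> f \<in> adjointable ip ip" if "continuous_on (ops.spec A) f" for f
    using \<Phi>' that by blast
  then have app: "app (mk_bop (\<Phi> f)) = \<Phi> f" if "continuous_on (ops.spec A) f" for f
    using that by (simp add: app_mk_bop_adjointable)
  have eqI: "mk_bop F = G" if "F = app G" for F G using that by simp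
  show ?thesis
  proof
    fix f g :: "complex \<Rightarrow> complex" and c
    assume f: "continuous_on (ops.spec A) f"
    show "mk_bop (\<Phi> f) \<in> adj_ops ip" by (rule mk_bop_mem[OF mem[OF f]])
    have "\<Phi> (\<lambda>z. c * f z) = (\<lambda>x. c *\<^sub>C \<Phi> f x)" using \<Phi>' f by blast
    then show "mk_bop (\<Phi> (\<lambda>z. c * f z)) = c *\<^sub>C mk_bop (\<Phi> f)" using f by (intro eqI) (auto simp: app)
    have "\<Phi> (\<lambda>z. cnj (f z)) = module_adj ip ip (\<Phi> f)" using \<Phi>' f by blast
    then show "mk_bop (\<Phi> (\<lambda>z. cnj (f z))) = adj_star ip (mk_bop (\<Phi> f))"
      using f by (simp add: adj_star_def app)
    assume g: "continuous_on (ops.spec A) g"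
    show "mk_bop (\<Phi> f) = mk_bop (\<Phi> g)" if "\<And>z. z \<in> ops.spec A \<Longrightarrow> f z = g z"
    proof -
      have "\<Phi> f = \<Phi> g" using \<Phi>' f g that by blast
      then show ?thesis by simp
    qed
    have "\<Phi> (\<lambda>z. f z + g z) = (\<lambda>x. \<Phi> f x + \<Phi> g x)" using \<Phi>' f g by blast
    then show "mk_bop (\<Phi> (\<lambda>z. f z + g z)) = mk_bop (\<Phi> f) + mk_bop (\<Phi> g)"
      using f g by (intro eqI) (auto simp: app)
    have "\<Phi> (\<lambda>z. f z * g z) = \<Phi> f \<circ> \<Phi> g" using \<Phi>' f g by blast
    then show "mk_bop (\<Phi> (\<lambda>z. f z * g z)) = mk_bop (\<Phi> f) * mk_bop (\<Phi> g)"
      using f g by (intro eqI) (auto simp: app)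
  next
    have "\<Phi> (\<lambda>z. 1) = id" using \<Phi>' by blast
    then show "mk_bop (\<Phi> (\<lambda>z. 1)) = 1" by (intro eqI) auto
    have "\<Phi> (\<lambda>z. z) = app A" using \<Phi>' by blast
    then show "mk_bop (\<Phi> (\<lambda>z. z)) = A" by simp
  qed (rule A)+
qed

lemma cfc_app:
  assumes A: "A \<in> adj_ops ip" "adj_star ip A = A" and f: "continuous_on (ops.spec A) f"
  shows "cfc ip f (app A) = app (ops.cfun A f)"
  unfolding cfc_def
proof (rule the_equality)
  show "\<exists>\<Phi>. is_cfc ip (app A) \<Phi> \<and> app (ops.cfun A f) = \<Phi> f" using is_cfc_cfun[OF A] by blast
  fix B assume "\<exists>\<Phi>. is_cfc ip (app A) \<Phi> \<and> B = \<Phi> f"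
  then obtain \<Phi> where \<Phi>: "is_cfc ip (app A) \<Phi>" "B = \<Phi> f" by blast
  have "\<Phi> f \<in> adjointable ip ip"
    using \<Phi>(1) f unfolding is_cfc_def op_spectrum_app[OF A(1)] Let_def by blast
  then have "app (mk_bop (\<Phi> f)) = \<Phi> f" by (rule app_mk_bop_adjointable)
  moreover have "mk_bop (\<Phi> f) = ops.cfun A f"
    using ops.functional_calculus_unique[OF functional_calculus_if_is_cfc[OF A \<Phi>(1)] ops.cfun_calculus[OF A] f] .
  ultimately show "B = app (ops.cfun A f)" using \<Phi> by simp
qed

lemma op_powr_app:
  assumes "ops.positive A" "0 < \<beta>"
  shows "op_powr ip (app A) \<beta> = app (ops.cfun A (cpowr \<beta>))"
  unfolding op_powr_def cpowr_def[symmetric]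
  by (rule cfc_app) (use assms in \<open>auto simp: ops.positive_def intro!: continuous_on_cpowr\<close>)

end

text \<open>
  The exponent is \<open>- \<alpha> / 2\<close> because the argument is the spectral variable of \<open>T\<^sup>* T = |T|\<^sup>2\<close>.
\<close>

definition cutoff :: "real \<Rightarrow> nat \<Rightarrow> real \<Rightarrow> real" where
  "cutoff \<alpha> n t = max t (1 / real (Suc n)) powr (- \<alpha> / 2)"

text \<open>Controls the convergence of T f_n(A). Above the threshold h = 1 / (n + 1) the difference
  is 0; below it both terms lie between 0 and h^((1-\<alpha>)/2), which tends to 0 since \<alpha> <
  1.\<close>

lemma cutoff_sqrt_approx:
  assumes "0 < \<alpha>" "\<alpha> < 1" "0 \<le> t"
  shows "\<bar>sqrt t * cutoff \<alpha> n t - t powr ((1 - \<alpha>) / 2)\<bar> \<le> (1 / real (Suc n)) powr ((1 - \<alpha>) / 2)"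
proof -
  define h where "h = 1 / real (Suc n)"
  have h: "h > 0" by (simp add: h_def)
  have sq: "sqrt s * s powr (- \<alpha> / 2) = s powr ((1 - \<alpha>) / 2)" if "s > 0" for s
    using that by (simp add: powr_half_sqrt[symmetric] diff_divide_distrib flip: powr_add)
  show ?thesis
  proof (cases "h \<le> t")
    case True
    then have "max t h = t" by simp
    then show ?thesis using sq[of t] h True unfolding cutoff_def h_def[symmetric] by simp
  next
    case False
    have "sqrt t * h powr (- \<alpha> / 2) \<le> sqrt h * h powr (- \<alpha> / 2)"
      using False assms by (intro mult_right_mono) auto
    then have "sqrt t * h powr (- \<alpha> / 2) \<le> h powr ((1 - \<alpha>) / 2)" using sq[OF h] by simp
    moreover have "t powr ((1 - \<alpha>) / 2) \<le> h powr ((1 - \<alpha>) / 2)"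
      using False assms by (intro powr_mono2) auto
    moreover have "0 \<le> sqrt t * h powr (- \<alpha> / 2)" "0 \<le> t powr ((1 - \<alpha>) / 2)" using assms by auto
    ultimately have "\<bar>sqrt t * h powr (- \<alpha> / 2) - t powr ((1 - \<alpha>) / 2)\<bar> \<le> h powr ((1 - \<alpha>) / 2)" by linarith
    moreover have "max t h = h" using False by simp
    ultimately show ?thesis unfolding cutoff_def h_def[symmetric] by simp
  qed
qed

text \<open>The symbol of f_n(A) T* T f_n(A), whose limit will be U* U.\<close>

lemma cutoff_square_approx:
  assumes "0 < \<alpha>" "\<alpha> < 1" "0 \<le> t"
  shows "\<bar>cutoff \<alpha> n t * t * cutoff \<alpha> n t - t powr (1 - \<alpha>)\<bar> \<le> (1 / real (Suc n)) powr (1 - \<alpha>)"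
proof -
  define h where "h = 1 / real (Suc n)"
  have h: "h > 0" by (simp add: h_def)
  have sq: "s powr (- \<alpha> / 2) * s * s powr (- \<alpha> / 2) = s powr (1 - \<alpha>)" if "s > 0" for s
  proof -
    have "s powr (- \<alpha> / 2) * s powr 1 * s powr (- \<alpha> / 2) = s powr (1 - \<alpha>)"
      unfolding powr_add[symmetric] by simp
    then show ?thesis using that by simp
  qed
  show ?thesis
  proof (cases "h \<le> t")
    case True
    then have "max t h = t" by simp
    then show ?thesis using sq[of t] h True unfolding cutoff_def h_def[symmetric] by simp
  next
    case False
    have "h powr (- \<alpha> / 2) * t * h powr (- \<alpha> / 2) \<le> h powr (- \<alpha> / 2) * h * h powr (- \<alpha> / 2)"
      using False assms by (intro mult_right_mono mult_left_mono) auto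
    then have "h powr (- \<alpha> / 2) * t * h powr (- \<alpha> / 2) \<le> h powr (1 - \<alpha>)" using sq[OF h] by simp
    moreover have "t powr (1 - \<alpha>) \<le> h powr (1 - \<alpha>)"
      using False assms by (intro powr_mono2) auto
    moreover have "0 \<le> h powr (- \<alpha> / 2) * t * h powr (- \<alpha> / 2)" "0 \<le> t powr (1 - \<alpha>)" using assms by auto
    ultimately have "\<bar>h powr (- \<alpha> / 2) * t * h powr (- \<alpha> / 2) - t powr (1 - \<alpha>)\<bar> \<le> h powr (1 - \<alpha>)" by linarith
    moreover have "max t h = h" using False by simp
    ultimately show ?thesis unfolding cutoff_def h_def[symmetric] by simp
  qed
qed

text \<open>The difference 1 - f_n(t) t^(\<alpha>/2) does not become small near 0, but it lies in
  [0,1] and vanishes for t above the threshold; the factor t, coming from T, supplies the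
  smallness.\<close>

lemma cutoff_defect:
  assumes "0 < \<alpha>" "0 \<le> t"
  shows "t * (1 - cutoff \<alpha> n t * t powr (\<alpha> / 2))\<^sup>2 \<le> 1 / real (Suc n)"
proof -
  define h where "h = 1 / real (Suc n)"
  have h: "h > 0" by (simp add: h_def)
  have inv: "s powr (- \<alpha> / 2) * s powr (\<alpha> / 2) = 1" if "s > 0" for s
    using that by (simp flip: powr_add)
  show ?thesis
  proof (cases "h \<le> t")
    case True
    then have "max t h = t" by simp
    then show ?thesis using inv[of t] h True unfolding cutoff_def h_def[symmetric] by simp
  next
    case False
    have "h powr (- \<alpha> / 2) * t powr (\<alpha> / 2) \<le> h powr (- \<alpha> / 2) * h powr (\<alpha> / 2)"
      using False assms by (intro mult_left_mono powr_mono2) auto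
    then have "h powr (- \<alpha> / 2) * t powr (\<alpha> / 2) \<le> 1" using inv[OF h] by simp
    moreover have "0 \<le> h powr (- \<alpha> / 2) * t powr (\<alpha> / 2)" by simp
    ultimately have "(1 - h powr (- \<alpha> / 2) * t powr (\<alpha> / 2))\<^sup>2 \<le> 1" by (intro power_le_one) auto
    then have "t * (1 - h powr (- \<alpha> / 2) * t powr (\<alpha> / 2))\<^sup>2 \<le> h * 1"
      using False assms by (intro mult_mono) auto
    moreover have "max t h = h" using False by simp
    ultimately show ?thesis unfolding cutoff_def h_def[symmetric] by simp
  qed
qed

lemma powr_inverse_Suc_tendsto_0: "0 < s \<Longrightarrow> (\<lambda>n. (1 / real (Suc n)) powr s) \<longlonglongrightarrow> 0"
  using tendsto_powr'[of "\<lambda>n. 1 / real (Suc n)" 0 sequentially "\<lambda>_. s" s] LIMSEQ_inverse_real_of_nat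
  by (auto simp: inverse_eq_divide)

definition ccutoff :: "real \<Rightarrow> nat \<Rightarrow> complex \<Rightarrow> complex" where
  "ccutoff \<alpha> n z = complex_of_real (cutoff \<alpha> n (Re z))"

lemma continuous_on_ccutoff [continuous_intros]: "continuous_on S (ccutoff \<alpha> n)"
  unfolding ccutoff_def cutoff_def by (intro continuous_intros) (auto simp: max_def)

subsection \<open>The polar factor\<close>

definition gram :: "('h::{complex_normed_vector, banach} \<Rightarrow> 'h \<Rightarrow> 'a) \<Rightarrow> ('k \<Rightarrow> 'k \<Rightarrow> 'a) \<Rightarrow> ('h \<Rightarrow> 'k) \<Rightarrow> 'h bop" where
  "gram ipH ipK T = mk_bop (module_adj ipH ipK T \<circ> T)"

context hilbert_module_pair begin

lemma app_gram: "T \<in> adjointable ipH ipK \<Longrightarrow> app (gram ipH ipK T) x = module_adj ipH ipK T (T x)"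
  using adjoint_compose_mem(2)[of T] by (simp add: gram_def)

lemma positive_gram: "T \<in> adjointable ipH ipK \<Longrightarrow> H.ops.positive (gram ipH ipK T)"
  unfolding gram_def by (rule positive_adjoint_compose)

lemma gram_mem: "T \<in> adjointable ipH ipK \<Longrightarrow> gram ipH ipK T \<in> adj_ops ipH"
  and gram_star: "T \<in> adjointable ipH ipK \<Longrightarrow> adj_star ipH (gram ipH ipK T) = gram ipH ipK T"
  using positive_gram by (auto simp: H.ops.positive_def)

lemma gram_spec_nonneg: "T \<in> adjointable ipH ipK \<Longrightarrow> z \<in> H.ops.spec (gram ipH ipK T) \<Longrightarrow> 0 \<le> Re z"
  using positive_gram by (auto simp: H.ops.positive_def)

lemma gram_spec_real: "T \<in> adjointable ipH ipK \<Longrightarrow> z \<in> H.ops.spec (gram ipH ipK T) \<Longrightarrow> z = complex_of_real (Re z)"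
  using H.ops.selfadj_spec_real[OF gram_mem gram_star] by (simp add: complex_eq_iff)

lemma gram_calculus:
  assumes "T \<in> adjointable ipH ipK"
  shows "functional_calculus (adj_ops ipH) (adj_star ipH) 4 (gram ipH ipK T) (H.ops.cfun (gram ipH ipK T))"
  by (rule H.ops.cfun_calculus[OF gram_mem[OF assms] gram_star[OF assms]])

text \<open>With D = d(A), the inner square of T D x is <x, D* A D x>. One factor 4 comes from the
  calculus and one from Cauchy-Schwarz, so the square root leaves 4.\<close>

lemma norm_adjointable_cfun_le:
  assumes T: "T \<in> adjointable ipH ipK" and d: "continuous_on (H.ops.spec (gram ipH ipK T)) d" and "0 \<le> \<delta>"
    and le: "\<And>z. z \<in> H.ops.spec (gram ipH ipK T) \<Longrightarrow> cmod z * (cmod (d z))\<^sup>2 \<le> \<delta>\<^sup>2"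
  shows "norm (T (app (H.ops.cfun (gram ipH ipK T) d) x)) \<le> 4 * \<delta> * norm x"
proof -
  let ?A = "gram ipH ipK T" and ?D = "H.ops.cfun (gram ipH ipK T) d"
  interpret A: functional_calculus "adj_ops ipH" "adj_star ipH" 4 ?A "H.ops.cfun ?A" by (rule gram_calculus[OF T])
  have D: "?D \<in> adj_ops ipH" by (rule A.calc_mem[OF d])
  have "adj_star ipH ?D * ?A * ?D = H.ops.cfun ?A (\<lambda>z. cnj (d z) * z * d z)"
    using d A.calc_mult[of "\<lambda>z. cnj (d z) * z" d] A.calc_mult[of "\<lambda>z. cnj (d z)" "\<lambda>z. z"]
    by (simp add: A.calc_cnj A.calc_id continuous_intros)
  moreover have "norm (H.ops.cfun ?A (\<lambda>z. cnj (d z) * z * d z)) \<le> 4 * \<delta>\<^sup>2"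
    using le by (intro A.norm_calc_le continuous_intros d)
      (auto simp: norm_mult power2_eq_square mult.assoc mult.left_commute)
  ultimately have nb: "norm (adj_star ipH ?D * ?A * ?D) \<le> 4 * \<delta>\<^sup>2" by simp
  have "(norm (T (app ?D x)))\<^sup>2 = norm (ipH (app ?D x) (app ?A (app ?D x)))"
    using T by (simp add: app_gram adjoint_eq[symmetric] K.norm_ip_self)
  also have "\<dots> = norm (ipH x (app (adj_star ipH ?D * ?A * ?D) x))" using D by (simp add: H.ip_app)
  also have "\<dots> \<le> 4 * norm x * norm (app (adj_star ipH ?D * ?A * ?D) x)" by (rule H.norm_ip_le)
  also have "\<dots> \<le> 4 * norm x * (4 * \<delta>\<^sup>2 * norm x)"
    by (intro mult_left_mono order_trans[OF norm_app_le] mult_right_mono nb) auto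
  also have "\<dots> = (4 * \<delta> * norm x)\<^sup>2" by (simp add: power2_eq_square)
  finally show ?thesis by (rule power2_le_imp_le) (use \<open>0 \<le> \<delta>\<close> in simp)
qed

text \<open>Taken pointwise on plain functions: maps between different modules are not elements of
  the operator algebras built above.\<close>

definition phase :: "real \<Rightarrow> ('h \<Rightarrow> 'k) \<Rightarrow> 'h \<Rightarrow> 'k" where
  "phase \<alpha> T x = lim (\<lambda>n. T (app (H.ops.cfun (gram ipH ipK T) (ccutoff \<alpha> n)) x))"

lemma phase_tendsto:
  assumes T: "T \<in> adjointable ipH ipK" and \<alpha>: "0 < \<alpha>" "\<alpha> < 1"
  shows "(\<lambda>n. T (app (H.ops.cfun (gram ipH ipK T) (ccutoff \<alpha> n)) x)) \<longlonglongrightarrow> phase \<alpha> T x"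
proof -
  let ?A = "gram ipH ipK T"
  interpret A: functional_calculus "adj_ops ipH" "adj_star ipH" 4 ?A "H.ops.cfun ?A" by (rule gram_calculus[OF T])
  interpret Tl: bounded_linear T by (rule adjointable_bounded_linear[OF T])
  let ?F = "\<lambda>n. H.ops.cfun ?A (ccutoff \<alpha> n)"
  let ?e = "\<lambda>n. (1 / real (Suc n)) powr ((1 - \<alpha>) / 2)"
  have diff: "norm (T (app (?F m) x) - T (app (?F n) x)) \<le> 4 * (?e m + ?e n) * norm x" for m n
  proof -
    let ?d = "\<lambda>z. ccutoff \<alpha> m z - ccutoff \<alpha> n z"
    have "T (app (?F m) x) - T (app (?F n) x) = T (app (H.ops.cfun ?A ?d) x)"
      by (simp add: A.calc_diff continuous_intros Tl.diff)
    moreover have "norm (T (app (H.ops.cfun ?A ?d) x)) \<le> 4 * (?e m + ?e n) * norm x"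
    proof (rule norm_adjointable_cfun_le[OF T])
      fix z assume z: "z \<in> H.ops.spec ?A"
      define t where "t = Re z"
      have t: "0 \<le> t" "z = complex_of_real t"
        using gram_spec_nonneg[OF T z] gram_spec_real[OF T z] by (auto simp: t_def)
      have "\<bar>sqrt t * cutoff \<alpha> m t - sqrt t * cutoff \<alpha> n t\<bar> \<le> ?e m + ?e n"
        using cutoff_sqrt_approx[OF \<alpha> t(1), of m] cutoff_sqrt_approx[OF \<alpha> t(1), of n] by linarith
      then have "(sqrt t * cutoff \<alpha> m t - sqrt t * cutoff \<alpha> n t)\<^sup>2 \<le> (?e m + ?e n)\<^sup>2"
        using power_mono[OF _ abs_ge_zero, of _ _ 2] by fastforce
      moreover have "(sqrt t * cutoff \<alpha> m t - sqrt t * cutoff \<alpha> n t)\<^sup>2 = t * (cutoff \<alpha> m t - cutoff \<alpha> n t)\<^sup>2"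
        using t by (simp add: power_mult_distrib flip: right_diff_distrib)
      moreover have "cmod (?d z) = \<bar>cutoff \<alpha> m t - cutoff \<alpha> n t\<bar>"
        by (simp add: t(2) ccutoff_def flip: of_real_diff)
      ultimately show "cmod z * (cmod (?d z))\<^sup>2 \<le> (?e m + ?e n)\<^sup>2" using t by simp
    qed (intro continuous_intros, simp)
    ultimately show ?thesis by simp
  qed
  have "Cauchy (\<lambda>n. T (app (?F n) x))"
  proof (rule CauchyI)
    fix e :: real assume "e > 0"
    \<comment> \<open>8 = 4 * 2 for the two error terms; the summand 1 allows x = 0 and makes the
      final inequality strict.\<close>
    define e' where "e' = e / (8 * (norm x + 1))"
    have "norm x + 1 > 0" by (simp add: add_nonneg_pos)
    then have e': "e' > 0" "8 * e' * (norm x + 1) = e"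
      using \<open>e > 0\<close> by (simp_all add: e'_def field_simps)
    have "?e \<longlonglongrightarrow> 0" by (rule powr_inverse_Suc_tendsto_0) (use \<alpha> in simp)
    then have "\<forall>\<^sub>F n in sequentially. ?e n < e'" using e'(1) by (rule order_tendstoD(2))
    then obtain N where N: "\<And>n. n \<ge> N \<Longrightarrow> ?e n < e'" by (auto simp: eventually_sequentially)
    have "norm (T (app (?F m) x) - T (app (?F n) x)) < e" if "m \<ge> N" "n \<ge> N" for m n
    proof -
      have "4 * (?e m + ?e n) * norm x \<le> 4 * (e' + e') * norm x"
        using N[OF that(1)] N[OF that(2)] by (intro mult_right_mono mult_left_mono add_mono) auto
      also have "\<dots> < 8 * e' * (norm x + 1)" using e' by (simp add: algebra_simps)
      finally show ?thesis using diff[of m n] e'(2) by linarith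
    qed
    then show "\<exists>M. \<forall>m\<ge>M. \<forall>n\<ge>M. norm (T (app (?F m) x) - T (app (?F n) x)) < e" by blast
  qed
  then show ?thesis
    unfolding phase_def by (simp add: Cauchy_convergent_iff convergent_LIMSEQ_iff)
qed

text \<open>The power \<alpha>/2 of T* T is |T|^\<alpha>; the error at stage n is T applied to the
  defect function of \<open>cutoff_defect\<close>.\<close>

lemma phase_cpowr:
  assumes T: "T \<in> adjointable ipH ipK" and \<alpha>: "0 < \<alpha>" "\<alpha> < 1"
  shows "phase \<alpha> T (app (H.ops.cfun (gram ipH ipK T) (cpowr (\<alpha> / 2))) x) = T x"
proof -
  let ?A = "gram ipH ipK T" and ?p = "cpowr (\<alpha> / 2)"
  interpret A: functional_calculus "adj_ops ipH" "adj_star ipH" 4 ?A "H.ops.cfun ?A" by (rule gram_calculus[OF T])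
  interpret Tl: bounded_linear T by (rule adjointable_bounded_linear[OF T])
  let ?F = "\<lambda>n. H.ops.cfun ?A (ccutoff \<alpha> n)"
  have p: "continuous_on (H.ops.spec ?A) ?p"
    using \<alpha> gram_spec_nonneg[OF T] by (intro continuous_on_cpowr) auto
  have le: "norm (T x - T (app (?F n) (app (H.ops.cfun ?A ?p) x))) \<le> 4 * sqrt (1 / real (Suc n)) * norm x" for n
  proof -
    let ?d = "\<lambda>z. 1 - ccutoff \<alpha> n z * ?p z"
    have "H.ops.cfun ?A ?d = 1 - ?F n * H.ops.cfun ?A ?p"
      using p by (simp add: A.calc_diff[of "\<lambda>z. 1"] A.calc_mult A.calc_one continuous_intros)
    then have "T (app (H.ops.cfun ?A ?d) x) = T x - T (app (?F n) (app (H.ops.cfun ?A ?p) x))"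
      by (simp add: Tl.diff)
    moreover have "norm (T (app (H.ops.cfun ?A ?d) x)) \<le> 4 * sqrt (1 / real (Suc n)) * norm x"
    proof (rule norm_adjointable_cfun_le[OF T])
      fix z assume z: "z \<in> H.ops.spec ?A"
      define t where "t = Re z"
      have t: "0 \<le> t" "z = complex_of_real t"
        using gram_spec_nonneg[OF T z] gram_spec_real[OF T z] by (auto simp: t_def)
      have "?d z = complex_of_real (1 - cutoff \<alpha> n t * t powr (\<alpha> / 2))"
        by (simp add: t(2) ccutoff_def cpowr_def)
      then have "cmod (?d z) = \<bar>1 - cutoff \<alpha> n t * t powr (\<alpha> / 2)\<bar>" by (simp only: norm_of_real)
      then show "cmod z * (cmod (?d z))\<^sup>2 \<le> (sqrt (1 / real (Suc n)))\<^sup>2"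
        using cutoff_defect[OF \<alpha>(1) t(1), of n] t by simp
    qed (auto intro!: continuous_intros p)
    ultimately show ?thesis by simp
  qed
  have "(\<lambda>n. 4 * sqrt (1 / real (Suc n)) * norm x) \<longlonglongrightarrow> 4 * sqrt 0 * norm x"
    using LIMSEQ_inverse_real_of_nat by (intro tendsto_intros) (simp add: inverse_eq_divide)
  then have lim0: "(\<lambda>n. 4 * sqrt (1 / real (Suc n)) * norm x) \<longlonglongrightarrow> 0" by simp
  have "(\<lambda>n. T x - T (app (?F n) (app (H.ops.cfun ?A ?p) x))) \<longlonglongrightarrow> 0"
    by (rule Lim_null_comparison[OF _ lim0]) (use le in \<open>intro always_eventually allI\<close>)
  then have "(\<lambda>n. T (app (?F n) (app (H.ops.cfun ?A ?p) x))) \<longlonglongrightarrow> T x"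
    using tendsto_diff[OF tendsto_const[of "T x"]] by fastforce
  with phase_tendsto[OF T \<alpha>] show ?thesis by (rule LIMSEQ_unique)
qed

text \<open>States U* U = |T|^(2(1-\<alpha>)) as an identity of forms, before an adjoint of U is at
  hand.\<close>

lemma ip_phase_phase:
  assumes T: "T \<in> adjointable ipH ipK" and \<alpha>: "0 < \<alpha>" "\<alpha> < 1"
  shows "ipK (phase \<alpha> T x) (phase \<alpha> T y) = ipH x (app (H.ops.cfun (gram ipH ipK T) (cpowr (1 - \<alpha>))) y)"
proof -
  let ?A = "gram ipH ipK T"
  interpret A: functional_calculus "adj_ops ipH" "adj_star ipH" 4 ?A "H.ops.cfun ?A" by (rule gram_calculus[OF T])
  let ?F = "\<lambda>n. H.ops.cfun ?A (ccutoff \<alpha> n)"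
  let ?g = "\<lambda>n z. ccutoff \<alpha> n z * z * ccutoff \<alpha> n z"
  have F: "?F n \<in> adj_ops ipH" "adj_star ipH (?F n) = ?F n" for n
  proof -
    show "?F n \<in> adj_ops ipH" by (intro A.calc_mem continuous_intros)
    have "(\<lambda>z. cnj (ccutoff \<alpha> n z)) = ccutoff \<alpha> n" by (auto simp: ccutoff_def)
    then show "adj_star ipH (?F n) = ?F n" using A.calc_cnj[of "ccutoff \<alpha> n"] by (simp add: continuous_intros)
  qed
  have "ipK (T (app (?F n) x)) (T (app (?F n) y)) = ipH x (app (H.ops.cfun ?A (?g n)) y)" for n
  proof -
    have "H.ops.cfun ?A (?g n) = ?F n * ?A * ?F n"
      using A.calc_mult[of "\<lambda>z. ccutoff \<alpha> n z * z" "ccutoff \<alpha> n"] A.calc_mult[of "ccutoff \<alpha> n" "\<lambda>z. z"]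
      by (simp add: A.calc_id continuous_intros)
    moreover have "ipK (T (app (?F n) x)) (T (app (?F n) y)) = ipH (app (?F n) x) (app ?A (app (?F n) y))"
      using T by (simp add: app_gram adjoint_eq[symmetric])
    ultimately show ?thesis using H.ip_app[OF F(1)] F(2) by simp
  qed
  moreover have "(\<lambda>n. ipK (T (app (?F n) x)) (T (app (?F n) y))) \<longlonglongrightarrow> ipK (phase \<alpha> T x) (phase \<alpha> T y)"
    by (intro K.tendsto_ip phase_tendsto T \<alpha>)
  moreover have "(\<lambda>n. ipH x (app (H.ops.cfun ?A (?g n)) y)) \<longlonglongrightarrow> ipH x (app (H.ops.cfun ?A (cpowr (1 - \<alpha>))) y)"
  proof (intro H.tendsto_ip tendsto_app tendsto_const A.calc_limit)
    show "continuous_on (H.ops.spec ?A) (?g n)" for n by (intro continuous_intros)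
    show "uniform_limit (H.ops.spec ?A) ?g (cpowr (1 - \<alpha>)) sequentially"
    proof (rule uniform_limitI)
      fix e :: real assume "e > 0"
      have "(\<lambda>n. (1 / real (Suc n)) powr (1 - \<alpha>)) \<longlonglongrightarrow> 0" by (rule powr_inverse_Suc_tendsto_0) (use \<alpha> in simp)
      then have "\<forall>\<^sub>F n in sequentially. (1 / real (Suc n)) powr (1 - \<alpha>) < e" using \<open>e > 0\<close> by (rule order_tendstoD(2))
      then show "\<forall>\<^sub>F n in sequentially. \<forall>z\<in>H.ops.spec ?A. dist (?g n z) (cpowr (1 - \<alpha>) z) < e"
      proof eventually_elim
        case (elim n)
        show ?case
        proof
          fix z assume z: "z \<in> H.ops.spec ?A"
          define t where "t = Re z"
          have t: "0 \<le> t" "z = complex_of_real t"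
            using gram_spec_nonneg[OF T z] gram_spec_real[OF T z] by (auto simp: t_def)
          have "?g n z - cpowr (1 - \<alpha>) z = complex_of_real (cutoff \<alpha> n t * t * cutoff \<alpha> n t - t powr (1 - \<alpha>))"
            by (simp add: t(2) ccutoff_def cpowr_def)
          then have "dist (?g n z) (cpowr (1 - \<alpha>) z) = \<bar>cutoff \<alpha> n t * t * cutoff \<alpha> n t - t powr (1 - \<alpha>)\<bar>"
            by (simp only: dist_norm norm_of_real)
          also have "\<dots> \<le> (1 / real (Suc n)) powr (1 - \<alpha>)" by (rule cutoff_square_approx[OF \<alpha> t(1)])
          finally show "dist (?g n z) (cpowr (1 - \<alpha>) z) < e" using elim by linarith
        qed
      qed
    qed
  qed
  ultimately show ?thesis by (simp add: LIMSEQ_unique)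
qed

section \<open>Intertwining of two functional calculi\<close>

lemma intertwine_peval:
  assumes "\<And>x. T (app A x) = app B (T x)" and T: "T \<in> adjointable ipH ipK"
  shows "T (app (peval p A) x) = app (peval p B) (T x)"
proof (induction p)
  case 0
  then show ?case using adjointable_scaleC[OF T, of 0 0] by simp
next
  case (pCons c p)
  then show ?case by (simp add: peval_pCons adjointable_add[OF T] adjointable_scaleC[OF T] assms(1))
qed

lemma intertwine_cfun:
  assumes T: "T \<in> adjointable ipH ipK"
    and A: "H.ops.positive A" and B: "K.ops.positive B" and AB: "\<And>x. T (app A x) = app B (T x)"
    and g: "continuous_on {z. 0 \<le> Re z} g"
  shows "T (app (H.ops.cfun A g) x) = app (K.ops.cfun B g) (T x)"
proof -
  interpret Tl: bounded_linear T by (rule adjointable_bounded_linear[OF T])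
  \<comment> \<open>An interval containing both spectra, so that one polynomial sequence serves A
    and B simultaneously.\<close>
  define M where "M = max (norm A) (norm B)"
  let ?S = "complex_of_real ` {0..M}"
  have S: "H.ops.spec A \<subseteq> ?S" "K.ops.spec B \<subseteq> ?S"
    using H.ops.positive_spec_subset[OF A] K.ops.positive_spec_subset[OF B] by (auto simp: M_def)
  have "continuous_on ?S g" by (rule continuous_on_subset[OF g]) auto
  then obtain p where p: "uniform_limit ?S (\<lambda>n. poly (p n)) g sequentially"
    using weierstrass_sequence[OF compact_of_real_Icc _ \<open>continuous_on ?S g\<close>] by fastforce
  have "(\<lambda>n. peval (p n) A) \<longlonglongrightarrow> H.ops.cfun A g"
    using A by (intro H.ops.cfun_limit uniform_limit_on_subset[OF p S(1)]) (auto simp: H.ops.positive_def)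
  then have "(\<lambda>n. T (app (peval (p n) A) x)) \<longlonglongrightarrow> T (app (H.ops.cfun A g) x)"
    by (intro Tl.tendsto tendsto_app tendsto_const)
  moreover have "(\<lambda>n. peval (p n) B) \<longlonglongrightarrow> K.ops.cfun B g"
    using B by (intro K.ops.cfun_limit uniform_limit_on_subset[OF p S(2)]) (auto simp: K.ops.positive_def)
  then have "(\<lambda>n. app (peval (p n) B) (T x)) \<longlonglongrightarrow> app (K.ops.cfun B g) (T x)"
    by (intro tendsto_app tendsto_const)
  ultimately show ?thesis by (simp add: intertwine_peval[OF AB T] LIMSEQ_unique)
qed

text \<open>The exponent is halved because |T| is the square root of T* T.\<close>

lemma op_powr_op_abs:
  assumes T: "T \<in> adjointable ipH ipK" and "0 < \<beta>"
  shows "op_powr ipH (op_abs ipH ipK T) \<beta> = app (H.ops.cfun (gram ipH ipK T) (cpowr (\<beta> / 2)))"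
proof -
  have "op_abs ipH ipK T = app (H.ops.cfun (gram ipH ipK T) (cpowr (1 / 2)))"
    unfolding op_abs_def using H.op_powr_app[OF positive_gram[OF T], of "1 / 2"]
    by (simp add: gram_def adjoint_compose_mem(2)[OF T])
  then show ?thesis
    using H.op_powr_app[OF H.ops.cfun_cpowr_cpowr(1)[OF positive_gram[OF T], of "1 / 2"] \<open>0 < \<beta>\<close>]
      H.ops.cfun_cpowr_cpowr(2)[OF positive_gram[OF T], of "1 / 2" \<beta>] \<open>0 < \<beta>\<close> by simp
qed

end

theorem theorem3p1:
  fixes actH :: "'h::{complex_normed_vector, banach} \<Rightarrow> 'a::c_star_algebra \<Rightarrow> 'h"
    and ipH :: "'h \<Rightarrow> 'h \<Rightarrow> 'a"
    and actK :: "'k::{complex_normed_vector, banach} \<Rightarrow> 'a \<Rightarrow> 'k"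
    and ipK :: "'k \<Rightarrow> 'k \<Rightarrow> 'a"
    and T :: "'h \<Rightarrow> 'k" and \<alpha> :: real
  assumes "hilbert_module actH ipH" and "hilbert_module actK ipK"
    and "T \<in> adjointable ipH ipK"
    and "0 < \<alpha>" and "\<alpha> < 1"
  shows "\<exists>U\<in>adjointable ipH ipK.
      T = U \<circ> op_powr ipH (op_abs ipH ipK T) \<alpha> \<and>
      module_adj ipH ipK T = module_adj ipH ipK U \<circ> op_powr ipK (op_abs ipK ipH (module_adj ipH ipK T)) \<alpha> \<and>
      module_adj ipH ipK U \<circ> U = op_powr ipH (op_abs ipH ipK T) (2 * (1 - \<alpha>)) \<and>
      U \<circ> module_adj ipH ipK U = op_powr ipK (op_abs ipK ipH (module_adj ipH ipK T)) (2 * (1 - \<alpha>)) \<and>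
      (\<forall>\<beta>>0. U \<circ> op_powr ipH (op_abs ipH ipK T) \<beta> = op_powr ipK (op_abs ipK ipH (module_adj ipH ipK T)) \<beta> \<circ> U)"
proof -
  interpret P: hilbert_module_pair actH ipH actK ipK
    using assms(1,2) by (simp add: hilbert_module_pair_def)
  interpret Q: hilbert_module_pair actK ipK actH ipH
    using assms(1,2) by (simp add: hilbert_module_pair_def)
  note T = assms(3) and \<alpha> = assms(4,5)
  define T' where "T' = module_adj ipH ipK T"
  have T': "T' \<in> adjointable ipK ipH" unfolding T'_def by (rule P.module_adj_mem[OF T])
  \<comment> \<open>Identifies B as T T*, so that T A = B T is associativity.\<close>
  have T'': "module_adj ipK ipH T' = T"
    unfolding T'_def by (rule Q.module_adj_unique) (rule P.adjoint_eq'[OF T])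
  define A where "A = gram ipH ipK T"
  define B where "B = gram ipK ipH T'"
  have TA: "T (app A x) = app B (T x)" for x
    by (simp add: A_def B_def P.app_gram[OF T] Q.app_gram[OF T'] T'' flip: T'_def)
  have posA: "P.H.ops.positive A" and posB: "P.K.ops.positive B"
    unfolding A_def B_def by (rule P.positive_gram[OF T], rule Q.positive_gram[OF T'])
  note intertwine = P.intertwine_cfun[OF T posA posB TA]
  define U where "U = P.phase \<alpha> T"
  define V where "V = Q.phase \<alpha> T'"
  note limU = P.phase_tendsto[OF T \<alpha>, folded A_def U_def]
  note limV = Q.phase_tendsto[OF T' \<alpha>, folded B_def V_def]
  interpret A: functional_calculus "adj_ops ipH" "adj_star ipH" 4 A "P.H.ops.cfun A"
    unfolding A_def by (rule P.gram_calculus[OF T])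
  interpret B: functional_calculus "adj_ops ipK" "adj_star ipK" 4 B "P.K.ops.cfun B"
    unfolding B_def by (rule Q.gram_calculus[OF T'])
  \<comment> \<open>At stage n: T f_n(A) = f_n(B) T and f_n(B) is selfadjoint, so T f_n(A) has
    adjoint T* f_n(B). The limits inherit the relation, which makes U adjointable.\<close>
  have UV: "ipK (U x) y = ipH x (V y)" for x y
  proof -
    have "ipK (T (app (P.H.ops.cfun A (ccutoff \<alpha> n)) x)) y = ipH x (T' (app (P.K.ops.cfun B (ccutoff \<alpha> n)) y))" for n
    proof -
      let ?G = "P.K.ops.cfun B (ccutoff \<alpha> n)"
      have G: "?G \<in> adj_ops ipK" by (intro B.calc_mem continuous_intros)
      have "(\<lambda>z. cnj (ccutoff \<alpha> n z)) = ccutoff \<alpha> n" by (auto simp: ccutoff_def)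
      then have sG: "adj_star ipK ?G = ?G" using B.calc_cnj[of "ccutoff \<alpha> n"] by (simp add: continuous_intros)
      have "ipK (T (app (P.H.ops.cfun A (ccutoff \<alpha> n)) x)) y = ipK (app ?G (T x)) y"
        by (simp add: intertwine continuous_intros)
      also have "\<dots> = ipK (T x) (app ?G y)" using P.K.ip_app[OF G] sG by simp
      finally show ?thesis by (simp add: P.adjoint_eq[OF T] T'_def)
    qed
    moreover have "(\<lambda>n. ipK (T (app (P.H.ops.cfun A (ccutoff \<alpha> n)) x)) y) \<longlonglongrightarrow> ipK (U x) y"
      by (intro P.K.tendsto_ip limU tendsto_const)
    moreover have "(\<lambda>n. ipH x (T' (app (P.K.ops.cfun B (ccutoff \<alpha> n)) y))) \<longlonglongrightarrow> ipH x (V y)"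
      by (intro P.H.tendsto_ip limV tendsto_const)
    ultimately show ?thesis by (simp add: LIMSEQ_unique)
  qed
  then have U: "U \<in> adjointable ipH ipK" by (auto simp: adjointable_def)
  have adjU: "module_adj ipH ipK U = V" by (rule P.module_adj_unique[OF UV])
  have powA: "op_powr ipH (op_abs ipH ipK T) \<beta> = app (P.H.ops.cfun A (cpowr (\<beta> / 2)))" if "0 < \<beta>" for \<beta>
    unfolding A_def by (rule P.op_powr_op_abs[OF T that])
  have powB: "op_powr ipK (op_abs ipK ipH T') \<beta> = app (P.K.ops.cfun B (cpowr (\<beta> / 2)))" if "0 < \<beta>" for \<beta>
    unfolding B_def by (rule Q.op_powr_op_abs[OF T' that])
  have 1: "T = U \<circ> op_powr ipH (op_abs ipH ipK T) \<alpha>"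
    using P.phase_cpowr[OF T \<alpha>] by (auto simp: powA \<alpha> U_def A_def)
  have 2: "T' = V \<circ> op_powr ipK (op_abs ipK ipH T') \<alpha>"
    using Q.phase_cpowr[OF T' \<alpha>] by (auto simp: powB \<alpha> V_def B_def)
  have pos2: "0 < 2 * (1 - \<alpha>)" and half: "2 * (1 - \<alpha>) / 2 = 1 - \<alpha>" using \<alpha> by simp_all
  have 3: "V \<circ> U = op_powr ipH (op_abs ipH ipK T) (2 * (1 - \<alpha>))"
  proof
    fix x
    \<comment> \<open>Pairing with an arbitrary vector and moving V across turns this into
      \<open>ip_phase_phase\<close>.\<close>
    have "V (U x) = app (P.H.ops.cfun A (cpowr (1 - \<alpha>))) x"
      by (rule P.H.ip_right_cancel) (simp add: U_def A_def P.ip_phase_phase[OF T \<alpha>] flip: UV)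
    then show "(V \<circ> U) x = op_powr ipH (op_abs ipH ipK T) (2 * (1 - \<alpha>)) x"
      by (simp only: powA[OF pos2] half o_apply)
  qed
  have VU: "ipH (V y) x = ipK y (U x)" for x y by (metis UV P.H.cstar_ip P.K.cstar_ip)
  have 4: "U \<circ> V = op_powr ipK (op_abs ipK ipH T') (2 * (1 - \<alpha>))"
  proof
    fix y
    have "U (V y) = app (P.K.ops.cfun B (cpowr (1 - \<alpha>))) y"
      by (rule P.K.ip_right_cancel) (simp add: V_def B_def Q.ip_phase_phase[OF T' \<alpha>] flip: VU)
    then show "(U \<circ> V) y = op_powr ipK (op_abs ipK ipH T') (2 * (1 - \<alpha>)) y"
      by (simp only: powB[OF pos2] half o_apply)
  qed
  have 5: "U \<circ> op_powr ipH (op_abs ipH ipK T) \<beta> = op_powr ipK (op_abs ipK ipH T') \<beta> \<circ> U" if "0 < \<beta>" for \<beta>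
  proof
    fix x
    let ?p = "cpowr (\<beta> / 2)" and ?F = "\<lambda>n. P.H.ops.cfun A (ccutoff \<alpha> n)"
    have p: "continuous_on {z. 0 \<le> Re z} ?p" using that by (intro continuous_on_cpowr) auto
    then have pA: "continuous_on (P.H.ops.spec A) ?p"
      by (rule continuous_on_subset) (use posA in \<open>auto simp: P.H.ops.positive_def\<close>)
    \<comment> \<open>Functions of A commute, so the power is moved next to T, where it can be
      exchanged for the same power of B.\<close>
    have "?F n * P.H.ops.cfun A ?p = P.H.ops.cfun A ?p * ?F n" for n
      using A.calc_mult[OF pA, of "ccutoff \<alpha> n"] A.calc_mult[OF _ pA, of "ccutoff \<alpha> n"]
      by (simp add: mult.commute continuous_intros)
    then have "T (app (?F n) (app (P.H.ops.cfun A ?p) x)) = app (P.K.ops.cfun B ?p) (T (app (?F n) x))" for n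
      using intertwine[OF p] by (metis app_simps(6))
    moreover have "(\<lambda>n. T (app (?F n) (app (P.H.ops.cfun A ?p) x))) \<longlonglongrightarrow> U (app (P.H.ops.cfun A ?p) x)"
      by (rule limU)
    moreover have "(\<lambda>n. app (P.K.ops.cfun B ?p) (T (app (?F n) x))) \<longlonglongrightarrow> app (P.K.ops.cfun B ?p) (U x)"
      by (intro tendsto_app tendsto_const limU)
    ultimately have "U (app (P.H.ops.cfun A ?p) x) = app (P.K.ops.cfun B ?p) (U x)" by (simp add: LIMSEQ_unique)
    then show "(U \<circ> op_powr ipH (op_abs ipH ipK T) \<beta>) x = (op_powr ipK (op_abs ipK ipH T') \<beta> \<circ> U) x"
      using that by (simp add: powA powB)
  qed
  show ?thesis
    using U 1 2 3 4 5 by (intro bexI[of _ U]) (auto simp: adjU simp flip: T'_def)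
qed

end
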